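(* Let $d\ge1$ and $p\ge d+1$ be integers. With $q,r,h$ and $G$ as in the context, for $\tau\in[0,1]$ let $\alpha_G(p,d,\tau)$ be the largest $\alpha>0$ such that $r(\tau)\alpha^{-1}\ge G(1-\alpha^{-1},\tau)$. Then $\alpha_G(p,d,\tau)$ is given as follows. (I) For $d=1$: 1. $\alpha_G(p,1,\tau)=\alpha$ with $\alpha=\frac{p-1+(1-\tau^2)^2}{2\tau^2+(1-\tau^2)^2}$, if this $\alpha$ satisfies $(1-\alpha^{-1})(1-\tau^2)^2+2\tau^2\ge\frac{p-1}{p}$; 2. otherwise, $\alpha_G(p,1,\tau)=p$, in which case $\alpha=p$ satisfies $(1-\alpha^{-1})(1-\tau^2)^2+2\tau^2\le\frac{p-1}{p}$. (II) For $d\ge2$ and $h(\tau)\ge1$: 1. $\alpha_G(p,d,\tau)=\alpha$ if $\alpha$ is the larger root of $\frac{r(\tau)}{\alpha}=2(q(\tau)+d\tau^2)-\frac{1}{(1-\alpha^{-1})d}$ and satisfies $1-\alpha^{-1}\ge\frac{1}{dq(\tau)}$; 2. otherwise, $\alpha_G(p,d,\tau)=\alpha$ if $\alpha=\frac{dq^2(\tau)+r(\tau)}{dq^2(\tau)+2d\tau^2}$ satisfies $\frac{2-h(\tau)}{dq(\tau)}\le1-\alpha^{-1}\le\frac{1}{dq(\tau)}$; 3. otherwise, $\alpha_G(p,d,\tau)=\alpha$ if $\alpha=\frac{r(\tau)}{2(q(\tau)+d\tau^2)-q(\tau)h(\tau)}$ satisfies $1-\alpha^{-1}\le\frac{2-h(\tau)}{dq(\tau)}$.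 (III) For $d\ge2$ and $h(\tau)\le1$: 1. $\alpha_G(p,d,\tau)=\alpha$ if $\alpha$ is the larger root of $\frac{r(\tau)}{\alpha}=2(q(\tau)+d\tau^2)-\frac{1}{(1-\alpha^{-1})d}$ and satisfies $1-\alpha^{-1}\ge\frac{1}{dq(\tau)h(\tau)}$; 2. otherwise, $\alpha_G(p,d,\tau)=\alpha$ if $\alpha=\frac{r(\tau)}{2(q(\tau)+d\tau^2)-q(\tau)h(\tau)}$ satisfies $1-\alpha^{-1}\le\frac{1}{dq(\tau)h(\tau)}$. Moreover, $\alpha_G(p,d):=\max_{0\le\tau\le1}\alpha_G(p,d,\tau)$ satisfies $$\alpha_G(p,1)=p\quad\text{for all }p\ge2,$$ $$\alpha_G(p,d)>1\quad\text{whenever } p\ge d+2,\ d\ge2,\ \text{ or } p=d+1,\ d\in\{2,3\}.$$ Finally, let $n\ge2$, let $A\in\mathbb{R}^{nd\times nd}$ be symmetric, $Z\in\mathrm{O}(d)^{\otimes n}$ and $L=\mathrm{BDG}(AZZ^\top)-A$ with $LZ=0$, $L\succeq0$, $\lambda_{d+1}(L)>0$. If $$\frac{\lambda_{\max}(L)}{\lambda_{d+1}(L)}<\alpha_G(p,d),$$ then the landscape is benign: every second-order critical point $S$ of $\min_{S\in\mathrm{St}(p,d)^{\otimes n}}-\langle A,SS^\top\rangle$ is a global minimizer satisfying $SS^\top=ZZ^\top$.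
   Context: $r(\tau)=2(d-1)\tau^2+p-d$ and $q(\tau)=(d-2)\tau^2-2(d-1)\tau+d$. For $d\ge2$, $$h(\tau)=\begin{cases}2-\frac{d}{d+1}+\frac{pd}{pd-1}\cdot\frac{\tau^2}{q(\tau)},&p=d+1,\\ \frac{p}{d(p-d)}+\frac{pd}{pd-1}\cdot\frac{\tau^2}{q(\tau)},&p\ge d+2.\end{cases}$$ The function $G(x,\tau)$ ($x<1$ real, $\tau\in[0,1]$) is defined by: for $d=1$, $G(x,\tau)=\max\{x(1-\tau^2)^2+2\tau^2,\ \frac{p-1}{p}\}$; for $d\ge2$, $$G(x,\tau)=\begin{cases}2q(\tau)+2d\tau^2-\frac{1}{xd},& xdq(\tau)\ge\max\{1,1/h(\tau)\},\\ xdq^2(\tau)+2d\tau^2,& 2-h(\tau)\le xdq(\tau)\le1,\\ 2q(\tau)+2d\tau^2-q(\tau)h(\tau),&\text{otherwise.}\end{cases}$$ At $\tau=1$, where $q(1)=0$, use the limits as $\tau\to1^-$: $h(1)=+\infty$, $1/q(1)=+\infty$, $(2-h(1))/(dq(1))=-\infty$ (so item (II)2 applies and the second case of $G$ applies). $\mathrm{O}(d)$ is the group of $d\times d$ orthogonal matrices, $\mathrm{St}(p,d)=\{X\in\mathbb{R}^{d\times p}:XX^\top=I_d\}$. Elements of $\mathrm{O}(d)^{\otimes n}\subset\mathbb{R}^{nd\times d}$ and $\mathrm{St}(p,d)^{\otimes n}\subset\mathbb{R}^{nd\times p}$ are vertical concatenations of $n$ blocks. $\mathrm{BDG}(X)=\mathrm{blkdiag}\big(\tfrac{X_{11}+X_{11}^\top}{2},\dots,\tfrac{X_{nn}+X_{nn}^\top}{2}\big)$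 for $X\in\mathbb{R}^{nd\times nd}$ with $d\times d$ blocks $X_{ij}$. $\langle X,Y\rangle=\mathrm{Tr}(XY^\top)$. $\lambda_k$ is the $k$-th smallest eigenvalue, $\lambda_{\max}$ the largest. A second-order critical point is a point with vanishing Riemannian gradient and positive semidefinite Riemannian Hessian ($\mathrm{St}(p,d)^{\otimes n}$ embedded in $\mathbb{R}^{nd\times p}$ with the Frobenius inner product). *)

theory Defs
  imports "HOL-Analysis.Analysis"
begin

section \<open>The threshold\<close>

definition r_fun :: "nat \<Rightarrow> nat \<Rightarrow> real \<Rightarrow> real" where
  "r_fun p d \<tau> = 2 * (real d - 1) * \<tau>\<^sup>2 + real p - real d"

definition q_fun :: "nat \<Rightarrow> real \<Rightarrow> real" where
  "q_fun d \<tau> = (real d - 2) * \<tau>\<^sup>2 - 2 * (real d - 1) * \<tau> + real d"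

text \<open>
  The function \<open>h\<close> and the thresholds built from it are extended reals, so that the
  limit conventions at \<open>\<tau> = 1\<close>, where \<open>q = 0\<close>, can be stated:
  \<open>h(1) = \<infinity>\<close>.  Division in \<^typ>\<open>ereal\<close> satisfies \<open>1 / 0 = \<infinity>\<close>, \<open>1 / \<infinity> = 0\<close> and
  \<open>-\<infinity> / 0 = -\<infinity>\<close>, in accordance with the limits as \<open>\<tau>\<close> tends to 1 from the left
  (see the lemmas below).
\<close>

definition h_fun :: "nat \<Rightarrow> nat \<Rightarrow> real \<Rightarrow> ereal" where
  "h_fun p d \<tau> =
    (if \<tau> = 1 then \<infinity>
     else ereal ((if p = d + 1 then 2 - real d / (real d + 1)
                  else real p / (real d * (real p - real d)))
            + real p * real d / (real p * real d - 1) * (\<tau>\<^sup>2 / q_fun d \<tau>)))"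

definition G_fun :: "nat \<Rightarrow> nat \<Rightarrow> real \<Rightarrow> real \<Rightarrow> real" where
  "G_fun p d x \<tau> =
    (if d = 1 then max (x * (1 - \<tau>\<^sup>2)\<^sup>2 + 2 * \<tau>\<^sup>2) ((real p - 1) / real p)
     else if max 1 (1 / h_fun p d \<tau>) \<le> ereal (x * real d * q_fun d \<tau>)
       then 2 * q_fun d \<tau> + 2 * real d * \<tau>\<^sup>2 - 1 / (x * real d)
     else if 2 - h_fun p d \<tau> \<le> ereal (x * real d * q_fun d \<tau>) \<and> x * real d * q_fun d \<tau> \<le> 1
       then x * real d * (q_fun d \<tau>)\<^sup>2 + 2 * real d * \<tau>\<^sup>2
     else 2 * q_fun d \<tau> + 2 * real d * \<tau>\<^sup>2 - q_fun d \<tau> * real_of_ereal (h_fun p d \<tau>))"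

lemma q_fun_1: "q_fun d 1 = 0"
  by (simp add: q_fun_def)

lemma threshold_conventions_at_1:
  "1 / ereal (real d * q_fun d 1) = \<infinity>"
  "(2 - h_fun p d 1) / ereal (real d * q_fun d 1) = - \<infinity>"
  "max 1 (1 / h_fun p d 1) = 1"
  by (simp_all add: q_fun_1 h_fun_def divide_ereal_def)

lemma G_fun_at_1: "2 \<le> d \<Longrightarrow> G_fun p d x 1 = 2 * real d"
  by (simp add: G_fun_def q_fun_1 h_fun_def)

definition feasible :: "nat \<Rightarrow> nat \<Rightarrow> real \<Rightarrow> real \<Rightarrow> bool" where
  "feasible p d \<tau> \<alpha> \<longleftrightarrow> 0 < \<alpha> \<and> r_fun p d \<tau> / \<alpha> \<ge> G_fun p d (1 - 1 / \<alpha>) \<tau>"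

definition alphaG :: "nat \<Rightarrow> nat \<Rightarrow> real \<Rightarrow> real" where
  "alphaG p d \<tau> = (GREATEST \<alpha>. feasible p d \<tau> \<alpha>)"

definition alphaG_max :: "nat \<Rightarrow> nat \<Rightarrow> real" where
  "alphaG_max p d = (GREATEST a. \<exists>\<tau>\<in>{0..1}. a = alphaG p d \<tau>)"

text \<open>
  The exclusions \<open>\<alpha> \<noteq> 0\<close> and \<open>\<alpha> \<noteq> 1\<close> say that both sides of the equation are defined.
\<close>

definition alpha_root :: "nat \<Rightarrow> nat \<Rightarrow> real \<Rightarrow> real \<Rightarrow> bool" where
  "alpha_root p d \<tau> \<alpha> \<longleftrightarrow> \<alpha> \<noteq> 0 \<and> \<alpha> \<noteq> 1 \<and>
     r_fun p d \<tau> / \<alpha> = 2 * (q_fun d \<tau> + real d * \<tau>\<^sup>2) - 1 / ((1 - 1 / \<alpha>) * real d)"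

definition larger_root :: "nat \<Rightarrow> nat \<Rightarrow> real \<Rightarrow> real \<Rightarrow> bool" where
  "larger_root p d \<tau> \<alpha> \<longleftrightarrow> alpha_root p d \<tau> \<alpha> \<and> (\<forall>\<beta>. alpha_root p d \<tau> \<beta> \<longrightarrow> \<beta> \<le> \<alpha>)"


section \<open>Block matrices\<close>

text \<open>
  With \<open>n\<close>, \<open>d\<close> and \<open>p\<close> the cardinalities of the index types, a row index of an \<open>nd \<times> m\<close>
  matrix is a pair: block number and position inside the block.  The inner product
  of the library on matrices is the Frobenius inner product (\<open>inner_eq_trace\<close> below).
\<close>

definition row_block :: "real^'m^('n::finite \<times> 'd::finite) \<Rightarrow> 'n \<Rightarrow> real^'m^'d" where
  "row_block X i = (\<chi> a. X $ (i, a))"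

definition block :: "real^('n::finite \<times> 'd::finite)^('n \<times> 'd) \<Rightarrow> 'n \<Rightarrow> 'n \<Rightarrow> real^'d^'d" where
  "block X i j = (\<chi> a b. X $ (i, a) $ (j, b))"

definition BDG :: "real^('n::finite \<times> 'd::finite)^('n \<times> 'd) \<Rightarrow> real^('n \<times> 'd)^('n \<times> 'd)" where
  "BDG X = (\<chi> k l. if fst k = fst l
     then ((1/2) *\<^sub>R (block X (fst k) (fst k) + transpose (block X (fst k) (fst k)))) $ snd k $ snd l
     else 0)"

definition orthogonal_blocks :: "(real^'d^('n::finite \<times> 'd::finite)) set" where
  "orthogonal_blocks = {Z. \<forall>i. orthogonal_matrix (row_block Z i)}"

definition stiefel_blocks :: "(real^'p^('n::finite \<times> 'd::finite)) set" where
  "stiefel_blocks = {S. \<forall>i. row_block S i ** transpose (row_block S i) = mat 1}"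

lemma inner_eq_trace:
  fixes X Y :: "real^'m::finite^'k::finite"
  shows "X \<bullet> Y = trace (X ** transpose Y)"
  by (simp add: inner_vec_def trace_def matrix_matrix_mult_def transpose_def)


section \<open>Spectrum of a symmetric matrix\<close>

definition eigenvalues :: "real^'m^'m \<Rightarrow> real set" where
  "eigenvalues L = {\<mu>. \<exists>v. v \<noteq> 0 \<and> L *v v = \<mu> *\<^sub>R v}"

text \<open>
  Multiplicities are geometric; for symmetric matrices these are also the algebraic ones.
\<close>

definition spectrum_list :: "real^'m^'m \<Rightarrow> real list" where
  "spectrum_list L =
     concat (map (\<lambda>\<mu>. replicate (dim {v. L *v v = \<mu> *\<^sub>R v}) \<mu>)
       (sorted_list_of_set (eigenvalues L)))"

definition lambda :: "nat \<Rightarrow> real^'m^'m \<Rightarrow> real" where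
  "lambda k L = spectrum_list L ! (k - 1)"

definition lambda_max :: "real^'m^'m \<Rightarrow> real" where
  "lambda_max L = Max (eigenvalues L)"

definition psd :: "real^'m^'m \<Rightarrow> bool" where
  "psd L \<longleftrightarrow> transpose L = L \<and> (\<forall>v. 0 \<le> v \<bullet> (L *v v))"


section \<open>Second-order critical points on the product of Stiefel manifolds\<close>

text \<open>
  Kernel of the differential at \<open>S\<close> of the defining map, whose \<open>i\<close>-th component sends
  \<open>S\<close> to \<open>S\<^sub>i S\<^sub>i\<^sup>T\<close>.
\<close>

definition tangent_space :: "real^'p^('n::finite \<times> 'd::finite) \<Rightarrow> (real^'p^('n \<times> 'd)) set" where
  "tangent_space S = {V. \<forall>i. row_block V i ** transpose (row_block S i)
                           + row_block S i ** transpose (row_block V i) = 0}"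

text \<open>
  For \<open>S\<close> on the manifold this is the orthogonal projection onto the tangent space
  (\<open>tangent_proj_orthogonal\<close> below).  The same formula, used for all \<open>S\<close>, extends
  the Riemannian gradient smoothly to the ambient space.
\<close>

definition tangent_proj ::
    "real^'p^('n::finite \<times> 'd::finite) \<Rightarrow> real^'p^('n \<times> 'd) \<Rightarrow> real^'p^('n \<times> 'd)" where
  "tangent_proj S X = X - BDG (X ** transpose S) ** S"

lemma row_block_mult: "row_block (X ** Y) i = row_block X i ** Y"
  by (simp add: row_block_def matrix_matrix_mult_def vec_eq_iff)

lemma row_block_diff: "row_block (X - Y) i = row_block X i - row_block Y i"
  by (simp add: row_block_def vec_eq_iff)

lemma block_mult_transpose:
  "block (X ** transpose Y) i j = row_block X i ** transpose (row_block Y j)"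
  by (simp add: row_block_def block_def matrix_matrix_mult_def transpose_def vec_eq_iff)

lemma inner_row_block: "X \<bullet> Y = (\<Sum>i\<in>UNIV. row_block X i \<bullet> row_block Y i)"
  by (simp add: row_block_def inner_vec_def UNIV_Times_UNIV[symmetric] sum.cartesian_product'
      del: UNIV_Times_UNIV)

lemma row_block_BDG_mult:
  "row_block (BDG M ** S) i =
     ((1/2) *\<^sub>R (block M i i + transpose (block M i i))) ** row_block S i"
proof -
  have "(\<Sum>k\<in>UNIV. BDG M $ (i, a) $ k * S $ k $ b) =
        (\<Sum>c\<in>UNIV. ((1/2) *\<^sub>R (block M i i + transpose (block M i i))) $ a $ c * S $ (i, c) $ b)"
    for a b
  proof -
    have "(\<Sum>k\<in>UNIV. BDG M $ (i, a) $ k * S $ k $ b)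
        = (\<Sum>j\<in>UNIV. \<Sum>c\<in>UNIV. BDG M $ (i, a) $ (j, c) * S $ (j, c) $ b)"
      by (simp add: UNIV_Times_UNIV[symmetric] sum.cartesian_product del: UNIV_Times_UNIV)
    also have "\<dots> = (\<Sum>j\<in>UNIV. if j = i then
         (\<Sum>c\<in>UNIV. ((1/2) *\<^sub>R (block M i i + transpose (block M i i))) $ a $ c * S $ (i, c) $ b) else 0)"
      by (intro sum.cong) (auto simp: BDG_def)
    finally show ?thesis by simp
  qed
  then show ?thesis
    by (simp add: row_block_def matrix_matrix_mult_def vec_eq_iff)
qed

lemma inner_transpose_matrix:
  fixes X Y :: "real^'m::finite^'k::finite"
  shows "transpose X \<bullet> transpose Y = X \<bullet> Y"
  by (simp add: inner_vec_def transpose_def) (rule sum.swap)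

lemma inner_mult_left_matrix:
  fixes M :: "real^'k::finite^'l::finite" and S :: "real^'m::finite^'k" and V :: "real^'m^'l"
  shows "(M ** S) \<bullet> V = M \<bullet> (V ** transpose S)"
  by (simp add: inner_eq_trace matrix_transpose_mul matrix_mul_assoc)

lemma bounded_bilinear_matrix_mult:
  "bounded_bilinear ((**) :: real^'k::finite^'l::finite \<Rightarrow> real^'m::finite^'k \<Rightarrow> real^'m^'l)"
proof -
  have "bilinear ((**) :: real^'k^'l \<Rightarrow> real^'m^'k \<Rightarrow> real^'m^'l)"
    by (simp add: bilinear_def linear_iff matrix_matrix_mult_def vec_eq_iff
        sum.distrib sum_distrib_left algebra_simps)
  then show ?thesis by (simp add: bilinear_conv_bounded_bilinear)
qed

lemma bounded_linear_transpose_real: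
  "bounded_linear (transpose :: real^'k::finite^'l::finite \<Rightarrow> real^'l^'k)"
  by (simp add: linear_conv_bounded_linear[symmetric] linear_iff transpose_def vec_eq_iff)

lemma tangent_proj_orthogonal:
  assumes "S \<in> stiefel_blocks"
  shows "tangent_proj S X \<in> tangent_space S"
    and "V \<in> tangent_space S \<Longrightarrow> (X - tangent_proj S X) \<bullet> V = 0"
proof -
  let ?M = "\<lambda>i. (1/2) *\<^sub>R (row_block X i ** transpose (row_block S i)
                     + row_block S i ** transpose (row_block X i))"
  have M: "row_block (BDG (X ** transpose S) ** S) i = ?M i ** row_block S i" for i
    by (simp add: row_block_BDG_mult block_mult_transpose matrix_transpose_mul)
  have Mt: "transpose (?M i) = ?M i" for i
    by (simp add: vec_eq_iff transpose_def matrix_matrix_mult_def mult.commute)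
  have S: "row_block S i ** transpose (row_block S i) = mat 1" for i
    using assms by (simp add: stiefel_blocks_def)
  show "tangent_proj S X \<in> tangent_space S"
  proof -
    have "(row_block X i - ?M i ** row_block S i) ** transpose (row_block S i)
        = row_block X i ** transpose (row_block S i) - ?M i" for i
      by (simp only: bounded_bilinear.diff_left[OF bounded_bilinear_matrix_mult]
          matrix_mul_assoc[symmetric] S matrix_mul_rid)
    moreover have "row_block S i ** transpose (row_block X i - ?M i ** row_block S i)
        = row_block S i ** transpose (row_block X i) - ?M i" for i
    proof -
      have "transpose (row_block X i - ?M i ** row_block S i)
          = transpose (row_block X i) - transpose (row_block S i) ** ?M i"
        using matrix_transpose_mul[of "?M i" "row_block S i"]
        by (simp only: Mt linear_diff[OF bounded_linear.linear[OF bounded_linear_transpose_real]])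
      then show ?thesis
        by (simp only: bounded_bilinear.diff_right[OF bounded_bilinear_matrix_mult]
          matrix_mul_assoc S matrix_mul_lid)
    qed
    moreover have "(P - (1/2) *\<^sub>R (P + Q)) + (Q - (1/2) *\<^sub>R (P + Q)) = 0"
      for P Q :: "real^'c^'c"
      by (simp add: vec_eq_iff field_simps)
    ultimately show ?thesis
      by (simp only: tangent_space_def tangent_proj_def row_block_diff M mem_Collect_eq) blast
  qed
  show "(X - tangent_proj S X) \<bullet> V = 0" if V: "V \<in> tangent_space S"
  proof -
    have "(?M i ** row_block S i) \<bullet> row_block V i = 0" for i
    proof -
      let ?W = "row_block V i ** transpose (row_block S i)"
      have "?W + transpose ?W = 0"
        using V by (simp add: tangent_space_def matrix_transpose_mul)
      then have "transpose ?W = - ?W" by (simp add: add_eq_0_iff)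
      then have "?M i \<bullet> ?W = - (?M i \<bullet> ?W)"
        using inner_transpose_matrix[of "?M i" ?W] by (simp only: Mt inner_minus_right)
      then show ?thesis by (simp only: inner_mult_left_matrix)
    qed
    then show ?thesis by (simp add: tangent_proj_def inner_row_block M)
  qed
qed

definition euclidean_grad :: "('a::real_inner \<Rightarrow> real) \<Rightarrow> 'a \<Rightarrow> 'a" where
  "euclidean_grad f x = (THE g. GDERIV f x :> g)"

definition riem_grad ::
    "(real^'p^('n::finite \<times> 'd::finite) \<Rightarrow> real) \<Rightarrow> real^'p^('n \<times> 'd) \<Rightarrow> real^'p^('n \<times> 'd)" where
  "riem_grad f S = tangent_proj S (euclidean_grad f S)"

text \<open>
  On a Riemannian submanifold of a Euclidean space the Hessian along a tangent vector is the
  tangential part of the directional derivative of any smooth extension of the gradient field.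
\<close>

definition riem_hess ::
    "(real^'p^('n::finite \<times> 'd::finite) \<Rightarrow> real) \<Rightarrow> real^'p^('n \<times> 'd)
       \<Rightarrow> real^'p^('n \<times> 'd) \<Rightarrow> real^'p^('n \<times> 'd)" where
  "riem_hess f S V = tangent_proj S (frechet_derivative (riem_grad f) (at S) V)"

definition second_order_critical ::
    "(real^'p^('n::finite \<times> 'd::finite) \<Rightarrow> real) \<Rightarrow> real^'p^('n \<times> 'd) \<Rightarrow> bool" where
  "second_order_critical f S \<longleftrightarrow>
     S \<in> stiefel_blocks \<and> riem_grad f S = 0 \<and>
     (\<forall>V\<in>tangent_space S. 0 \<le> V \<bullet> riem_hess f S V)"

definition objective :: "real^('n::finite \<times> 'd::finite)^('n \<times> 'd) \<Rightarrow> real^'p^('n \<times> 'd) \<Rightarrow> real" where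
  "objective A S = - (A \<bullet> (S ** transpose S))"

lemma bounded_linear_BDG: "bounded_linear BDG"
  by (simp add: linear_conv_bounded_linear[symmetric] linear_iff)
     (auto simp: BDG_def block_def transpose_def vec_eq_iff algebra_simps)

lemma GDERIV_objective:
  assumes "transpose A = A"
  shows "GDERIV (objective A) S :> (- 2) *\<^sub>R (A ** S)"
proof -
  have D: "((\<lambda>S. S ** transpose S) has_derivative
          (\<lambda>V. S ** transpose V + V ** transpose S)) (at S)"
    by (rule bounded_bilinear.FDERIV[OF bounded_bilinear_matrix_mult has_derivative_ident
          bounded_linear_imp_has_derivative[OF bounded_linear_transpose_real]])
  have "(objective A has_derivative (\<lambda>V. - (A \<bullet> (S ** transpose V + V ** transpose S)))) (at S)"
    unfolding objective_def by (intro derivative_intros D)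
  moreover have "A \<bullet> (S ** transpose V + V ** transpose S) = V \<bullet> (2 *\<^sub>R (A ** S))" for V
  proof -
    have 1: "A \<bullet> (V ** transpose S) = (A ** S) \<bullet> V"
      by (simp add: inner_mult_left_matrix)
    have "A \<bullet> (S ** transpose V) = transpose A \<bullet> transpose (S ** transpose V)"
      by (simp add: inner_transpose_matrix)
    also have "\<dots> = A \<bullet> (V ** transpose S)"
      by (simp add: assms matrix_transpose_mul)
    finally show ?thesis using 1 by (simp add: inner_add_right inner_commute)
  qed
  ultimately show ?thesis by (simp add: gderiv_def)
qed

lemma euclidean_grad_eqI: "GDERIV f x :> g \<Longrightarrow> euclidean_grad f x = g"
  unfolding euclidean_grad_def gderiv_def
  by (rule the_equality, assumption) (metis has_derivative_unique inner_commute vector_eq_ldot)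

lemma riem_grad_objective:
  "transpose A = A \<Longrightarrow> riem_grad (objective A) = (\<lambda>S. tangent_proj S ((- 2) *\<^sub>R (A ** S)))"
  by (simp add: fun_eq_iff riem_grad_def euclidean_grad_eqI[OF GDERIV_objective] del: scaleR_minus_left)

lemma differentiable_matrix_mult:
  fixes F :: "'a::real_normed_vector \<Rightarrow> real^'k::finite^'l::finite"
    and K :: "'a \<Rightarrow> real^'m::finite^'k"
  assumes "F differentiable (at x)" "K differentiable (at x)"
  shows "(\<lambda>x. F x ** K x) differentiable (at x)"
  using assms unfolding differentiable_def
  by (elim exE) (rule exI, rule bounded_bilinear.FDERIV[OF bounded_bilinear_matrix_mult])

lemma riem_grad_objective_differentiable:
  assumes "transpose A = A"
  shows "riem_grad (objective A) differentiable (at S)"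
proof -
  have E: "(\<lambda>S. (- 2) *\<^sub>R (A ** S)) differentiable (at S)"
    by (intro bounded_linear_imp_differentiable bounded_linear_scaleR_right[THEN bounded_linear_compose]
        bounded_bilinear.bounded_linear_right[OF bounded_bilinear_matrix_mult])
  have T: "transpose differentiable (at S)"
    by (rule bounded_linear_imp_differentiable[OF bounded_linear_transpose_real])
  have B: "(\<lambda>S. BDG (F S)) differentiable (at S)" if "F differentiable (at S)" for F
    using that bounded_linear.has_derivative[OF bounded_linear_BDG]
    unfolding differentiable_def by blast
  show ?thesis
    unfolding riem_grad_objective[OF assms] tangent_proj_def
    by (intro differentiable_diff E differentiable_matrix_mult B T differentiable_ident)
qed

end

theory Submission
  imports Defs
begin

text \<open>
  Multiplying the \<open>i\<close>-th block by \<open>Z\<^sub>i\<^sup>T\<close> turns all blocks of \<open>Z\<close> into the identity.  A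
  critical point becomes a configuration \<open>T\<^sub>1, \<dots>, T\<^sub>n\<close> of \<open>d \<times> p\<close> matrices with
  orthonormal rows, and \<open>L\<close> a quadratic form that ignores constant configurations and lies
  between \<open>\<mu>\<close> and \<open>\<alpha>\<mu>\<close> times the squared distance to them (\<open>centered\<close>), where
  \<open>\<mu> = \<lambda>\<^bsub>d+1\<^esub>\<close>.  The landscape is benign if \<open>T\<close> is forced to be constant.

  Criticality gives symmetric multipliers \<open>\<Lambda>\<^sub>i\<close> with \<open>L T = \<Lambda> T\<close> blockwise, and
  \<open>\<Sum>\<^sub>i \<langle>\<Lambda>\<^sub>i V\<^sub>i, V\<^sub>i\<rangle> \<le> \<langle>L V, V\<rangle>\<close> for tangent \<open>V\<close>.  For a fixed \<open>d \<times> p\<close> matrix \<open>\<Phi>\<close> put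
  \<open>\<beta>\<^sub>i(\<Phi>) = (1 - \<tau>) \<Phi> T\<^sub>i\<^sup>T T\<^sub>i + \<tau> T\<^sub>i \<Phi>\<^sup>T T\<^sub>i\<close> (\<open>turn\<close>).  Then \<open>\<Phi> - \<beta>(\<Phi>)\<close> is tangent.
  Summed over an orthonormal basis of matrices \<open>\<Phi>\<close>, the products \<open>V\<^sub>i V\<^sub>i\<^sup>T\<close> add up to
  \<open>r(\<tau>) I\<close>, so the left side becomes \<open>r(\<tau>) \<langle>L T, T\<rangle>\<close> and the multipliers disappear; on the right only
  \<open>\<beta>(\<Phi>)\<close> survives, because \<open>L\<close> ignores constants.  The first-order condition also yields
  \<open>\<langle>L T, \<beta>(\<Phi>)\<rangle> = 0\<close>.  So a multiple of \<open>T\<close> may be subtracted from \<open>\<beta>(\<Phi>)\<close> before \<open>L\<close> is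
  replaced by its upper bound, which costs only a multiple of \<open>\<langle>L T, T\<rangle>\<close>; this is
  \<open>master_inequality\<close>, and optimising that multiple produces the factor \<open>1 - 1/\<alpha>\<close>.

  All terms are then estimated through the mean \<open>m\<close> of the \<open>T\<^sub>i\<close>.  Let \<open>m = H U\<close> be its polar
  decomposition and \<open>s = d - |m|\<^sup>2\<close>, which vanishes exactly for constant configurations.  Bessel's
  inequality bounds the fourth moments from below, by projecting on the row space of \<open>U\<close>
  and on the line of \<open>m\<close>; the alignment of \<open>T\<close> with \<open>\<beta>(U)\<close> is bounded from below by
  \<open>H \<ge> \<surd>(max 0 (1 - s))\<close>.  If \<open>s > 0\<close>, the outcome is an upper bound for \<open>r(\<tau>)/\<alpha>\<close>
  (\<open>critical_bound\<close>).  For \<open>d \<ge> 2\<close> it is at most a convex combination, with weights \<open>min s 1\<close> and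
  \<open>max 0 (1 - s)\<close>, of two quantities whose maximum is \<open>G\<close>; indeed \<open>G\<close> is, up to the summand
  \<open>2 d \<tau>\<^sup>2\<close>, the maximum of a reversed Huber function and of a constant
  (\<open>G_fun_eq_G_max\<close>).  Hence \<open>r(\<tau>)/\<alpha> > G(1 - 1/\<alpha>, \<tau>)\<close> forces \<open>s = 0\<close>.  For \<open>d = 1\<close> the
  same estimate at \<open>\<tau> = 0\<close> suffices, since \<open>\<tau> = 0\<close> already gives the best threshold \<open>p\<close>.

  As to the threshold itself, \<open>r/\<alpha>\<close> decreases strictly in \<open>\<alpha>\<close> and \<open>G(1 - 1/\<alpha>, \<tau>)\<close>
  does not decrease, so the admissible \<open>\<alpha>\<close> form an interval \<open>(0, \<alpha>\<^sub>G]\<close> whose endpoint is the only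
  solution of \<open>r/\<alpha> = G(1 - 1/\<alpha>, \<tau>)\<close>.  The explicit formulas solve this equation on each branch of \<open>G\<close>.
  The maximum over \<open>\<tau>\<close> exists by compactness of the set of admissible pairs.
\<close>

(* Adjoints stay visible as transposes; the default rule rewrites them to row vector products. *)
declare transpose_matrix_vector [simp del]

lemmas matrix_mult_add_left = bounded_bilinear.add_left[OF bounded_bilinear_matrix_mult]
lemmas matrix_mult_add_right = bounded_bilinear.add_right[OF bounded_bilinear_matrix_mult]
lemmas matrix_mult_diff_left = bounded_bilinear.diff_left[OF bounded_bilinear_matrix_mult]
lemmas matrix_mult_diff_right = bounded_bilinear.diff_right[OF bounded_bilinear_matrix_mult]
lemmas matrix_mult_scaleR_left = bounded_bilinear.scaleR_left[OF bounded_bilinear_matrix_mult]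
lemmas matrix_mult_scaleR_right = bounded_bilinear.scaleR_right[OF bounded_bilinear_matrix_mult]
lemmas matrix_mult_sum_left = bounded_bilinear.sum_left[OF bounded_bilinear_matrix_mult]

section \<open>The function \<open>G\<close> as a maximum\<close>

text \<open>
  The value \<open>max {2 u - u\<^sup>2 / y | 0 \<le> u \<le> 1}\<close> for \<open>y > 0\<close>: the identity up to \<open>1\<close>, and
  \<open>2 - 1/y\<close> from there on.  The closed form with \<open>min\<close> and \<open>max\<close> makes continuity and
  monotonicity immediate.
\<close>

definition huber :: "real \<Rightarrow> real" where
  "huber y = min y 1 + 1 - 1 / max y 1"

lemma huber_mono: "y \<le> z \<Longrightarrow> huber y \<le> huber z"
proof -
  assume "y \<le> z"
  then have "1 / max z 1 \<le> 1 / max y 1" "min y 1 \<le> min z 1"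
    by (auto intro!: divide_left_mono simp: max_def min_def)
  then show ?thesis by (simp add: huber_def)
qed

lemma huber_le1: "y \<le> 1 \<Longrightarrow> huber y = y"
  by (simp add: huber_def)

lemma huber_ge1: "1 \<le> y \<Longrightarrow> huber y = 2 - 1 / y"
  by (simp add: huber_def)

lemma huber_pos: "0 < y \<Longrightarrow> 0 < huber y"
  by (cases "y \<le> 1") (simp_all add: huber_le1 huber_ge1 field_simps)

lemma huber_ge:
  assumes "0 < y" "0 \<le> u" "u \<le> 1"
  shows "2 * u - u\<^sup>2 / y \<le> huber y"
proof (cases "y \<le> 1")
  case True
  have "0 \<le> (u - y)\<^sup>2 / y" using assms by simp
  also have "\<dots> = y - (2 * u - u\<^sup>2 / y)"
    using assms by (simp add: field_simps power2_eq_square)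
  finally show ?thesis using True by (simp add: huber_le1)
next
  case False
  have "0 \<le> (1 - u) * (2 * y - 1 - u) / y" using assms False by simp
  also have "\<dots> = 2 - 1 / y - (2 * u - u\<^sup>2 / y)"
    using assms by (simp add: field_simps power2_eq_square)
  finally show ?thesis using False by (simp add: huber_ge1)
qed

text \<open>
  With the next definition, \<open>q h = h_const * q + h_slope * \<tau>\<^sup>2\<close>.  In this form the third
  branch of \<open>G\<close> has no singularity at \<open>\<tau> = 1\<close>.
\<close>

definition h_const :: "nat \<Rightarrow> nat \<Rightarrow> real" where
  "h_const p d = (if p = d + 1 then 2 - real d / (real d + 1)
                  else real p / (real d * (real p - real d)))"

definition h_slope :: "nat \<Rightarrow> nat \<Rightarrow> real" where
  "h_slope p d = real p * real d / (real p * real d - 1)"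

definition G_max :: "nat \<Rightarrow> nat \<Rightarrow> real \<Rightarrow> real \<Rightarrow> real" where
  "G_max p d x \<tau> = 2 * real d * \<tau>\<^sup>2 + max (q_fun d \<tau> * huber (x * real d * q_fun d \<tau>))
     ((2 - h_const p d) * q_fun d \<tau> - h_slope p d * \<tau>\<^sup>2)"

lemma q_fun_eq: "q_fun d \<tau> = (1 - \<tau>) * (real d * (1 - \<tau>) + 2 * \<tau>)"
  by (simp add: q_fun_def power2_eq_square algebra_simps)

lemma q_fun_nonneg: "0 \<le> \<tau> \<Longrightarrow> \<tau> \<le> 1 \<Longrightarrow> 0 \<le> q_fun d \<tau>"
  unfolding q_fun_eq by (intro mult_nonneg_nonneg add_nonneg_nonneg) auto

lemma q_fun_pos:
  assumes "1 \<le> d" "0 \<le> \<tau>" "\<tau> < 1"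
  shows "0 < q_fun d \<tau>"
proof -
  have "0 < real d * (1 - \<tau>)" using assms by simp
  then have "0 < real d * (1 - \<tau>) + 2 * \<tau>" using assms(2) by linarith
  then show ?thesis using assms by (simp add: q_fun_eq)
qed

lemma r_fun_pos: "1 \<le> d \<Longrightarrow> d + 1 \<le> p \<Longrightarrow> 0 < r_fun p d \<tau>"
proof -
  assume "1 \<le> d" "d + 1 \<le> p"
  then have "real d + 1 \<le> real p" "0 \<le> 2 * (real d - 1) * \<tau>\<^sup>2" by simp_all
  then show ?thesis unfolding r_fun_def by linarith
qed

lemma h_const_pos: "1 \<le> d \<Longrightarrow> d + 1 \<le> p \<Longrightarrow> 0 < h_const p d"
  by (auto simp: h_const_def field_simps)

lemma h_slope_gt_1: "1 \<le> d \<Longrightarrow> d + 1 \<le> p \<Longrightarrow> 1 < h_slope p d"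
proof -
  assume "1 \<le> d" "d + 1 \<le> p"
  then have "2 * 1 \<le> p * d" by (intro mult_le_mono) auto
  then have "2 \<le> real (p * d)" by linarith
  then have "1 < real p * real d" by simp
  then show ?thesis unfolding h_slope_def by (simp add: field_simps)
qed

lemma h_slope_le_2: "1 \<le> d \<Longrightarrow> d + 1 \<le> p \<Longrightarrow> h_slope p d \<le> 2"
proof -
  assume "1 \<le> d" "d + 1 \<le> p"
  then have "2 * 1 \<le> p * d" by (intro mult_le_mono) auto
  then have "2 \<le> real (p * d)" by linarith
  then have "2 \<le> real p * real d" by simp
  then show ?thesis unfolding h_slope_def by (simp add: field_simps)
qed

lemma h_fun_eq:
  "\<tau> \<noteq> 1 \<Longrightarrow> h_fun p d \<tau> = ereal (h_const p d + h_slope p d * (\<tau>\<^sup>2 / q_fun d \<tau>))"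
  by (simp add: h_fun_def h_const_def h_slope_def)

lemma h_fun_pos:
  assumes "1 \<le> d" "d + 1 \<le> p" "0 \<le> \<tau>" "\<tau> < 1"
  shows "0 < h_const p d + h_slope p d * (\<tau>\<^sup>2 / q_fun d \<tau>)"
  using h_const_pos[OF assms(1,2)] h_slope_gt_1[OF assms(1,2)] q_fun_pos[OF assms(1,3,4)]
  by (intro add_pos_nonneg mult_nonneg_nonneg) auto

text \<open>
  Up to the summand \<open>2 d \<tau>\<^sup>2\<close>, the first two branches of \<open>G\<close> form \<open>q\<close> times the Huber profile of
  \<open>y = x d q\<close>, and the third one is \<open>q (2 - h)\<close>.  The side conditions select the larger of the two: for \<open>y \<ge> 1\<close> one has
  \<open>2 - 1/y \<ge> 2 - h\<close> iff \<open>y \<ge> 1/h\<close>.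
\<close>

lemma G_fun_eq_G_max:
  assumes "2 \<le> d" "d + 1 \<le> p" "0 \<le> \<tau>" "\<tau> \<le> 1"
  shows "G_fun p d x \<tau> = G_max p d x \<tau>"
proof (cases "\<tau> = 1")
  case True
  have "1 < h_slope p d" using assms by (intro h_slope_gt_1) auto
  then show ?thesis using True assms
    by (simp add: G_fun_at_1 G_max_def q_fun_1)
next
  case False
  define q where "q = q_fun d \<tau>"
  define h where "h = h_const p d + h_slope p d * (\<tau>\<^sup>2 / q)"
  have q: "0 < q" using q_fun_pos[of d \<tau>] assms False by (simp add: q_def)
  have h: "0 < h" using h_fun_pos[of d p \<tau>] assms False by (simp add: h_def q_def)
  have hf: "h_fun p d \<tau> = ereal h" using h_fun_eq[OF False] by (simp add: h_def q_def)
  define y where "y = x * real d * q"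
  have 2: "(2 - h_const p d) * q - h_slope p d * \<tau>\<^sup>2 = q * (2 - h)"
    using q by (simp add: h_def field_simps)
  have 1: "1 / (x * real d) = q / y" if "0 < y"
    using that q by (auto simp: y_def)
  have c1: "max 1 (1 / h_fun p d \<tau>) \<le> ereal y \<longleftrightarrow> 1 \<le> y \<and> 1 / h \<le> y"
    using h by (simp add: hf one_ereal_def)
  have "ereal 2 = 2" by simp
  then have c2: "2 - h_fun p d \<tau> \<le> ereal y \<longleftrightarrow> 2 - h \<le> y"
    by (metis hf ereal_minus(1) ereal_less_eq(3))
  have G: "G_fun p d x \<tau> = (if 1 \<le> y \<and> 1 / h \<le> y then 2 * q + 2 * real d * \<tau>\<^sup>2 - 1 / (x * real d)
     else if 2 - h \<le> y \<and> y \<le> 1 then y * q + 2 * real d * \<tau>\<^sup>2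
     else 2 * q + 2 * real d * \<tau>\<^sup>2 - q * h)"
    using assms unfolding G_fun_def q_def[symmetric] y_def[symmetric] c1 c2
    by (simp add: hf y_def power2_eq_square)
  have M: "G_max p d x \<tau> = 2 * real d * \<tau>\<^sup>2 + max (q * huber y) (q * (2 - h))"
    unfolding G_max_def q_def[symmetric] y_def[symmetric] 2 ..
  consider (a) "1 \<le> y" "1 / h \<le> y" | (b) "1 \<le> y" "y < 1 / h" | (c) "y < 1" "2 - h \<le> y"
    | (d) "y < 1" "y < 2 - h" by linarith
  then show ?thesis
  proof cases
    case a
    have "1 / y \<le> h" using a h by (simp add: field_simps)
    then have "q * (2 - h) \<le> q * (2 - 1 / y)" using q by (intro mult_left_mono) auto
    then have "max (q * huber y) (q * (2 - h)) = q * (2 - 1 / y)"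
      using a by (simp add: huber_ge1)
    then show ?thesis using a 1 by (simp add: G M right_diff_distrib)
  next
    case b
    have "h \<le> 1 / y" using b h by (simp add: field_simps)
    then have "q * (2 - 1 / y) \<le> q * (2 - h)" using q by (intro mult_left_mono) auto
    then have m: "max (q * huber y) (q * (2 - h)) = q * (2 - h)"
      using b by (simp add: huber_ge1)
    have "y = 1 \<Longrightarrow> 2 - h \<le> y \<Longrightarrow> False"
      using b h by (simp add: field_simps)
    then show ?thesis unfolding G M m using b by (auto simp: algebra_simps)
  next
    case c
    then have "max (q * huber y) (q * (2 - h)) = q * y" using q
      by (simp add: huber_le1)
    then show ?thesis using c by (simp add: G M)
  next
    case d
    then have "max (q * huber y) (q * (2 - h)) = q * (2 - h)" using q
      by (simp add: huber_le1)
    then show ?thesis using d by (simp add: G M algebra_simps)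
  qed
qed

section \<open>The balance point of \<open>r/\<alpha>\<close> and \<open>G\<close>\<close>

text \<open>
  The difference \<open>r/\<alpha> - \<Gamma>(1 - 1/\<alpha>)\<close> is strictly decreasing, positive near \<open>0\<close> and
  eventually negative; the balance is found by the intermediate value theorem.
\<close>

lemma balance_point:
  fixes \<Gamma> :: "real \<Rightarrow> real"
  assumes r: "0 < r"
    and mono: "\<And>x y. x \<le> y \<Longrightarrow> y < 1 \<Longrightarrow> \<Gamma> x \<le> \<Gamma> y"
    and cont: "continuous_on {..<1} \<Gamma>"
    and x0: "x0 < 1" "0 < \<Gamma> x0"
  obtains a where "0 < a" "r / a = \<Gamma> (1 - 1 / a)"
    "\<And>\<alpha>. 0 < \<alpha> \<Longrightarrow> \<Gamma> (1 - 1 / \<alpha>) \<le> r / \<alpha> \<longleftrightarrow> \<alpha> \<le> a"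
proof -
  let ?g = "\<lambda>\<alpha>. r / \<alpha> - \<Gamma> (1 - 1 / \<alpha>)"
  have decr: "?g \<beta> < ?g \<alpha>" if "0 < \<alpha>" "\<alpha> < \<beta>" for \<alpha> \<beta>
  proof -
    have "r / \<beta> < r / \<alpha>" using that r by (intro divide_strict_left_mono) auto
    moreover have "\<Gamma> (1 - 1 / \<alpha>) \<le> \<Gamma> (1 - 1 / \<beta>)"
      using that by (intro mono) (auto simp: field_simps)
    ultimately show ?thesis by linarith
  qed
  \<comment> \<open>For \<open>\<alpha> \<le> 1\<close> the right side is at most \<open>\<Gamma> 0\<close>, which \<open>r/lo\<close> exceeds by construction.\<close>
  define lo where "lo = r / (r + \<bar>\<Gamma> 0\<bar>)"
  have lo: "0 < lo" "lo \<le> 1" using r by (auto simp: lo_def)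
  have "r / lo = r + \<bar>\<Gamma> 0\<bar>" using r by (simp add: lo_def)
  moreover have "\<Gamma> (1 - 1 / lo) \<le> \<Gamma> 0" using lo by (intro mono) (auto simp: field_simps)
  ultimately have glo: "0 \<le> ?g lo" using r by linarith
  \<comment> \<open>The second entry gives \<open>1 - 1/hi \<ge> x0\<close>, the third one \<open>r/hi \<le> \<Gamma> x0\<close>.\<close>
  define hi where "hi = max 1 (max (1 / (1 - x0)) (r / \<Gamma> x0))"
  have hi: "1 \<le> hi" "1 / (1 - x0) \<le> hi" "r / \<Gamma> x0 \<le> hi" by (auto simp: hi_def)
  have "r / hi \<le> \<Gamma> x0" using hi(1,3) x0 by (simp add: field_simps)
  moreover have "\<Gamma> x0 \<le> \<Gamma> (1 - 1 / hi)" using hi(1,2) x0 by (intro mono) (auto simp: field_simps)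
  ultimately have ghi: "?g hi \<le> 0" by linarith
  have "continuous_on {lo..hi} ?g"
    using lo by (intro continuous_intros continuous_on_compose2[OF cont]) auto
  then obtain a where a: "lo \<le> a" "a \<le> hi" "?g a = 0"
    using IVT2'[of ?g hi 0 lo] glo ghi lo hi by auto
  have "0 < a" using a lo by simp
  moreover have "\<Gamma> (1 - 1 / \<alpha>) \<le> r / \<alpha> \<longleftrightarrow> \<alpha> \<le> a" if "0 < \<alpha>" for \<alpha>
    using decr[of \<alpha> a] decr[of a \<alpha>] that \<open>0 < a\<close> a(3) by (cases \<alpha> a rule: linorder_cases) auto
  ultimately show ?thesis using that a(3) by simp
qed

lemma q_fun_or: "1 \<le> d \<Longrightarrow> 0 \<le> \<tau> \<Longrightarrow> \<tau> \<le> 1 \<Longrightarrow> 0 < q_fun d \<tau> \<or> \<tau> = 1"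
  using q_fun_pos[of d \<tau>] by force

lemma G_max_half_pos:
  assumes "2 \<le> d" "0 \<le> \<tau>" "\<tau> \<le> 1"
  shows "0 < G_max p d (1/2) \<tau>"
proof (cases "\<tau> = 1")
  case True
  have "0 < 2 * real d * \<tau>\<^sup>2" using assms True by simp
  then show ?thesis unfolding G_max_def using True by (simp add: q_fun_1 max_def)
next
  case False
  then have "0 < q_fun d \<tau>" using assms q_fun_pos[of d \<tau>] by simp
  then have "0 < q_fun d \<tau> * huber (1/2 * real d * q_fun d \<tau>)"
    using assms by (intro mult_pos_pos huber_pos) auto
  moreover have "0 \<le> 2 * real d * \<tau>\<^sup>2" by simp
  ultimately show ?thesis unfolding G_max_def by (smt (verit) max.cobounded1)
qed

lemma G_max_mono:
  assumes "0 \<le> \<tau>" "\<tau> \<le> 1" "x \<le> y"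
  shows "G_max p d x \<tau> \<le> G_max p d y \<tau>"
  using q_fun_nonneg[OF assms(1,2), of d] assms(3) unfolding G_max_def
  by (intro add_left_mono max.mono mult_left_mono huber_mono mult_right_mono) auto

lemma continuous_on_huber: "continuous_on S huber"
proof -
  have "max y 1 \<noteq> (0::real)" for y by (simp add: max_def)
  then show ?thesis unfolding huber_def by (intro continuous_intros ballI)
qed

lemma continuous_on_G_max:
  fixes f g :: "'a::topological_space \<Rightarrow> real"
  assumes "continuous_on S f" "continuous_on S g"
  shows "continuous_on S (\<lambda>z. G_max p d (f z) (g z))"
  unfolding G_max_def q_fun_def
  by (intro continuous_intros assms continuous_on_compose2[OF continuous_on_huber[of UNIV]]) simp_all

lemma G_fun_1: "G_fun p 1 x \<tau> = max (x * (1 - \<tau>\<^sup>2)\<^sup>2 + 2 * \<tau>\<^sup>2) ((real p - 1) / real p)"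
  by (simp add: G_fun_def)

lemma G_fun_mono:
  assumes "1 \<le> d" "d + 1 \<le> p" "0 \<le> \<tau>" "\<tau> \<le> 1" "x \<le> y"
  shows "G_fun p d x \<tau> \<le> G_fun p d y \<tau>"
proof (cases "d = 1")
  case True
  have "x * (1 - \<tau>\<^sup>2)\<^sup>2 \<le> y * (1 - \<tau>\<^sup>2)\<^sup>2"
    using assms by (intro mult_right_mono) auto
  then show ?thesis unfolding True G_fun_1 by (intro max.mono add_right_mono) auto
next
  case False
  then show ?thesis using assms by (simp add: G_fun_eq_G_max G_max_mono)
qed

lemma continuous_on_G_fun:
  assumes "1 \<le> d" "d + 1 \<le> p" "0 \<le> \<tau>" "\<tau> \<le> 1"
  shows "continuous_on S (\<lambda>x. G_fun p d x \<tau>)"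
proof (cases "d = 1")
  case True
  show ?thesis unfolding True G_fun_1 by (intro continuous_intros)
next
  case False
  then have d: "2 \<le> d" using assms by simp
  show ?thesis
    unfolding G_fun_eq_G_max[OF d assms(2-4)] by (intro continuous_on_G_max continuous_intros)
qed

lemma G_fun_half_pos:
  assumes "1 \<le> d" "d + 1 \<le> p" "0 \<le> \<tau>" "\<tau> \<le> 1"
  shows "0 < G_fun p d (1/2) \<tau>"
proof (cases "d = 1")
  case True
  have "0 < (real p - 1) / real p" using assms by simp
  then show ?thesis unfolding True G_fun_1 by (simp add: less_max_iff_disj)
next
  case False
  then have d: "2 \<le> d" using assms by simp
  show ?thesis unfolding G_fun_eq_G_max[OF d assms(2-4)]
    by (intro G_max_half_pos d assms)
qed

lemma alphaG_spec:
  assumes "1 \<le> d" "d + 1 \<le> p" "0 \<le> \<tau>" "\<tau> \<le> 1"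
  shows alphaG_pos: "0 < alphaG p d \<tau>"
    and alphaG_balance: "r_fun p d \<tau> / alphaG p d \<tau> = G_fun p d (1 - 1 / alphaG p d \<tau>) \<tau>"
    and feasible_iff: "feasible p d \<tau> \<alpha> \<longleftrightarrow> 0 < \<alpha> \<and> \<alpha> \<le> alphaG p d \<tau>"
proof -
  obtain a where a: "0 < a" "r_fun p d \<tau> / a = G_fun p d (1 - 1 / a) \<tau>"
    "\<And>\<alpha>. 0 < \<alpha> \<Longrightarrow> G_fun p d (1 - 1 / \<alpha>) \<tau> \<le> r_fun p d \<tau> / \<alpha> \<longleftrightarrow> \<alpha> \<le> a"
    by (rule balance_point[OF r_fun_pos[OF assms(1,2), of \<tau>] G_fun_mono[OF assms]
          continuous_on_G_fun[OF assms] _ G_fun_half_pos[OF assms]]) (assumption | simp)+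
  have f: "feasible p d \<tau> \<alpha> \<longleftrightarrow> 0 < \<alpha> \<and> \<alpha> \<le> a" for \<alpha>
    unfolding feasible_def using a(3)[of \<alpha>] by blast
  have eq: "alphaG p d \<tau> = a"
    unfolding alphaG_def by (rule Greatest_equality) (use f a(1) in simp_all)
  show "0 < alphaG p d \<tau>" using a(1) eq by simp
  show "feasible p d \<tau> \<alpha> \<longleftrightarrow> 0 < \<alpha> \<and> \<alpha> \<le> alphaG p d \<tau>" using f eq by simp
  show "r_fun p d \<tau> / alphaG p d \<tau> = G_fun p d (1 - 1 / alphaG p d \<tau>) \<tau>" using a(2) eq by simp
qed

lemma alphaG_eqI:
  assumes "1 \<le> d" "d + 1 \<le> p" "0 \<le> \<tau>" "\<tau> \<le> 1"
    and \<alpha>: "0 < \<alpha>" "r_fun p d \<tau> / \<alpha> = G_fun p d (1 - 1 / \<alpha>) \<tau>"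
  shows "alphaG p d \<tau> = \<alpha>"
proof (rule ccontr)
  assume "alphaG p d \<tau> \<noteq> \<alpha>"
  moreover have "\<alpha> \<le> alphaG p d \<tau>"
    using feasible_iff[OF assms(1-4), of \<alpha>] \<alpha> by (simp add: feasible_def)
  ultimately have less: "\<alpha> < alphaG p d \<tau>" by simp
  then have "r_fun p d \<tau> / alphaG p d \<tau> < r_fun p d \<tau> / \<alpha>"
    using r_fun_pos[OF assms(1,2), of \<tau>] \<alpha>(1) by (intro divide_strict_left_mono) auto
  moreover have "G_fun p d (1 - 1 / \<alpha>) \<tau> \<le> G_fun p d (1 - 1 / alphaG p d \<tau>) \<tau>"
    using less \<alpha>(1) by (intro G_fun_mono[OF assms(1-4)]) (simp add: field_simps)
  ultimately show False using \<alpha>(2) alphaG_balance[OF assms(1-4)] by simp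
qed

lemma below_alphaG:
  assumes "1 \<le> d" "d + 1 \<le> p" "0 \<le> \<tau>" "\<tau> \<le> 1"
    and \<alpha>: "0 < \<alpha>" "\<alpha> < alphaG p d \<tau>"
  shows "G_fun p d (1 - 1 / \<alpha>) \<tau> < r_fun p d \<tau> / \<alpha>"
proof -
  have "G_fun p d (1 - 1 / \<alpha>) \<tau> \<le> r_fun p d \<tau> / \<alpha>"
    using feasible_iff[OF assms(1-4), of \<alpha>] \<alpha> by (simp add: feasible_def)
  moreover have "G_fun p d (1 - 1 / \<alpha>) \<tau> \<noteq> r_fun p d \<tau> / \<alpha>"
    using alphaG_eqI[OF assms(1-4) \<alpha>(1)] \<alpha>(2) by (metis less_irrefl)
  ultimately show ?thesis by simp
qed

section \<open>Explicit formulas for the threshold\<close>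

text \<open>
  Each entry of the maximum that defines \<open>G\<close> for \<open>d = 1\<close> meets \<open>r/\<alpha>\<close> in a single point, namely
  \<open>\<alpha>\<close> and \<open>p\<close>; the balance point lies on the entry that is larger there.
\<close>

lemma alphaG_1_cases:
  fixes \<tau> :: real
  assumes "2 \<le> p" "0 \<le> \<tau>" "\<tau> \<le> 1"
  defines "\<alpha> \<equiv> (real p - 1 + (1 - \<tau>\<^sup>2)\<^sup>2) / (2 * \<tau>\<^sup>2 + (1 - \<tau>\<^sup>2)\<^sup>2)"
  shows "if (1 - 1 / \<alpha>) * (1 - \<tau>\<^sup>2)\<^sup>2 + 2 * \<tau>\<^sup>2 \<ge> (real p - 1) / real p
         then alphaG p 1 \<tau> = \<alpha>
         else alphaG p 1 \<tau> = real p \<and>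
              (1 - 1 / real p) * (1 - \<tau>\<^sup>2)\<^sup>2 + 2 * \<tau>\<^sup>2 \<le> (real p - 1) / real p"
proof -
  define w where "w = (1 - \<tau>\<^sup>2)\<^sup>2"
  define v where "v = 2 * \<tau>\<^sup>2"
  define F where "F = (\<lambda>\<beta>::real. (1 - 1 / \<beta>) * w + v)"
  have wv: "0 < w + v"
  proof (cases "\<tau> = 0")
    case False
    then have "0 < v" "0 \<le> w" by (auto simp: v_def w_def)
    then show ?thesis by simp
  qed (simp add: w_def v_def)
  have w: "0 \<le> w" by (simp add: w_def)
  have \<alpha>: "\<alpha> = (real p - 1 + w) / (v + w)" by (simp add: \<alpha>_def w_def v_def)
  have \<alpha>_pos: "0 < \<alpha>" using wv w assms(1) by (auto simp: \<alpha> intro!: divide_pos_pos)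
  have r: "r_fun p 1 \<tau> = real p - 1" by (simp add: r_fun_def)
  have root: "(real p - 1) / \<beta> = F \<beta> \<longleftrightarrow> \<beta> = \<alpha>" if "0 < \<beta>" for \<beta>
  proof -
    have "(real p - 1) / \<beta> = F \<beta> \<longleftrightarrow> real p - 1 + w = \<beta> * (v + w)"
      using that by (simp add: F_def field_simps)
    also have "\<dots> \<longleftrightarrow> \<beta> = \<alpha>" using wv by (auto simp: \<alpha> field_simps)
    finally show ?thesis .
  qed
  have G: "G_fun p 1 (1 - 1 / \<beta>) \<tau> = max (F \<beta>) ((real p - 1) / real p)" for \<beta>
    unfolding G_fun_1 F_def w_def v_def by simp
  have d: "1 \<le> (1::nat)" "1 + 1 \<le> p" using assms by auto
  note unique = alphaG_eqI[OF d assms(2,3), unfolded r G]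
  show ?thesis
    unfolding w_def[symmetric] v_def[symmetric]
  proof (split if_split, intro conjI impI)
    have F_eq: "(1 - 1 / \<beta>) * w + v = F \<beta>" for \<beta> by (simp add: F_def)
    show "alphaG p 1 \<tau> = \<alpha>" if "(real p - 1) / real p \<le> (1 - 1 / \<alpha>) * w + v"
      using that unfolding F_eq using root[OF \<alpha>_pos] by (intro unique \<alpha>_pos) (simp add: max_def)
    assume "\<not> (real p - 1) / real p \<le> (1 - 1 / \<alpha>) * w + v"
    then have neg: "F \<alpha> < (real p - 1) / real p" unfolding F_eq by simp
    define a where "a = alphaG p 1 \<tau>"
    have a: "0 < a" "(real p - 1) / a = max (F a) ((real p - 1) / real p)"
      using alphaG_pos[OF d assms(2,3)] alphaG_balance[OF d assms(2,3)] unfolding r G a_def .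
    have "F a < (real p - 1) / real p"
    proof (rule ccontr)
      assume "\<not> F a < (real p - 1) / real p"
      then have "(real p - 1) / a = F a" using a(2) by simp
      then have "a = \<alpha>" using root[OF a(1)] by blast
      with neg \<open>\<not> F a < (real p - 1) / real p\<close> show False by simp
    qed
    moreover from this have "(real p - 1) / a = (real p - 1) / real p" using a(2) by simp
    then have "a = real p" using a(1) assms(1) by (simp add: field_simps)
    ultimately show "alphaG p 1 \<tau> = real p" "(1 - 1 / real p) * w + v \<le> (real p - 1) / real p"
      unfolding F_eq a_def[symmetric] by auto
  qed
qed

lemma alphaG_1_le: "2 \<le> p \<Longrightarrow> 0 \<le> \<tau> \<Longrightarrow> \<tau> \<le> 1 \<Longrightarrow> alphaG p 1 \<tau> \<le> real p"
proof -
  assume a: "2 \<le> p" "0 \<le> \<tau>" "\<tau> \<le> 1"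
  have d: "1 \<le> (1::nat)" "1 + 1 \<le> p" using a by auto
  have "(real p - 1) / real p \<le> (real p - 1) / alphaG p 1 \<tau>"
    using alphaG_balance[OF d a(2,3)] unfolding G_fun_1 by (simp add: r_fun_def)
  then show ?thesis
    using divide_strict_left_mono[of "real p" "alphaG p 1 \<tau>" "real p - 1"]
      alphaG_pos[OF d a(2,3)] a(1) by (cases "real p < alphaG p 1 \<tau>") auto
qed

lemma alphaG_1_0: "2 \<le> p \<Longrightarrow> alphaG p 1 0 = real p"
  by (intro alphaG_eqI) (simp_all add: G_fun_def r_fun_def field_simps)

lemma alphaG_max_eqI:
  assumes "\<tau> \<in> {0..1}" "\<And>\<sigma>. \<sigma> \<in> {0..1} \<Longrightarrow> alphaG p d \<sigma> \<le> alphaG p d \<tau>"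
  shows "alphaG_max p d = alphaG p d \<tau>"
  unfolding alphaG_max_def by (rule Greatest_equality) (use assms in auto)

text \<open>
  The pairs \<open>(\<tau>, \<alpha>)\<close> with \<open>\<alpha>\<close> admissible for \<open>\<tau>\<close> and
  \<open>\<alpha> \<ge> \<alpha>\<^sub>G(0)\<close> form a compact set, and the largest second coordinate is the maximum.  Compactness
  needs a bound on \<open>\<alpha>\<close> uniform in \<open>\<tau>\<close>, which comes from the minimum of \<open>G(1/2, -)\<close>.
\<close>

lemma alphaG_attains_max:
  assumes "1 \<le> d" "d + 1 \<le> p"
  obtains \<tau> where "\<tau> \<in> {0..1}" "\<And>\<sigma>. \<sigma> \<in> {0..1} \<Longrightarrow> alphaG p d \<sigma> \<le> alphaG p d \<tau>"
proof (cases "d = 1")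
  case True
  then have "2 \<le> p" using assms by simp
  then show thesis using True alphaG_1_0[of p] alphaG_1_le[of p] by (intro that[of 0]) auto
next
  case False
  then have d: "2 \<le> d" using assms by simp
  have "\<exists>\<tau>\<in>{0..1}. \<forall>\<sigma>\<in>{0..1}. G_max p d (1/2) \<tau> \<le> G_max p d (1/2) \<sigma>"
    by (intro continuous_attains_inf continuous_on_G_max continuous_intros compact_Icc) simp
  then obtain \<tau>1 where \<tau>1: "\<tau>1 \<in> {0..1}" "\<And>\<tau>. \<tau> \<in> {0..1} \<Longrightarrow> G_max p d (1/2) \<tau>1 \<le> G_max p d (1/2) \<tau>"
    by blast
  define m where "m = G_max p d (1/2) \<tau>1"
  have m: "0 < m" using G_max_half_pos[OF d] \<tau>1(1) by (auto simp: m_def)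
  define hi where "hi = max 2 (r_fun p d 1 / m)"
  have r_le: "r_fun p d \<tau> \<le> r_fun p d 1" if "\<tau> \<in> {0..1}" for \<tau>
  proof -
    have "\<tau>\<^sup>2 \<le> 1" using that by (simp add: power_le_one)
    then have "2 * (real d - 1) * \<tau>\<^sup>2 \<le> 2 * (real d - 1) * 1"
      using d by (intro mult_left_mono) auto
    then show ?thesis by (simp add: r_fun_def)
  qed
  have bal: "r_fun p d \<tau> / alphaG p d \<tau> = G_max p d (1 - 1 / alphaG p d \<tau>) \<tau>"
    and pos: "0 < alphaG p d \<tau>" if "\<tau> \<in> {0..1}" for \<tau>
  proof -
    have t: "0 \<le> \<tau>" "\<tau> \<le> 1" using that by auto
    show "r_fun p d \<tau> / alphaG p d \<tau> = G_max p d (1 - 1 / alphaG p d \<tau>) \<tau>"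
      using alphaG_balance[OF assms t] unfolding G_fun_eq_G_max[OF d assms(2) t] .
    show "0 < alphaG p d \<tau>" by (rule alphaG_pos[OF assms t])
  qed
  have le_hi: "alphaG p d \<tau> \<le> hi" if t: "\<tau> \<in> {0..1}" for \<tau>
  proof (cases "alphaG p d \<tau> \<le> 2")
    case False
    define a where "a = alphaG p d \<tau>"
    have a: "2 < a" using False by (simp add: a_def)
    have "m \<le> G_max p d (1/2) \<tau>" using \<tau>1(2)[OF t] by (simp add: m_def)
    also have "\<dots> \<le> G_max p d (1 - 1 / a) \<tau>"
      using t a by (intro G_max_mono) (auto simp: field_simps)
    also have "\<dots> = r_fun p d \<tau> / a" using bal[OF t] by (simp add: a_def)
    finally have "m * a \<le> r_fun p d \<tau>" using a by (simp add: field_simps)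
    then have "a \<le> r_fun p d 1 / m" using r_le[OF t] m by (simp add: field_simps)
    then show ?thesis by (simp add: hi_def a_def)
  qed (simp add: hi_def)
  define lo where "lo = alphaG p d 0"
  have lo: "0 < lo" using pos[of 0] by (simp add: lo_def)
  let ?f = "\<lambda>z. r_fun p d (fst z) / snd z - G_max p d (1 - 1 / snd z) (fst z)"
  define K where "K = ({0..1} \<times> {lo..hi}) \<inter> ?f -` {0..}"
  have "continuous_on ({0..1} \<times> {lo..hi}) ?f"
    using lo unfolding r_fun_def
    by (intro continuous_intros continuous_on_G_max) auto
  then have "closed K" unfolding K_def
    by (intro continuous_closed_preimage closed_Times) auto
  moreover have "bounded K" unfolding K_def by (intro bounded_Int disjI1 bounded_Times) auto
  ultimately have "compact K" by (simp add: compact_eq_bounded_closed)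
  have mem: "(\<sigma>, alphaG p d \<sigma>) \<in> K" if "\<sigma> \<in> {0..1}" "lo \<le> alphaG p d \<sigma>" for \<sigma>
    using that le_hi[OF that(1)] bal[OF that(1)] by (simp add: K_def)
  have "(0, alphaG p d 0) \<in> K" by (rule mem) (auto simp: lo_def)
  then have "K \<noteq> {}" by blast
  then have "\<exists>z\<in>K. \<forall>w\<in>K. snd w \<le> snd z"
    by (intro continuous_attains_sup \<open>compact K\<close> continuous_intros)
  then obtain z where z: "z \<in> K" "\<And>w. w \<in> K \<Longrightarrow> snd w \<le> snd z" by blast
  obtain \<tau> \<alpha> where \<tau>\<alpha>: "z = (\<tau>, \<alpha>)" by (cases z)
  have \<tau>: "0 \<le> \<tau>" "\<tau> \<le> 1" "lo \<le> \<alpha>" "0 < \<alpha>"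
    "G_max p d (1 - 1 / \<alpha>) \<tau> \<le> r_fun p d \<tau> / \<alpha>"
    using z(1) lo by (auto simp: K_def \<tau>\<alpha>)
  then have "feasible p d \<tau> \<alpha>"
    using G_fun_eq_G_max[OF d assms(2)] by (simp add: feasible_def)
  then have \<alpha>: "\<alpha> \<le> alphaG p d \<tau>" using feasible_iff[OF assms \<tau>(1,2)] by simp
  show thesis
  proof (rule that)
    show "\<tau> \<in> {0..1}" using \<tau> by simp
    show "alphaG p d \<sigma> \<le> alphaG p d \<tau>" if "\<sigma> \<in> {0..1}" for \<sigma>
    proof (cases "lo \<le> alphaG p d \<sigma>")
      case True
      then have "alphaG p d \<sigma> \<le> \<alpha>" using z(2)[OF mem[OF that]] by (simp add: \<tau>\<alpha>)
      then show ?thesis using \<alpha> by simp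
    qed (use \<tau> \<alpha> in linarith)
  qed
qed


lemma G_fun_real:
  fixes x \<tau> :: real
  assumes "2 \<le> d" "d + 1 \<le> p" "0 \<le> \<tau>" "\<tau> < 1" and h: "h_fun p d \<tau> = ereal h"
  defines "y \<equiv> x * (real d * q_fun d \<tau>)"
  shows "G_fun p d x \<tau> =
    (if 1 \<le> y \<and> 1 \<le> y * h then 2 * (q_fun d \<tau> + real d * \<tau>\<^sup>2) - 1 / (x * real d)
     else if 2 - h \<le> y \<and> y \<le> 1 then x * (real d * (q_fun d \<tau>)\<^sup>2) + 2 * real d * \<tau>\<^sup>2
     else 2 * (q_fun d \<tau> + real d * \<tau>\<^sup>2) - q_fun d \<tau> * h)"
proof -
  have "0 < h" using h_fun_pos[of d p \<tau>] h_fun_eq[of \<tau> p d] h assms by auto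
  then have "max 1 (1 / h_fun p d \<tau>) \<le> ereal y \<longleftrightarrow> 1 \<le> y \<and> 1 \<le> y * h"
    by (simp add: h one_ereal_def field_simps)
  moreover have "ereal 2 = 2" by simp
  then have "2 - h_fun p d \<tau> \<le> ereal y \<longleftrightarrow> 2 - h \<le> y"
    by (metis h ereal_minus(1) ereal_less_eq(3))
  moreover have "y = x * real d * q_fun d \<tau>" by (simp add: y_def)
  ultimately show ?thesis
    using assms(1) unfolding G_fun_def by (simp add: h algebra_simps)
qed

text \<open>
  Clearing denominators.  The leading coefficient of the quadratic is positive
  (\<open>leading_coeff_pos\<close>), and its value at \<open>\<alpha> = 1\<close> is \<open>-1\<close>, so that exactly one
  root exceeds \<open>1\<close>.
\<close>

lemma alpha_root_iff:
  fixes \<tau> \<alpha> :: real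
  assumes "1 \<le> d" "\<alpha> \<noteq> 0" "\<alpha> \<noteq> 1"
  defines "Q \<equiv> q_fun d \<tau> + real d * \<tau>\<^sup>2"
  shows "alpha_root p d \<tau> \<alpha> \<longleftrightarrow>
    (2 * Q * real d - 1) * \<alpha>\<^sup>2 - (2 * Q * real d + r_fun p d \<tau> * real d) * \<alpha> + r_fun p d \<tau> * real d = 0"
proof -
  define r D where "r = r_fun p d \<tau>" and "D = real d"
  have D: "0 < D" using assms by (simp add: D_def)
  have 1: "(1 - 1 / \<alpha>) * D = (\<alpha> - 1) * D / \<alpha>" using assms by (simp add: field_simps)
  have "alpha_root p d \<tau> \<alpha> \<longleftrightarrow> r / \<alpha> = 2 * Q - \<alpha> / ((\<alpha> - 1) * D)"
    using assms unfolding alpha_root_def Q_def[symmetric] r_def[symmetric] D_def[symmetric] 1 by simp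
  also have "\<dots> \<longleftrightarrow> r * ((\<alpha> - 1) * D) = 2 * Q * (\<alpha> * ((\<alpha> - 1) * D)) - \<alpha> * \<alpha>"
    using assms D by (simp add: field_simps)
  also have "\<dots> \<longleftrightarrow> (2 * Q * D - 1) * \<alpha>\<^sup>2 - (2 * Q * D + r * D) * \<alpha> + r * D = 0"
    by (auto simp: algebra_simps power2_eq_square)
  finally show ?thesis by (simp add: r_def D_def)
qed

lemma leading_coeff_pos:
  assumes "2 \<le> d" "0 \<le> \<tau>" "\<tau> \<le> 1"
  shows "1 < 2 * (q_fun d \<tau> + real d * \<tau>\<^sup>2) * real d"
proof -
  define D where "D = real d"
  have D: "2 \<le> D" using assms by (simp add: D_def)
  have "0 \<le> (2 * \<tau> - 1)\<^sup>2 * (D - 1) / 2" using D by simp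
  also have "\<dots> = q_fun d \<tau> + D * \<tau>\<^sup>2 - (D + 1) / 2"
    unfolding q_fun_def D_def[symmetric] by (simp add: field_simps power2_eq_square)
  finally have "(D + 1) / 2 \<le> q_fun d \<tau> + D * \<tau>\<^sup>2" by simp
  moreover have "1 < (D + 1) / 2" using D by simp
  ultimately have "1 < q_fun d \<tau> + D * \<tau>\<^sup>2" by (rule less_le_trans[rotated])
  then have "1 * 1 < (q_fun d \<tau> + D * \<tau>\<^sup>2) * D" using D by (intro mult_strict_mono) auto
  moreover have "2 * (q_fun d \<tau> + real d * \<tau>\<^sup>2) * real d = 2 * ((q_fun d \<tau> + D * \<tau>\<^sup>2) * D)"
    by (simp add: D_def)
  ultimately show ?thesis by linarith
qed

lemma alpha_root_pos:
  assumes "2 \<le> d" "d + 1 \<le> p" "0 \<le> \<tau>" "\<tau> \<le> 1" "alpha_root p d \<tau> \<alpha>"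
  shows "0 < \<alpha>"
proof (rule ccontr)
  define c where "c = 2 * (q_fun d \<tau> + real d * \<tau>\<^sup>2) * real d - 1"
  define e where "e = r_fun p d \<tau> * real d"
  have c: "0 < c" using leading_coeff_pos[of d \<tau>] assms by (simp add: c_def)
  have e: "0 < e" using r_fun_pos[of d p \<tau>] assms by (simp add: e_def)
  assume "\<not> 0 < \<alpha>"
  then have \<alpha>: "\<alpha> < 0" "\<alpha> \<noteq> 1" using assms(5) by (auto simp: alpha_root_def)
  then have "c * \<alpha>\<^sup>2 - (c + 1 + e) * \<alpha> + e = 0"
    using alpha_root_iff[of d \<alpha> p \<tau>] assms by (simp add: c_def e_def)
  moreover have "0 < c * \<alpha>\<^sup>2" "(c + 1 + e) * \<alpha> < 0"
    using \<alpha> c e by (simp_all add: mult_pos_neg)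
  ultimately show False using e by linarith
qed

text \<open>
  Two roots \<open>\<alpha>, \<beta> > 1\<close> would make the value \<open>c (1 - \<alpha>) (1 - \<beta>)\<close> of the quadratic at \<open>1\<close>
  positive, where \<open>c\<close> is its leading coefficient; but it equals \<open>-1\<close>.
\<close>

lemma larger_rootI:
  assumes "2 \<le> d" "d + 1 \<le> p" "0 \<le> \<tau>" "\<tau> \<le> 1" "alpha_root p d \<tau> \<alpha>" "1 < \<alpha>"
  shows "larger_root p d \<tau> \<alpha>"
  unfolding larger_root_def
proof (intro conjI allI impI assms(5) leI notI)
  fix \<beta> assume \<beta>: "alpha_root p d \<tau> \<beta>" "\<alpha> < \<beta>"
  define c where "c = 2 * (q_fun d \<tau> + real d * \<tau>\<^sup>2) * real d - 1"
  define e where "e = r_fun p d \<tau> * real d"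
  have c: "0 < c" using leading_coeff_pos[of d \<tau>] assms by (simp add: c_def)
  have root: "c * \<gamma>\<^sup>2 - (c + 1 + e) * \<gamma> + e = 0" if "alpha_root p d \<tau> \<gamma>" for \<gamma>
    using alpha_root_iff[of d \<gamma> p \<tau>] assms(1) that by (simp add: c_def e_def alpha_root_def)
  have "(\<beta> - \<alpha>) * (c * (\<alpha> + \<beta>) - (c + 1 + e)) = 0"
    using root[OF assms(5)] root[OF \<beta>(1)] by (simp add: algebra_simps power2_eq_square)
  then have sum: "c * (\<alpha> + \<beta>) = c + 1 + e" using \<beta>(2) by simp
  have "c * \<alpha>\<^sup>2 - (c * (\<alpha> + \<beta>)) * \<alpha> + e = 0" unfolding sum by (rule root[OF assms(5)])
  then have prod: "e = c * (\<alpha> * \<beta>)" by (simp add: algebra_simps power2_eq_square)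
  have "0 < c * ((\<alpha> - 1) * (\<beta> - 1))" using c \<beta>(2) assms(6) by simp
  also have "\<dots> = e - c * (\<alpha> + \<beta>) + c" by (simp add: prod algebra_simps)
  also have "\<dots> = - 1" by (simp add: sum)
  finally show False by simp
qed

lemma divide_swap: "r / a = X \<Longrightarrow> 0 < r \<Longrightarrow> 0 < a \<Longrightarrow> a = r / (X::real)"
  by auto

lemma ereal_divide_le_iff:
  fixes a c x :: real
  assumes "0 < c"
  shows "ereal a / ereal c \<le> ereal x \<longleftrightarrow> a \<le> x * c" "ereal x \<le> ereal a / ereal c \<longleftrightarrow> x * c \<le> a"
  using assms by (simp_all add: field_simps)

definition alpha_mid :: "nat \<Rightarrow> nat \<Rightarrow> real \<Rightarrow> real" where
  "alpha_mid p d \<tau> = (real d * (q_fun d \<tau>)\<^sup>2 + r_fun p d \<tau>) / (real d * (q_fun d \<tau>)\<^sup>2 + 2 * real d * \<tau>\<^sup>2)"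

definition alpha_low :: "nat \<Rightarrow> nat \<Rightarrow> real \<Rightarrow> real" where
  "alpha_low p d \<tau> = r_fun p d \<tau> / (2 * (q_fun d \<tau> + real d * \<tau>\<^sup>2)
     - q_fun d \<tau> * real_of_ereal (h_fun p d \<tau>))"

lemma alpha_mid_iff:
  assumes "2 \<le> d" "d + 1 \<le> p" "0 \<le> \<tau>" "\<tau> \<le> 1"
  shows "0 < alpha_mid p d \<tau>"
    and "0 < \<alpha> \<Longrightarrow> r_fun p d \<tau> / \<alpha> = (1 - 1 / \<alpha>) * (real d * (q_fun d \<tau>)\<^sup>2) + 2 * real d * \<tau>\<^sup>2
           \<longleftrightarrow> \<alpha> = alpha_mid p d \<tau>"
proof -
  define w where "w = real d * (q_fun d \<tau>)\<^sup>2"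
  define v where "v = 2 * real d * \<tau>\<^sup>2"
  have r: "0 < r_fun p d \<tau>" using assms by (intro r_fun_pos) auto
  have w: "0 \<le> w" "0 \<le> v" by (simp_all add: w_def v_def)
  have "0 < w \<or> 0 < v"
    using q_fun_or[of d \<tau>] assms by (auto simp: w_def v_def)
  then have wv: "0 < w + v" using w by linarith
  show "0 < alpha_mid p d \<tau>"
    using wv w r unfolding alpha_mid_def w_def[symmetric] v_def[symmetric] by (intro divide_pos_pos) auto
  assume \<alpha>: "0 < \<alpha>"
  have "r_fun p d \<tau> / \<alpha> = (1 - 1 / \<alpha>) * w + v \<longleftrightarrow> r_fun p d \<tau> + w = \<alpha> * (w + v)"
    using \<alpha> by (simp add: field_simps)
  also have "\<dots> \<longleftrightarrow> \<alpha> = (w + r_fun p d \<tau>) / (w + v)" using wv by (auto simp: field_simps)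
  finally show "r_fun p d \<tau> / \<alpha> = (1 - 1 / \<alpha>) * (real d * (q_fun d \<tau>)\<^sup>2) + 2 * real d * \<tau>\<^sup>2
           \<longleftrightarrow> \<alpha> = alpha_mid p d \<tau>"
    unfolding alpha_mid_def w_def[symmetric] v_def[symmetric] .
qed

lemma alpha_root_balance:
  assumes "alpha_root p d \<tau> \<alpha>"
  shows "r_fun p d \<tau> / \<alpha> = 2 * (q_fun d \<tau> + real d * \<tau>\<^sup>2) - 1 / ((1 - 1 / \<alpha>) * real d)"
  using assms by (simp add: alpha_root_def)

text \<open>
  For \<open>h \<ge> 1\<close> the thresholds are ordered, \<open>2 - h \<le> 1\<close>, and for \<open>\<tau> < 1\<close> the
  branches of \<open>G\<close> follow each other as \<open>x d q\<close> grows, while at \<open>\<tau> = 1\<close> only the middle one occurs.  A candidate that lies in the range of its branch balances \<open>r/\<alpha>\<close> and \<open>G\<close> and is the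
  threshold by uniqueness.  Conversely, if the first two candidates miss their ranges, then the
  balance point cannot lie on these branches.
\<close>

lemma alphaG_cases_h_ge_1:
  fixes \<tau> :: real
  assumes "2 \<le> d" "d + 1 \<le> p" "0 \<le> \<tau>" "\<tau> \<le> 1" and h1: "1 \<le> h_fun p d \<tau>"
  defines "high \<equiv> \<lambda>\<alpha>. larger_root p d \<tau> \<alpha> \<and> 1 / ereal (real d * q_fun d \<tau>) \<le> ereal (1 - 1 / \<alpha>)"
  defines "mid \<equiv> \<lambda>\<alpha>. (2 - h_fun p d \<tau>) / ereal (real d * q_fun d \<tau>) \<le> ereal (1 - 1 / \<alpha>) \<and>
                   ereal (1 - 1 / \<alpha>) \<le> 1 / ereal (real d * q_fun d \<tau>)"
  shows "(high \<alpha> \<longrightarrow> alphaG p d \<tau> = \<alpha>) \<and>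
    (mid (alpha_mid p d \<tau>) \<longrightarrow> alphaG p d \<tau> = alpha_mid p d \<tau>) \<and>
    ((\<nexists>\<alpha>. high \<alpha>) \<longrightarrow> \<not> mid (alpha_mid p d \<tau>) \<longrightarrow>
           ereal (1 - 1 / alpha_low p d \<tau>) \<le> (2 - h_fun p d \<tau>) / ereal (real d * q_fun d \<tau>) \<and>
           alphaG p d \<tau> = alpha_low p d \<tau>)"
proof -
  have d1: "1 \<le> d" using assms by simp
  note eqI = alphaG_eqI[OF d1 assms(2-4)]
  note pos = alphaG_pos[OF d1 assms(2-4)] and bal = alphaG_balance[OF d1 assms(2-4)]
  note midp = alpha_mid_iff[OF assms(1-4)]
  define D where "D = real d * q_fun d \<tau>"
  show ?thesis
  proof (cases "\<tau> = 1")
    case True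
    have "\<not> high \<beta>" for \<beta>
      unfolding high_def True threshold_conventions_at_1 by simp
    moreover have "mid (alpha_mid p d \<tau>)"
      unfolding mid_def True threshold_conventions_at_1 by simp
    moreover have "alphaG p d \<tau> = alpha_mid p d \<tau>"
      using midp(2)[OF midp(1)] assms(1)
      by (intro eqI midp) (simp add: True G_fun_at_1 q_fun_1)
    ultimately show ?thesis by blast
  next
    case False
    then have \<tau>: "\<tau> < 1" using assms by simp
    obtain h where h: "h_fun p d \<tau> = ereal h" using h_fun_eq[OF False] by metis
    have h_ge: "1 \<le> h" using h1 by (simp add: h one_ereal_def)
    have D: "0 < D" using q_fun_pos[OF d1 assms(3) \<tau>] assms(1) by (simp add: D_def)
    have two: "2 - ereal h = ereal (2 - h)" by (metis ereal_minus(1) numeral_eq_ereal)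
    note thr = ereal_divide_le_iff[OF D]
    have high: "high \<beta> \<longleftrightarrow> larger_root p d \<tau> \<beta> \<and> 1 \<le> (1 - 1 / \<beta>) * D" for \<beta>
      unfolding high_def D_def[symmetric] one_ereal_def thr ..
    have mid: "mid \<beta> \<longleftrightarrow> 2 - h \<le> (1 - 1 / \<beta>) * D \<and> (1 - 1 / \<beta>) * D \<le> 1" for \<beta>
      unfolding mid_def D_def[symmetric] h two one_ereal_def thr ..
    note G = G_fun_real[OF assms(1-3) \<tau> h, folded D_def]
    have low: "alpha_low p d \<tau> = r_fun p d \<tau> / (2 * (q_fun d \<tau> + real d * \<tau>\<^sup>2) - q_fun d \<tau> * h)"
      by (simp add: alpha_low_def h)
    have 1: "alphaG p d \<tau> = \<alpha>" if "high \<alpha>"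
    proof -
      have root: "alpha_root p d \<tau> \<alpha>" and y: "1 \<le> (1 - 1 / \<alpha>) * D"
        using that by (auto simp: high larger_root_def)
      have "1 * 1 \<le> (1 - 1 / \<alpha>) * D * h" using y h_ge by (intro mult_mono) auto
      then show ?thesis
        using y alpha_root_balance[OF root] by (intro eqI alpha_root_pos[OF assms(1-4) root]) (simp add: G)
    qed
    have G_mid: "G_fun p d x \<tau> = x * (real d * (q_fun d \<tau>)\<^sup>2) + 2 * real d * \<tau>\<^sup>2"
      if "2 - h \<le> x * D" "x * D \<le> 1" for x
    proof (cases "x * D = 1")
      case True
      then have xq: "x * (real d * q_fun d \<tau>) = 1" by (simp add: D_def)
      then have "q_fun d \<tau> * (x * real d) = 1" by (simp add: algebra_simps)
      then have "1 / (x * real d) = q_fun d \<tau>" by (metis divide_eq_eq mult_zero_right zero_neq_one)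
      moreover have "x * (real d * (q_fun d \<tau>)\<^sup>2) = q_fun d \<tau>"
        using xq by (simp add: power2_eq_square mult.assoc[symmetric])
      ultimately show ?thesis using True h_ge by (simp add: G)
    qed (use that in \<open>simp add: G\<close>)
    have 2: "alphaG p d \<tau> = alpha_mid p d \<tau>" if "mid (alpha_mid p d \<tau>)"
      using that midp(2)[OF midp(1)] unfolding mid by (intro eqI midp(1)) (simp add: G_mid)
    have 3: "ereal (1 - 1 / alpha_low p d \<tau>) \<le> (2 - h_fun p d \<tau>) / ereal (real d * q_fun d \<tau>) \<and>
           alphaG p d \<tau> = alpha_low p d \<tau>"
      if nh: "\<nexists>\<alpha>. high \<alpha>" and nm: "\<not> mid (alpha_mid p d \<tau>)"
    proof -
      define a where "a = alphaG p d \<tau>"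
      have a: "0 < a" "r_fun p d \<tau> / a = G_fun p d (1 - 1 / a) \<tau>" using pos bal unfolding a_def .
      have "\<not> 1 \<le> (1 - 1 / a) * D"
      proof
        assume y: "1 \<le> (1 - 1 / a) * D"
        then have "0 < (1 - 1 / a) * D" by linarith
        then have "0 < 1 - 1 / a" using D by (simp add: zero_less_mult_iff)
        then have a1: "1 < a" using a(1) by (simp add: field_simps)
        have "1 * 1 \<le> (1 - 1 / a) * D * h" using y h_ge by (intro mult_mono) auto
        then have "alpha_root p d \<tau> a" using a a1 y by (simp add: G alpha_root_def)
        then have "high a" using y a1 unfolding high by (intro conjI larger_rootI assms)
        with nh show False by blast
      qed
      moreover have "\<not> (2 - h \<le> (1 - 1 / a) * D \<and> (1 - 1 / a) * D \<le> 1)"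
      proof
        assume y: "2 - h \<le> (1 - 1 / a) * D \<and> (1 - 1 / a) * D \<le> 1"
        then have "a = alpha_mid p d \<tau>" using a midp(2)[OF a(1)] by (simp add: G_mid)
        with nm y show False by (simp add: mid)
      qed
      ultimately have y: "(1 - 1 / a) * D < 2 - h" by linarith
      have "r_fun p d \<tau> / a = 2 * (q_fun d \<tau> + real d * \<tau>\<^sup>2) - q_fun d \<tau> * h"
        using a(2) \<open>\<not> 1 \<le> (1 - 1 / a) * D\<close> y by (simp add: G)
      then have "a = alpha_low p d \<tau>"
        unfolding low by (intro divide_swap a(1) r_fun_pos[OF d1 assms(2)])
      then show ?thesis using y unfolding D_def[symmetric] h two thr a_def by simp
    qed
    from 1 2 3 show ?thesis by blast
  qed
qed

text \<open>
  For \<open>h \<le> 1\<close> the middle branch is void, since it would need \<open>2 - h \<le> x d q \<le> 1\<close>; this leaves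
  only \<open>h = x d q = 1\<close>, where the first branch applies.
\<close>

lemma alphaG_cases_h_le_1:
  fixes \<tau> :: real
  assumes "2 \<le> d" "d + 1 \<le> p" "0 \<le> \<tau>" "\<tau> \<le> 1" and h1: "h_fun p d \<tau> \<le> 1"
  defines "high \<equiv> \<lambda>\<alpha>. larger_root p d \<tau> \<alpha> \<and>
             1 / (ereal (real d * q_fun d \<tau>) * h_fun p d \<tau>) \<le> ereal (1 - 1 / \<alpha>)"
  shows "high \<alpha> \<Longrightarrow> alphaG p d \<tau> = \<alpha>"
    and "\<nexists>\<alpha>. high \<alpha> \<Longrightarrow>
           ereal (1 - 1 / alpha_low p d \<tau>) \<le> 1 / (ereal (real d * q_fun d \<tau>) * h_fun p d \<tau>) \<and>
           alphaG p d \<tau> = alpha_low p d \<tau>"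
proof -
  have d1: "1 \<le> d" using assms by simp
  note eqI = alphaG_eqI[OF d1 assms(2-4)]
  note pos = alphaG_pos[OF d1 assms(2-4)] and bal = alphaG_balance[OF d1 assms(2-4)]
  define D where "D = real d * q_fun d \<tau>"
  have "\<tau> \<noteq> 1" using h1 by (auto simp: h_fun_def)
  then have \<tau>: "\<tau> < 1" using assms by simp
  obtain h where h: "h_fun p d \<tau> = ereal h" "0 < h"
    using h_fun_eq[OF \<open>\<tau> \<noteq> 1\<close>] h_fun_pos[OF d1 assms(2,3) \<tau>] by metis
  have h_le: "h \<le> 1" using h1 by (simp add: h one_ereal_def)
  have D: "0 < D" using q_fun_pos[OF d1 assms(3) \<tau>] assms(1) by (simp add: D_def)
  then have Dh: "0 < D * h" using h by simp
  have thr: "1 / (ereal (real d * q_fun d \<tau>) * h_fun p d \<tau>) = ereal 1 / ereal (D * h)"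
    by (simp add: h D_def one_ereal_def)
  have high: "high \<beta> \<longleftrightarrow> larger_root p d \<tau> \<beta> \<and> 1 \<le> (1 - 1 / \<beta>) * D * h" for \<beta>
    unfolding high_def thr ereal_divide_le_iff[OF Dh] by (simp add: mult.assoc)
  note G = G_fun_real[OF assms(1-3) \<tau> h(1), folded D_def]
  have low: "alpha_low p d \<tau> = r_fun p d \<tau> / (2 * (q_fun d \<tau> + real d * \<tau>\<^sup>2) - q_fun d \<tau> * h)"
    by (simp add: alpha_low_def h)
  have y1: "1 \<le> y" if "1 \<le> y * h" for y
  proof -
    have "0 < y * h" using that by linarith
    then have "0 < y" using h(2) by (rule zero_less_mult_pos2)
    then have "y * h \<le> y * 1" using h_le by (intro mult_left_mono) auto
    then show ?thesis using that by linarith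
  qed
  show "alphaG p d \<tau> = \<alpha>" if "high \<alpha>"
  proof -
    have root: "alpha_root p d \<tau> \<alpha>" and y: "1 \<le> (1 - 1 / \<alpha>) * D * h"
      using that by (auto simp: high larger_root_def)
    show ?thesis
      using y y1[OF y] alpha_root_balance[OF root]
      by (intro eqI alpha_root_pos[OF assms(1-4) root]) (simp add: G)
  qed
  show "ereal (1 - 1 / alpha_low p d \<tau>) \<le> 1 / (ereal (real d * q_fun d \<tau>) * h_fun p d \<tau>) \<and>
           alphaG p d \<tau> = alpha_low p d \<tau>" if nh: "\<nexists>\<alpha>. high \<alpha>"
  proof -
    define a where "a = alphaG p d \<tau>"
    have a: "0 < a" "r_fun p d \<tau> / a = G_fun p d (1 - 1 / a) \<tau>" using pos bal unfolding a_def .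
    have y: "\<not> 1 \<le> (1 - 1 / a) * D * h"
    proof
      assume y: "1 \<le> (1 - 1 / a) * D * h"
      then have "0 < (1 - 1 / a) * D" using y1[OF y] by linarith
      then have "0 < 1 - 1 / a" using D by (simp add: zero_less_mult_iff)
      then have a1: "1 < a" using a(1) by (simp add: field_simps)
      then have "alpha_root p d \<tau> a" using a a1 y y1[OF y] by (simp add: G alpha_root_def)
      then have "high a" using y a1 unfolding high by (intro conjI larger_rootI assms)
      with nh show False by blast
    qed
    have n: "\<not> (2 - h \<le> (1 - 1 / a) * D \<and> (1 - 1 / a) * D \<le> 1)"
    proof
      assume m: "2 - h \<le> (1 - 1 / a) * D \<and> (1 - 1 / a) * D \<le> 1"
      then have "h = 1" "(1 - 1 / a) * D = 1" using h_le by linarith+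
      with y show False by simp
    qed
    have n': "\<not> (1 \<le> (1 - 1 / a) * D \<and> 1 \<le> (1 - 1 / a) * D * h)" using y by blast
    have "r_fun p d \<tau> / a = 2 * (q_fun d \<tau> + real d * \<tau>\<^sup>2) - q_fun d \<tau> * h"
      using a(2) unfolding G if_not_P[OF n] if_not_P[OF n'] .
    then have "a = alpha_low p d \<tau>"
      unfolding low by (intro divide_swap a(1) r_fun_pos[OF d1 assms(2)])
    then show ?thesis
      using y unfolding thr ereal_divide_le_iff[OF Dh] a_def by (simp add: mult.assoc)
  qed
qed

text \<open>
  At \<open>\<alpha> = 1\<close>, that is \<open>x = 0\<close>, the Huber profile vanishes.  The last two hypotheses say that
  \<open>r - 2 d \<tau>\<^sup>2\<close> exceeds both entries of the maximum there, hence the balance point lies to the right of \<open>1\<close>.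
\<close>

lemma alphaG_gt_1:
  assumes "2 \<le> d" "d + 1 \<le> p" "0 \<le> \<tau>" "\<tau> \<le> 1"
    and "2 * \<tau>\<^sup>2 < real p - real d"
    and "(2 - h_const p d) * q_fun d \<tau> + (2 - h_slope p d) * \<tau>\<^sup>2 < real p - real d"
  shows "1 < alphaG p d \<tau>"
proof (rule ccontr)
  assume "\<not> 1 < alphaG p d \<tau>"
  define a where "a = alphaG p d \<tau>"
  have d1: "1 \<le> d" using assms by simp
  have a: "0 < a" "a \<le> 1" "r_fun p d \<tau> / a = G_fun p d (1 - 1 / a) \<tau>"
    using alphaG_pos[OF d1 assms(2-4)] alphaG_balance[OF d1 assms(2-4)] \<open>\<not> 1 < alphaG p d \<tau>\<close>
    unfolding a_def by (simp_all only: not_less)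
  have "r_fun p d \<tau> \<le> r_fun p d \<tau> / a"
    using a(1,2) r_fun_pos[OF d1 assms(2), of \<tau>] by (simp add: le_divide_eq mult_left_le)
  also have "\<dots> \<le> G_fun p d 0 \<tau>"
    unfolding a(3) using a by (intro G_fun_mono d1 assms) (simp add: field_simps)
  also have "\<dots> = 2 * real d * \<tau>\<^sup>2 + max 0 ((2 - h_const p d) * q_fun d \<tau> - h_slope p d * \<tau>\<^sup>2)"
    unfolding G_fun_eq_G_max[OF assms(1-4)] G_max_def by (simp add: huber_le1)
  also have "\<dots> < r_fun p d \<tau>"
    using assms(5,6) by (simp add: r_fun_def algebra_simps max_def)
  finally show False by simp
qed

lemma exists_alphaG_gt_1:
  assumes "(d + 2 \<le> p \<and> 2 \<le> d) \<or> (p = d + 1 \<and> d \<in> {2, 3})"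
  obtains \<tau> where "\<tau> \<in> {0..1}" "1 < alphaG p d \<tau>"
proof -
  consider (a) "d + 2 \<le> p" "2 \<le> d" | (b) "p = 3" "d = 2" | (c) "p = 4" "d = 3"
    using assms by auto
  then show thesis
  proof cases
    case a
    \<comment> \<open>At \<open>\<tau> = 1\<close> the second condition holds with room to spare but the first may be an equality; a slightly smaller \<open>\<tau>\<close> keeps \<open>q < 1/2\<close>.\<close>
    define \<delta> where "\<delta> = 1 / (4 * real d)"
    have \<delta>: "0 < \<delta>" "\<delta> \<le> 1 / 8" "real d * \<delta> = 1 / 4" using a by (auto simp: \<delta>_def field_simps)
    have p: "2 \<le> real p - real d" using a by simp
    have "q_fun d (1 - \<delta>) = \<delta> * (1 / 4 + 2 * (1 - \<delta>))" using \<delta>(3) by (simp add: q_fun_eq)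
    also have "\<dots> \<le> \<delta> * (9 / 4)" using \<delta> by (intro mult_left_mono) auto
    also have "\<dots> < 1 / 2" using \<delta> by simp
    finally have q: "q_fun d (1 - \<delta>) < 1 / 2" .
    have q0: "0 \<le> q_fun d (1 - \<delta>)" using \<delta> by (intro q_fun_nonneg) auto
    have \<tau>2: "(1 - \<delta>)\<^sup>2 < 1" using \<delta> by (simp add: abs_square_less_1)
    have hc: "(2 - h_const p d) * q_fun d (1 - \<delta>) \<le> 2 * q_fun d (1 - \<delta>)"
      using h_const_pos[of d p] a q0 by (intro mult_right_mono) auto
    have hs: "(2 - h_slope p d) * (1 - \<delta>)\<^sup>2 \<le> 1 * (1 - \<delta>)\<^sup>2"
      using h_slope_gt_1[of d p] a by (intro mult_right_mono) auto
    show ?thesis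
    proof (rule that[of "1 - \<delta>"])
      show "1 < alphaG p d (1 - \<delta>)"
        by (rule alphaG_gt_1) (use a \<delta> p q \<tau>2 hc hs in linarith)+
    qed (use \<delta> in auto)
  next
    case b
    show ?thesis
    proof (rule that[of "1/2"])
      show "1 < alphaG p d (1/2)"
        using b by (intro alphaG_gt_1) (simp_all add: h_const_def h_slope_def q_fun_def power2_eq_square)
    qed auto
  next
    case c
    show ?thesis
    proof (rule that[of "7/10"])
      show "1 < alphaG p d (7/10)"
        using c by (intro alphaG_gt_1) (simp_all add: h_const_def h_slope_def q_fun_def power2_eq_square)
    qed auto
  qed
qed

section \<open>Moment and positivity inequalities\<close>

lemma sum_norm_ge_norm_sum:
  fixes x :: "'i::finite \<Rightarrow> 'a::real_inner"
  shows "(\<Sum>i\<in>UNIV. x i) \<bullet> (\<Sum>i\<in>UNIV. x i) \<le> real CARD('i) * (\<Sum>i\<in>UNIV. x i \<bullet> x i)"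
proof -
  define m where "m = (1 / real CARD('i)) *\<^sub>R (\<Sum>i\<in>UNIV. x i)"
  have n: "0 < real CARD('i)" by simp
  have S: "(\<Sum>i\<in>UNIV. x i) = real CARD('i) *\<^sub>R m" by (simp add: m_def)
  have "0 \<le> (\<Sum>i\<in>UNIV. (x i - m) \<bullet> (x i - m))" by (intro sum_nonneg) simp
  also have "\<dots> = (\<Sum>i\<in>UNIV. x i \<bullet> x i) - 2 * ((\<Sum>i\<in>UNIV. x i) \<bullet> m) + real CARD('i) * (m \<bullet> m)"
    by (simp add: inner_diff_left inner_diff_right sum.distrib sum_subtractf inner_sum_left
        inner_sum_right sum_distrib_left inner_commute)
  also have "\<dots> = (\<Sum>i\<in>UNIV. x i \<bullet> x i) - real CARD('i) * (m \<bullet> m)" by (simp add: S)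
  finally have "real CARD('i) * (real CARD('i) * (m \<bullet> m)) \<le> real CARD('i) * (\<Sum>i\<in>UNIV. x i \<bullet> x i)"
    using n by (intro mult_left_mono) auto
  then show ?thesis by (simp add: S)
qed

text \<open>
  Bessel's inequality for the operator \<open>f = \<Sum>\<^sub>i x\<^sub>i x\<^sub>i\<^sup>T\<close> with respect to the orthogonal pair
  \<open>Q\<close>, \<open>1 - Q\<close> in the Hilbert-Schmidt inner product: the double sum is \<open>|f|\<^sup>2\<close>, the
  inner products with \<open>Q\<close> and \<open>1 - Q\<close> are \<open>A\<close> and \<open>B\<close>, and \<open>k\<close> is the rank of \<open>Q\<close>.
\<close>

lemma gram_bessel:
  fixes x :: "'i \<Rightarrow> 'a::euclidean_space" and I :: "'i set" and Q :: "'a \<Rightarrow> 'a"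
  assumes lin: "linear Q" and self: "\<And>v w. Q v \<bullet> w = v \<bullet> Q w" and idem: "\<And>v. Q (Q v) = Q v"
    and k: "(\<Sum>b\<in>Basis. b \<bullet> Q b) = k" "0 < k" "k < real DIM('a)"
  defines "A \<equiv> \<Sum>i\<in>I. x i \<bullet> Q (x i)" and "B \<equiv> \<Sum>i\<in>I. x i \<bullet> x i - x i \<bullet> Q (x i)"
  shows "A\<^sup>2 / k + B\<^sup>2 / (real DIM('a) - k) \<le> (\<Sum>i\<in>I. \<Sum>j\<in>I. (x i \<bullet> x j)\<^sup>2)"
proof -
  \<comment> \<open>\<open>P\<close> below is the projection of \<open>f\<close> to the span of \<open>Q\<close> and \<open>1 - Q\<close>.\<close>
  define c1 where "c1 = A / k"
  define c2 where "c2 = B / (real DIM('a) - k)"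
  define P where "P = (\<lambda>v. c1 *\<^sub>R Q v + c2 *\<^sub>R (v - Q v))"
  define f where "f = (\<lambda>v. \<Sum>i\<in>I. (x i \<bullet> v) *\<^sub>R x i)"
  have Pself: "v \<bullet> P w = P v \<bullet> w" for v w
    by (simp add: P_def inner_add_left inner_add_right inner_diff_left inner_diff_right self)
  have ff: "(\<Sum>b\<in>Basis. f b \<bullet> f b) = (\<Sum>i\<in>I. \<Sum>j\<in>I. (x i \<bullet> x j)\<^sup>2)"
  proof -
    have "(\<Sum>b\<in>Basis. f b \<bullet> f b) = (\<Sum>b\<in>Basis. \<Sum>i\<in>I. \<Sum>j\<in>I. (x i \<bullet> b) * (x j \<bullet> b) * (x i \<bullet> x j))"
      unfolding f_def inner_sum_left inner_sum_right by (intro sum.cong refl) (simp add: inner_commute)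
    also have "\<dots> = (\<Sum>i\<in>I. \<Sum>j\<in>I. \<Sum>b\<in>Basis. (x i \<bullet> b) * (x j \<bullet> b) * (x i \<bullet> x j))"
      by (subst sum.swap) (intro sum.cong refl sum.swap)
    also have "\<dots> = (\<Sum>i\<in>I. \<Sum>j\<in>I. (x i \<bullet> x j) * (x i \<bullet> x j))"
      by (intro sum.cong refl) (simp add: sum_distrib_right[symmetric] euclidean_inner[symmetric])
    finally show ?thesis by (simp add: power2_eq_square)
  qed
  have fP: "(\<Sum>b\<in>Basis. f b \<bullet> P b) = c1 * A + c2 * B"
  proof -
    have "(\<Sum>b\<in>Basis. f b \<bullet> P b) = (\<Sum>b\<in>Basis. \<Sum>i\<in>I. (x i \<bullet> b) * (P (x i) \<bullet> b))"
      unfolding f_def inner_sum_left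
      by (intro sum.cong refl) (simp only: inner_scaleR_left, simp only: Pself)
    also have "\<dots> = (\<Sum>i\<in>I. \<Sum>b\<in>Basis. (x i \<bullet> b) * (P (x i) \<bullet> b))" by (rule sum.swap)
    also have "\<dots> = (\<Sum>i\<in>I. x i \<bullet> P (x i))" by (simp add: euclidean_inner[symmetric])
    also have "\<dots> = (\<Sum>i\<in>I. c1 * (x i \<bullet> Q (x i)) + c2 * (x i \<bullet> x i - x i \<bullet> Q (x i)))"
      by (simp add: P_def inner_add_right inner_diff_right)
    also have "\<dots> = c1 * A + c2 * B"
      unfolding A_def B_def sum_distrib_left sum.distrib[symmetric] ..
    finally show ?thesis .
  qed
  have PP: "(\<Sum>b\<in>Basis. P b \<bullet> P b) = c1\<^sup>2 * k + c2\<^sup>2 * (real DIM('a) - k)"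
  proof -
    have "P b \<bullet> P b = c1\<^sup>2 * (b \<bullet> Q b) + c2\<^sup>2 * (b \<bullet> b - b \<bullet> Q b)" for b
    proof -
      have "Q b \<bullet> Q b = b \<bullet> Q b" "Q b \<bullet> b = b \<bullet> Q b" by (simp_all add: self idem)
      then show ?thesis
        by (simp add: P_def inner_add_left inner_add_right inner_diff_left inner_diff_right
            power2_eq_square algebra_simps)
    qed
    then have "(\<Sum>b\<in>Basis. P b \<bullet> P b) = c1\<^sup>2 * (\<Sum>b\<in>Basis. b \<bullet> Q b)
        + c2\<^sup>2 * ((\<Sum>b\<in>Basis. (b::'a) \<bullet> b) - (\<Sum>b\<in>Basis. b \<bullet> Q b))"
      by (simp only: sum.distrib sum_distrib_left[symmetric] sum_subtractf)
    then show ?thesis by (simp add: k(1))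
  qed
  have "0 \<le> (\<Sum>b\<in>Basis. (f b - P b) \<bullet> (f b - P b))" by (intro sum_nonneg) simp
  also have "\<dots> = (\<Sum>b\<in>Basis. f b \<bullet> f b - 2 * (f b \<bullet> P b) + P b \<bullet> P b)"
    by (intro sum.cong refl) (simp add: inner_diff_left inner_diff_right inner_commute)
  also have "\<dots> = (\<Sum>b\<in>Basis. f b \<bullet> f b) - 2 * (\<Sum>b\<in>Basis. f b \<bullet> P b) + (\<Sum>b\<in>Basis. P b \<bullet> P b)"
    by (simp add: sum.distrib sum_subtractf sum_distrib_left)
  also have "\<dots> = (\<Sum>i\<in>I. \<Sum>j\<in>I. (x i \<bullet> x j)\<^sup>2) - (A\<^sup>2 / k + B\<^sup>2 / (real DIM('a) - k))"
    unfolding ff fP PP using k(2,3) by (simp add: c1_def c2_def power2_eq_square divide_simps)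
  finally show ?thesis by simp
qed

lemma linear_term_zero:
  fixes a b :: real
  assumes "\<And>t. 0 \<le> 2 * t * b + t\<^sup>2 * a"
  shows "b = 0"
proof (rule ccontr)
  assume b: "b \<noteq> 0"
  define s where "s = 1 / (\<bar>a\<bar> + 1)"
  have s: "0 < s" "s * a < 2" by (auto simp: s_def field_simps)
  have "0 \<le> 2 * (- b * s) * b + (- b * s)\<^sup>2 * a" by (rule assms)
  also have "\<dots> = (b\<^sup>2 * s) * (s * a - 2)" by (simp add: power2_eq_square algebra_simps)
  also have "\<dots> < 0" using b s by (intro mult_pos_neg) auto
  finally show False by simp
qed

lemma inner_matrix_vector:
  fixes M :: "real^'k::finite^'l::finite"
  shows "(M *v x) \<bullet> y = x \<bullet> (transpose M *v y)"
  by (metis dot_lmul_matrix inner_commute vector_transpose_matrix)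

text \<open>
  A minimiser of the Rayleigh quotient on the unit sphere of an invariant subspace is an eigenvector:
  by the first variation, \<open>f v - \<mu> v\<close> is orthogonal to \<open>V\<close>, and it lies in \<open>V\<close>.
\<close>

lemma rayleigh_minimizer:
  fixes f :: "'a::euclidean_space \<Rightarrow> 'a"
  assumes lin: "linear f" and self: "\<And>v w. f v \<bullet> w = v \<bullet> f w"
    and V: "subspace V" "\<And>v. v \<in> V \<Longrightarrow> f v \<in> V" "w0 \<in> V" "w0 \<noteq> 0"
  obtains v \<mu> where "v \<in> V" "v \<noteq> 0" "f v = \<mu> *\<^sub>R v" "\<And>w. w \<in> V \<Longrightarrow> \<mu> * (w \<bullet> w) \<le> w \<bullet> f w"
proof -
  have cont: "continuous_on A (\<lambda>v. v \<bullet> f v)" for A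
    by (rule continuous_on_inner[OF continuous_on_id linear_continuous_on])
      (use lin in \<open>simp add: linear_conv_bounded_linear\<close>)
  have "compact (sphere 0 1 \<inter> V)"
    using V(1) by (intro compact_Int_closed closed_subspace) auto
  moreover have "(1 / norm w0) *\<^sub>R w0 \<in> sphere 0 1 \<inter> V"
    using V by (auto simp: subspace_scale)
  then have "sphere 0 1 \<inter> V \<noteq> {}" by blast
  ultimately have "\<exists>v\<in>sphere 0 1 \<inter> V. \<forall>w\<in>sphere 0 1 \<inter> V. v \<bullet> f v \<le> w \<bullet> f w"
    by (intro continuous_attains_inf cont)
  then obtain v where v: "norm v = 1" "v \<in> V"
    and min: "\<And>w. norm w = 1 \<Longrightarrow> w \<in> V \<Longrightarrow> v \<bullet> f v \<le> w \<bullet> f w" by auto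
  define \<mu> where "\<mu> = v \<bullet> f v"
  have vv: "v \<bullet> v = 1" using v(1) by (simp add: dot_square_norm)
  have bound: "\<mu> * (w \<bullet> w) \<le> w \<bullet> f w" if "w \<in> V" for w
  proof (cases "w = 0")
    case False
    define u where "u = (1 / norm w) *\<^sub>R w"
    have "\<mu> \<le> u \<bullet> f u" unfolding \<mu>_def u_def
      using False that V(1) by (intro min) (auto simp: subspace_scale)
    also have "\<dots> = (w \<bullet> f w) / (w \<bullet> w)"
      by (simp add: u_def linear_scale[OF lin] dot_square_norm power2_eq_square)
    finally show ?thesis using False by (simp add: field_simps)
  qed simp
  have orth: "(f v - \<mu> *\<^sub>R v) \<bullet> w = 0" if "w \<in> V" for w
  proof (rule linear_term_zero)
    fix t
    have "\<mu> * ((v + t *\<^sub>R w) \<bullet> (v + t *\<^sub>R w)) \<le> (v + t *\<^sub>R w) \<bullet> f (v + t *\<^sub>R w)"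
      using v that V(1) by (intro bound subspace_add subspace_scale)
    then show "0 \<le> 2 * t * ((f v - \<mu> *\<^sub>R v) \<bullet> w) + t\<^sup>2 * (w \<bullet> f w - \<mu> * (w \<bullet> w))"
      using self[of v w] vv inner_commute[of w v] inner_commute[of w "f v"]
      by (simp add: linear_add[OF lin] linear_scale[OF lin] inner_add_left inner_add_right
          inner_diff_left \<mu>_def[symmetric] algebra_simps power2_eq_square)
  qed
  have "f v - \<mu> *\<^sub>R v \<in> V" using V v by (intro subspace_diff subspace_scale) auto
  then have "f v = \<mu> *\<^sub>R v" using orth[of "f v - \<mu> *\<^sub>R v"] by simp
  moreover have "v \<noteq> 0" using v(1) by auto
  ultimately show thesis using that[OF v(2) _ _ bound] by blast
qed

definition outer :: "real^'l \<Rightarrow> real^'k \<Rightarrow> real^'k^'l" where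
  "outer x y = (\<chi> a b. x $ a * y $ b)"

lemma outer_vector: "outer x y *v v = (y \<bullet> v) *\<^sub>R x"
  by (simp add: outer_def vec_eq_iff matrix_vector_mult_def inner_vec_def sum_distrib_left mult_ac)

lemma outer_inner: "outer x y \<bullet> K = x \<bullet> (K *v y)"
  by (simp add: outer_def inner_vec_def matrix_vector_mult_def sum_distrib_left mult_ac)

lemma transpose_outer: "transpose (outer x y) = outer y x"
  by (simp add: outer_def transpose_def vec_eq_iff)

lemma psd_zero_diagonal:
  fixes H :: "real^'d::finite^'d"
  assumes sym: "transpose H = H" and psd: "\<And>v. 0 \<le> v \<bullet> (H *v v)" and "H $ i $ i = 0"
  shows "H $ i $ j = 0"
proof (rule linear_term_zero)
  fix t
  have e: "axis a 1 \<bullet> (H *v axis b 1) = H $ a $ b" for a b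
    by (simp add: inner_axis' matrix_vector_mult_basis column_def)
  have "H $ j $ i = H $ i $ j" using sym by (metis transpose_def vec_lambda_beta)
  moreover have "0 \<le> (axis i 1 + t *\<^sub>R axis j 1) \<bullet> (H *v (axis i 1 + t *\<^sub>R axis j 1))" by (rule psd)
  ultimately show "0 \<le> 2 * t * (H $ i $ j) + t\<^sup>2 * (H $ j $ j)"
    using assms(3)
    by (simp add: matrix_vector_right_distrib matrix_vector_mult_scaleR inner_add_left inner_add_right e
        power2_eq_square algebra_simps)
qed

text \<open>
  One step of the Cholesky algorithm splits off a rank-one matrix from \<open>H\<close> and creates a zero on the
  diagonal; zeros on the diagonal persist, so the number of
  nonzero diagonal entries serves as induction measure.
\<close>

lemma psd_inner_nonneg:
  fixes H K :: "real^'d::finite^'d"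
  assumes "transpose H = H" "\<And>v. 0 \<le> v \<bullet> (H *v v)" and K: "\<And>v. 0 \<le> v \<bullet> (K *v v)"
  shows "0 \<le> H \<bullet> K"
  using assms(1,2)
proof (induction "card {i. H $ i $ i \<noteq> 0}" arbitrary: H rule: less_induct)
  case less
  note sym = less.prems(1) and psd = less.prems(2)
  show ?case
  proof (cases "\<forall>i. H $ i $ i = 0")
    case True
    then have "H = 0" using psd_zero_diagonal[OF sym psd] by (simp add: vec_eq_iff)
    then show ?thesis by simp
  next
    case False
    then obtain i where i: "H $ i $ i \<noteq> 0" by blast
    define h where "h = H $ i"
    define \<eta> where "\<eta> = H $ i $ i"
    have symc: "H $ a $ b = H $ b $ a" for a b using sym by (metis transpose_def vec_lambda_beta)
    have Hax: "H *v axis i 1 = h"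
      by (simp add: matrix_vector_mult_basis column_def h_def vec_eq_iff symc)
    have "0 \<le> axis i 1 \<bullet> (H *v axis i 1)" by (rule psd)
    then have \<eta>: "0 < \<eta>" using i by (simp add: Hax h_def \<eta>_def inner_axis')
    define H' where "H' = H - (1 / \<eta>) *\<^sub>R outer h h"
    have H'v: "H' *v v = H *v v - ((h \<bullet> v) / \<eta>) *\<^sub>R h" for v
      by (simp add: H'_def matrix_vector_mult_diff_rdistrib scaleR_matrix_vector_assoc[symmetric] outer_vector)
    have psd': "0 \<le> v \<bullet> (H' *v v)" for v
    proof -
      define c where "c = (h \<bullet> v) / \<eta>"
      have "0 \<le> (v - c *\<^sub>R axis i 1) \<bullet> (H *v (v - c *\<^sub>R axis i 1))" by (rule psd)
      also have "\<dots> = v \<bullet> (H *v v) - c * (axis i 1 \<bullet> (H *v v)) - c * (v \<bullet> h) + c * c * \<eta>"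
        by (simp add: matrix_vector_mult_diff_distrib matrix_vector_mult_scaleR Hax inner_diff_left inner_diff_right
            inner_axis' \<eta>_def h_def algebra_simps)
      also have "axis i 1 \<bullet> (H *v v) = h \<bullet> v"
        using inner_matrix_vector[of H v "axis i 1"] by (simp add: sym Hax inner_commute)
      also have "c * c * \<eta> = c * (h \<bullet> v)" using \<eta> by (simp add: c_def)
      finally show ?thesis by (simp add: H'v inner_diff_right c_def inner_commute)
    qed
    have sym': "transpose H' = H'"
      by (simp add: H'_def vec_eq_iff transpose_def symc outer_def mult.commute)
    have zero: "H' $ i $ i = 0" using \<eta> by (simp add: H'_def h_def \<eta>_def outer_def)
    have "H' $ a $ a = 0" if "H $ a $ a = 0" for a
      using psd_zero_diagonal[OF sym psd that, of i] that symc[of a i] by (simp add: H'_def h_def outer_def)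
    then have "{a. H' $ a $ a \<noteq> 0} \<subset> {a. H $ a $ a \<noteq> 0}" using zero i by blast
    then have "card {a. H' $ a $ a \<noteq> 0} < card {a. H $ a $ a \<noteq> 0}" by (intro psubset_card_mono) auto
    then have "0 \<le> H' \<bullet> K" using sym' psd' by (rule less.hyps)
    moreover have "H \<bullet> K = H' \<bullet> K + (h \<bullet> (K *v h)) / \<eta>"
      by (simp add: H'_def inner_diff_left outer_inner)
    ultimately show ?thesis using K[of h] \<eta> by simp
  qed
qed

lemma inner_mat_1: "(mat 1 :: real^'d::finite^'d) \<bullet> K = trace K"
  by (simp add: inner_vec_def mat_def trace_def if_distrib[of "\<lambda>x. x * _"] sum.delta cong: if_cong)

lemma inner_mat_1_self: "mat 1 \<bullet> (mat 1 :: real^'d::finite^'d) = real CARD('d)"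
  unfolding inner_mat_1 by (simp add: trace_def mat_def)

text \<open>
  The matrix \<open>|v|\<^sup>2 - v v\<^sup>T\<close> is positive semidefinite by Cauchy-Schwarz; pair it with \<open>K\<close>.
\<close>

lemma psd_le_trace:
  fixes K :: "real^'d::finite^'d"
  assumes "\<And>v. 0 \<le> v \<bullet> (K *v v)"
  shows "v \<bullet> (K *v v) \<le> trace K * (v \<bullet> v)"
proof -
  define H where "H = (v \<bullet> v) *\<^sub>R mat 1 - outer v v"
  have Hw: "H *v w = (v \<bullet> v) *\<^sub>R w - (v \<bullet> w) *\<^sub>R v" for w
    by (simp add: H_def matrix_vector_mult_diff_rdistrib scaleR_matrix_vector_assoc[symmetric] outer_vector)
  have "0 \<le> w \<bullet> (H *v w)" for w
    using Cauchy_Schwarz_ineq[of v w] by (simp add: Hw inner_diff_right inner_commute power2_eq_square)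
  moreover have "transpose H = H" by (simp add: H_def vec_eq_iff transpose_def mat_def outer_def mult.commute)
  ultimately have "0 \<le> H \<bullet> K" using assms by (intro psd_inner_nonneg)
  also have "H \<bullet> K = (v \<bullet> v) * trace K - v \<bullet> (K *v v)"
    by (simp add: H_def inner_diff_left inner_mat_1 outer_inner)
  finally show ?thesis by (simp add: mult.commute)
qed

lemma psd_lower_bound_from_square:
  fixes H :: "real^'d::finite^'d"
  assumes sym: "transpose H = H" and psd: "\<And>v. 0 \<le> v \<bullet> (H *v v)"
    and sq: "\<And>v. c * (v \<bullet> v) \<le> (H *v v) \<bullet> (H *v v)" and c: "0 \<le> c"
  shows "sqrt c * (v \<bullet> v) \<le> v \<bullet> (H *v v)"
proof (cases "v = 0")
  case False
  obtain w \<mu> where w: "w \<noteq> 0" "H *v w = \<mu> *\<^sub>R w" "\<And>v. \<mu> * (v \<bullet> v) \<le> v \<bullet> (H *v v)"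
    by (rule rayleigh_minimizer[of "(*v) H" UNIV v])
      (use False inner_matrix_vector[of H] in \<open>auto simp: sym\<close>)
  have ww: "0 < w \<bullet> w" using w(1) by simp
  have "0 \<le> \<mu>" using psd[of w] ww by (simp add: w(2) zero_le_mult_iff)
  moreover have "c \<le> \<mu>\<^sup>2" using sq[of w] ww by (simp add: w(2) power2_eq_square)
  ultimately have "sqrt c \<le> \<mu>" by (simp add: real_le_lsqrt)
  then have "sqrt c * (v \<bullet> v) \<le> \<mu> * (v \<bullet> v)" by (intro mult_right_mono) auto
  then show ?thesis using w(3)[of v] by linarith
qed simp

section \<open>Polar decomposition\<close>

lemma rows_orthonormal_iff:
  fixes E :: "real^'p::finite^'d::finite"
  shows "E ** transpose E = mat 1 \<longleftrightarrow> (\<forall>a b. E $ a \<bullet> E $ b = (if a = b then 1 else 0))"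
  by (simp add: vec_eq_iff matrix_matrix_mult_def transpose_def inner_vec_def mat_def)

lemma inner_eq_sum_rows: "(X::real^'p::finite^'d::finite) \<bullet> Y = (\<Sum>a\<in>UNIV. X $ a \<bullet> Y $ a)"
  by (simp add: inner_vec_def)

lemma orthonormal_rows_inner_self:
  fixes E :: "real^'p::finite^'d::finite"
  shows "E ** transpose E = mat 1 \<Longrightarrow> E \<bullet> E = real CARD('d)"
  by (simp add: inner_eq_sum_rows rows_orthonormal_iff)

lemma orthonormal_rows_compact: "compact {E::real^'p::finite^'d::finite. E ** transpose E = mat 1}"
proof -
  have "closed {E::real^'p^'d. \<forall>a b. E $ a \<bullet> E $ b = (if a = b then 1 else 0)}"
    by (intro closed_Collect_all closed_Collect_eq continuous_intros)
  moreover have "norm E \<le> sqrt (real CARD('d))" if "E ** transpose E = mat 1" for E :: "real^'p^'d"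
    using that by (simp add: norm_eq_sqrt_inner inner_eq_sum_rows rows_orthonormal_iff)
  then have "bounded {E::real^'p^'d. E ** transpose E = mat 1}"
    by (auto simp: bounded_iff)
  ultimately show ?thesis by (simp add: compact_eq_bounded_closed rows_orthonormal_iff)
qed

lemma orthonormal_rows_exist:
  assumes "CARD('d::finite) \<le> CARD('p::finite)"
  obtains E :: "real^'p^'d" where "E ** transpose E = mat 1"
proof -
  obtain f :: "'d \<Rightarrow> 'p" where "inj f"
    using card_le_inj[of "UNIV::'d set" "UNIV::'p set"] assms by auto
  then have "(\<chi> a. axis (f a) 1 :: real^'p^'d) ** transpose (\<chi> a. axis (f a) 1 :: real^'p^'d) = mat 1"
    by (auto simp: rows_orthonormal_iff inner_axis_axis inj_eq)
  then show thesis by (rule that)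
qed

lemma plane_rotation_isometry:
  fixes e f v w :: "'a::real_inner" and c s :: real
  assumes ef: "e \<bullet> e = 1" "f \<bullet> f = 1" "e \<bullet> f = 0" and cs: "c\<^sup>2 + s\<^sup>2 = 1"
  defines "rot \<equiv> \<lambda>v. v + ((c - 1) * (v \<bullet> e) - s * (v \<bullet> f)) *\<^sub>R e
                         + (s * (v \<bullet> e) + (c - 1) * (v \<bullet> f)) *\<^sub>R f"
  shows "rot v \<bullet> rot w = v \<bullet> w"
proof -
  have fe: "f \<bullet> e = 0" using ef(3) by (simp add: inner_commute)
  define a b a' b' where "a = v \<bullet> e" and "b = v \<bullet> f" and "a' = w \<bullet> e" and "b' = w \<bullet> f"
  have ev: "e \<bullet> w = a'" "f \<bullet> w = b'" by (simp_all add: a'_def b'_def inner_commute)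
  have "rot v \<bullet> rot w = v \<bullet> w + (c\<^sup>2 + s\<^sup>2 - 1) * (a * a' + b * b')"
    by (simp add: rot_def inner_add_left inner_add_right ef fe ev flip: a_def b_def a'_def b'_def)
      (simp add: algebra_simps power2_eq_square)
  then show ?thesis by (simp add: cs)
qed

text \<open>
  The stationarity condition of \<open>\<theta> \<mapsto> \<beta> cos \<theta> + \<gamma> sin \<theta>\<close> at a maximum in \<open>\<theta> = 0\<close>: the maximal
  value is \<open>\<surd>(\<beta>\<^sup>2 + \<gamma>\<^sup>2)\<close>.
\<close>

lemma rotation_derivative_zero:
  fixes \<beta> \<gamma> :: real
  assumes "\<And>c s. c\<^sup>2 + s\<^sup>2 = 1 \<Longrightarrow> (c - 1) * \<beta> + s * \<gamma> \<le> 0"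
  shows "\<gamma> = 0"
proof (rule ccontr)
  assume \<gamma>: "\<gamma> \<noteq> 0"
  define \<rho> where "\<rho> = sqrt (\<beta>\<^sup>2 + \<gamma>\<^sup>2)"
  have \<rho>2: "\<rho>\<^sup>2 = \<beta>\<^sup>2 + \<gamma>\<^sup>2" by (simp add: \<rho>_def)
  have "0 < \<rho>" using \<gamma> by (simp add: \<rho>_def add_nonneg_pos)
  have "(\<beta> / \<rho>)\<^sup>2 + (\<gamma> / \<rho>)\<^sup>2 = (\<beta>\<^sup>2 + \<gamma>\<^sup>2) / \<rho>\<^sup>2"
    by (simp add: power_divide add_divide_distrib)
  then have "(\<beta> / \<rho>)\<^sup>2 + (\<gamma> / \<rho>)\<^sup>2 = 1" using \<open>0 < \<rho>\<close> by (simp add: \<rho>2[symmetric])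
  then have "(\<beta> / \<rho> - 1) * \<beta> + (\<gamma> / \<rho>) * \<gamma> \<le> 0" by (rule assms)
  then have "(\<beta>\<^sup>2 + \<gamma>\<^sup>2) / \<rho> \<le> \<beta>" by (simp add: algebra_simps power2_eq_square add_divide_distrib)
  then have "\<rho>\<^sup>2 / \<rho> \<le> \<beta>" by (simp only: \<rho>2)
  then have "\<rho> \<le> \<beta>" using \<open>0 < \<rho>\<close> by (simp add: power2_eq_square)
  then have "\<rho>\<^sup>2 \<le> \<beta>\<^sup>2" using \<open>0 < \<rho>\<close> by (intro power_mono) auto
  then show False using \<rho>2 \<gamma> by simp
qed

text \<open>
  \<open>U\<close> maximises \<open>\<langle>R, E\<rangle>\<close> over the matrices \<open>E\<close> with orthonormal rows.  Comparing with rotations of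
  \<open>U\<close> in coordinate planes of \<open>\<real>\<^sup>p\<close> shows that \<open>U\<^sup>T R\<close> is symmetric, which yields
  both the symmetry of \<open>H = R U\<^sup>T\<close> and \<open>R = H U\<close>.  Comparing with reflections of the rows shows
  \<open>H \<ge> 0\<close>.
\<close>

lemma polar_decomposition:
  fixes R :: "real^'p::finite^'d::finite"
  assumes "CARD('d) \<le> CARD('p)"
  obtains U :: "real^'p^'d" where "U ** transpose U = mat 1"
    "transpose (R ** transpose U) = R ** transpose U"
    "\<And>y. 0 \<le> y \<bullet> ((R ** transpose U) *v y)"
    "R = R ** transpose U ** U"
proof -
  let ?K = "{E::real^'p^'d. E ** transpose E = mat 1}"
  have "?K \<noteq> {}" using orthonormal_rows_exist[OF assms] by blast
  then have "\<exists>U\<in>?K. \<forall>E\<in>?K. R \<bullet> E \<le> R \<bullet> U"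
    by (intro continuous_attains_sup orthonormal_rows_compact continuous_intros)
  then obtain U where U: "U ** transpose U = mat 1"
    and max: "\<And>E. E ** transpose E = mat 1 \<Longrightarrow> R \<bullet> E \<le> R \<bullet> U" by auto
  have rows: "U $ a \<bullet> U $ b = (if a = b then 1 else 0)" for a b
    using U by (simp add: rows_orthonormal_iff)
  have sym: "(\<Sum>a\<in>UNIV. U $ a $ i * R $ a $ j) = (\<Sum>a\<in>UNIV. U $ a $ j * R $ a $ i)" for i j
  proof (cases "i = j")
    case False
    define e f :: "real^'p" where "e = axis i 1" and "f = axis j 1"
    have ef: "e \<bullet> e = 1" "f \<bullet> f = 1" "e \<bullet> f = 0"
      using False by (simp_all add: e_def f_def inner_axis_axis)
    define \<beta> where "\<beta> = (\<Sum>a\<in>UNIV. (U $ a \<bullet> e) * (R $ a \<bullet> e) + (U $ a \<bullet> f) * (R $ a \<bullet> f))"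
    define \<gamma> where "\<gamma> = (\<Sum>a\<in>UNIV. (U $ a \<bullet> e) * (R $ a \<bullet> f) - (U $ a \<bullet> f) * (R $ a \<bullet> e))"
    have "\<gamma> = 0"
    proof (rule rotation_derivative_zero)
      fix c s :: real assume cs: "c\<^sup>2 + s\<^sup>2 = 1"
      define rot where "rot = (\<lambda>v. v + ((c - 1) * (v \<bullet> e) - s * (v \<bullet> f)) *\<^sub>R e
                         + (s * (v \<bullet> e) + (c - 1) * (v \<bullet> f)) *\<^sub>R f)"
      have "rot v \<bullet> rot w = v \<bullet> w" for v w
        unfolding rot_def by (rule plane_rotation_isometry[OF ef cs])
      then have "R \<bullet> (\<chi> a. rot (U $ a)) \<le> R \<bullet> U"
        by (intro max) (simp add: rows_orthonormal_iff rows)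
      also have "R \<bullet> (\<chi> a. rot (U $ a)) = R \<bullet> U + ((c - 1) * \<beta> + s * \<gamma>)"
        unfolding \<beta>_def \<gamma>_def
        by (simp add: inner_eq_sum_rows rot_def inner_add_right sum.distrib sum_subtractf
            sum_distrib_left algebra_simps)
      finally show "(c - 1) * \<beta> + s * \<gamma> \<le> 0" by simp
    qed
    then show ?thesis by (simp add: \<gamma>_def e_def f_def inner_axis sum_subtractf)
  qed simp
  have W: "transpose U ** R = transpose R ** U"
    using sym by (simp add: vec_eq_iff matrix_matrix_mult_def transpose_def mult.commute)
  have R: "R = U ** transpose R ** U"
    using arg_cong[OF W, of "\<lambda>X. U ** X"] by (simp add: matrix_mul_assoc U)
  have H: "R ** transpose U = U ** transpose R"
    by (subst R) (simp add: matrix_mul_assoc[symmetric] U)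
  have psd: "0 \<le> y \<bullet> ((R ** transpose U) *v y)" for y
  proof (cases "y = 0")
    case False
    define z where "z = transpose U *v y"
    have Uz: "U *v z = y" by (simp add: z_def matrix_vector_mul_assoc U)
    have Uaz: "U $ a \<bullet> z = y $ a" for a
      using Uz by (simp add: matrix_vector_mul_component vec_eq_iff)
    have zUa: "z \<bullet> U $ a = y $ a" for a using Uaz[of a] by (simp add: inner_commute)
    have zz: "z \<bullet> z = y \<bullet> y"
      using inner_matrix_vector[of U z y] Uz by (simp add: z_def)
    define k where "k = 2 / (y \<bullet> y)"
    have k: "k * (y \<bullet> y) = 2" using False by (simp add: k_def)
    \<comment> \<open>\<open>E\<close> is the reflection \<open>(1 - 2 y y\<^sup>T / |y|\<^sup>2) U\<close>.\<close>
    define E where "E = U - k *\<^sub>R outer y z"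
    have Ea: "E $ a = U $ a - (k * y $ a) *\<^sub>R z" for a
      by (simp add: E_def outer_def vec_eq_iff)
    have "E $ a \<bullet> E $ b = U $ a \<bullet> U $ b + k * y $ a * y $ b * (k * (y \<bullet> y) - 2)" for a b
      by (simp add: Ea inner_diff_left inner_diff_right Uaz zUa zz algebra_simps)
    then have "E ** transpose E = mat 1" by (simp add: rows_orthonormal_iff rows k)
    then have "R \<bullet> E \<le> R \<bullet> U" by (rule max)
    then have "0 \<le> k * (outer y z \<bullet> R)" by (simp add: E_def inner_diff_right inner_commute)
    moreover have "0 < k" using False by (simp add: k_def)
    ultimately have "0 \<le> outer y z \<bullet> R" by (simp add: zero_le_mult_iff)
    then show ?thesis by (simp add: outer_inner z_def matrix_vector_mul_assoc)
  qed simp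
  show thesis
  proof (rule that[OF U _ psd])
    show "transpose (R ** transpose U) = R ** transpose U"
      using H by (simp add: matrix_transpose_mul)
    show "R = R ** transpose U ** U" using R H by simp
  qed
qed

section \<open>Averages over tangent directions\<close>

lemma outer_matrix_mult: "outer x y ** M = outer x (transpose M *v y)"
  by (simp add: outer_def vec_eq_iff matrix_matrix_mult_def matrix_vector_mult_def transpose_def
      sum_distrib_left mult_ac)

lemma matrix_outer_mult: "M ** outer x y = outer (M *v x) y"
  by (simp add: outer_def vec_eq_iff matrix_matrix_mult_def matrix_vector_mult_def sum_distrib_left mult_ac)

lemma outer_inner_outer: "outer x y \<bullet> outer x' y' = (x \<bullet> x') * (y \<bullet> y')"
  by (simp add: outer_inner outer_vector inner_commute)

lemma sum_axis_inner:
  fixes v w :: "real^'k::finite"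
  shows "(\<Sum>a\<in>UNIV. (axis a 1 \<bullet> v) * (axis a 1 \<bullet> w)) = v \<bullet> w"
  by (simp add: inner_axis', simp add: inner_vec_def)

lemma sum_axis_columns:
  fixes M N :: "real^'k::finite^'l::finite"
  shows "(\<Sum>b\<in>UNIV. (M *v axis b 1) \<bullet> (N *v axis b 1)) = M \<bullet> N"
  by (simp add: matrix_vector_mult_basis column_def inner_vec_def) (rule sum.swap)

lemma sum_axis_trace:
  fixes M :: "real^'k::finite^'k"
  shows "(\<Sum>a\<in>UNIV. axis a 1 \<bullet> (M *v axis a 1)) = trace M"
  by (simp add: matrix_vector_mult_basis column_def trace_def inner_axis')

text \<open>
  The difference \<open>\<Phi> - turn \<tau> t \<Phi>\<close> is tangent to the Stiefel manifold at \<open>t\<close>: it consists of the part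
  of \<open>\<Phi>\<close> normal to the row space of \<open>t\<close> and of \<open>\<tau>\<close> times the rotation
  \<open>(\<Phi> t\<^sup>T - t \<Phi>\<^sup>T) t\<close>.
\<close>

definition turn :: "real \<Rightarrow> real^'p^'d \<Rightarrow> real^'p^'d \<Rightarrow> real^'p^'d" where
  "turn \<tau> t \<Phi> = (1 - \<tau>) *\<^sub>R (\<Phi> ** (transpose t ** t)) + \<tau> *\<^sub>R (t ** transpose \<Phi> ** t)"

definition unit_matrix :: "'d::finite \<Rightarrow> 'p::finite \<Rightarrow> real^'p^'d" where
  "unit_matrix a b = outer (axis a 1) (axis b 1)"

lemma turn_unit_matrix:
  "turn \<tau> t (unit_matrix a b) =
     (1 - \<tau>) *\<^sub>R outer (axis a 1) (transpose t *v (t *v axis b 1))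
     + \<tau> *\<^sub>R outer (t *v axis b 1) (transpose t *v axis a 1)"
  by (simp add: turn_def unit_matrix_def transpose_outer outer_matrix_mult matrix_outer_mult
      matrix_transpose_mul matrix_vector_mul_assoc)

text \<open>
  This is where \<open>q\<close> comes from: of the four products of the two parts of \<open>turn\<close>, the first one
  contributes \<open>d (1 - \<tau>)\<^sup>2\<close> and the mixed ones \<open>2 \<tau> (1 - \<tau>)\<close> times the inner product of the Gram
  matrices.
\<close>

lemma sum_turn_inner:
  fixes t s :: "real^'p::finite^'d::finite"
  shows "(\<Sum>a\<in>UNIV. \<Sum>b\<in>UNIV. turn \<tau> t (unit_matrix a b) \<bullet> turn \<tau> s (unit_matrix a b))
     = q_fun CARD('d) \<tau> * ((transpose t ** t) \<bullet> (transpose s ** s)) + \<tau>\<^sup>2 * (t \<bullet> s)\<^sup>2"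
proof -
  define M N where "M = transpose t ** t" and "N = transpose s ** s"
  let ?e = "\<lambda>a::'d. axis a (1::real)" and ?f = "\<lambda>b::'p. axis b (1::real)"
  have ee: "?e a \<bullet> ?e a = 1" for a by (simp add: inner_axis_axis)
  have expand: "turn \<tau> t (unit_matrix a b) \<bullet> turn \<tau> s (unit_matrix a b) =
      (1 - \<tau>)\<^sup>2 * ((M *v ?f b) \<bullet> (N *v ?f b))
      + (1 - \<tau>) * \<tau> * ((?e a \<bullet> (s *v ?f b)) * (?e a \<bullet> (s *v (M *v ?f b)))
                     + (?e a \<bullet> (t *v ?f b)) * (?e a \<bullet> (t *v (N *v ?f b))))
      + \<tau>\<^sup>2 * (((t *v ?f b) \<bullet> (s *v ?f b)) * ((transpose t *v ?e a) \<bullet> (transpose s *v ?e a)))" for a b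
  proof -
    have 1: "x \<bullet> (transpose s *v ?e a) = ?e a \<bullet> (s *v x)" "(transpose t *v ?e a) \<bullet> x = ?e a \<bullet> (t *v x)" for x
      using inner_matrix_vector[of s x "?e a"] inner_matrix_vector[of t x "?e a"] by (simp_all add: inner_commute)
    have 2: "(t *v ?f b) \<bullet> ?e a = ?e a \<bullet> (t *v ?f b)" by (rule inner_commute)
    show ?thesis
      unfolding turn_unit_matrix matrix_vector_mul_assoc M_def[symmetric] N_def[symmetric]
      by (simp add: inner_add_left inner_add_right outer_inner_outer ee 1 2 matrix_vector_mul_assoc[symmetric]
          power2_eq_square algebra_simps)
  qed
  have c1: "(\<Sum>a\<in>UNIV. (?e a \<bullet> (s *v ?f b)) * (?e a \<bullet> (s *v (M *v ?f b)))) = (M *v ?f b) \<bullet> (N *v ?f b)" for b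
    unfolding sum_axis_inner using inner_matrix_vector[of s "?f b" "s *v (M *v ?f b)"]
      inner_matrix_vector[of s "M *v ?f b" "s *v ?f b"]
    by (simp add: N_def matrix_vector_mul_assoc inner_commute)
  have c2: "(\<Sum>a\<in>UNIV. (?e a \<bullet> (t *v ?f b)) * (?e a \<bullet> (t *v (N *v ?f b)))) = (M *v ?f b) \<bullet> (N *v ?f b)" for b
    unfolding sum_axis_inner using inner_matrix_vector[of t "N *v ?f b" "t *v ?f b"]
    by (simp add: M_def matrix_vector_mul_assoc inner_commute)
  have c3: "(\<Sum>a\<in>UNIV. \<Sum>b\<in>UNIV. ((t *v ?f b) \<bullet> (s *v ?f b)) * ((transpose t *v ?e a) \<bullet> (transpose s *v ?e a)))
      = (t \<bullet> s)\<^sup>2"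
    unfolding sum_distrib_right[symmetric] sum_distrib_left[symmetric] sum_axis_columns inner_transpose_matrix
    by (simp add: power2_eq_square)
  have "(\<Sum>a\<in>UNIV. \<Sum>b\<in>UNIV. turn \<tau> t (unit_matrix a b) \<bullet> turn \<tau> s (unit_matrix a b))
    = (\<Sum>a::'d\<in>UNIV. \<Sum>b\<in>UNIV. (1 - \<tau>)\<^sup>2 * ((M *v ?f b) \<bullet> (N *v ?f b)))
      + (1 - \<tau>) * \<tau> * ((\<Sum>b\<in>UNIV. \<Sum>a\<in>UNIV. (?e a \<bullet> (s *v ?f b)) * (?e a \<bullet> (s *v (M *v ?f b))))
      + (\<Sum>b\<in>UNIV. \<Sum>a\<in>UNIV. (?e a \<bullet> (t *v ?f b)) * (?e a \<bullet> (t *v (N *v ?f b)))))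
      + \<tau>\<^sup>2 * (t \<bullet> s)\<^sup>2"
    unfolding expand c3[symmetric] sum.distrib sum_distrib_left[symmetric]
    by (simp add: sum.swap[of _ "UNIV::'d set" "UNIV::'p set"])
  also have "\<dots> = (real CARD('d) * (1 - \<tau>)\<^sup>2 + 2 * ((1 - \<tau>) * \<tau>)) * (M \<bullet> N) + \<tau>\<^sup>2 * (t \<bullet> s)\<^sup>2"
    unfolding c1 c2 sum_axis_columns sum_distrib_left[symmetric] by (simp add: algebra_simps)
  also have "real CARD('d) * (1 - \<tau>)\<^sup>2 + 2 * ((1 - \<tau>) * \<tau>) = q_fun CARD('d) \<tau>"
    by (simp add: q_fun_def power2_eq_square algebra_simps)
  finally show ?thesis unfolding M_def N_def .
qed

text \<open>
  This is where \<open>r\<close> comes from: the second moment \<open>\<Sum> V V\<^sup>T\<close> of the tangent directions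
  is \<open>r(\<tau>)\<close> times the identity, so a multiplier \<open>\<Lambda>\<close> enters only through its trace.
\<close>

lemma sum_tangent_moment:
  fixes t :: "real^'p::finite^'d::finite" and \<Lambda> :: "real^'d^'d" and \<tau> :: real
  assumes st: "t ** transpose t = mat 1" and sym: "transpose \<Lambda> = \<Lambda>"
  defines "V \<equiv> \<lambda>a b. unit_matrix a b - turn \<tau> t (unit_matrix a b)"
  shows "(\<Sum>a\<in>UNIV. \<Sum>b\<in>UNIV. (\<Lambda> ** V a b) \<bullet> V a b) = r_fun CARD('p) CARD('d) \<tau> * trace \<Lambda>"
proof -
  let ?e = "\<lambda>a::'d. axis a (1::real)" and ?f = "\<lambda>b::'p. axis b (1::real)"
  have tt: "t *v (transpose t *v v) = v" for v by (simp add: matrix_vector_mul_assoc st)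
  have ad: "x \<bullet> (transpose t *v v) = (t *v x) \<bullet> v" for x v
    using inner_matrix_vector[of t x v] by simp
  define u where "u = (\<lambda>b. ?f b - (1 - \<tau>) *\<^sub>R (transpose t *v (t *v ?f b)))"
  have V: "V a b = outer (?e a) (u b) - \<tau> *\<^sub>R outer (t *v ?f b) (transpose t *v ?e a)" for a b
    unfolding V_def turn_unit_matrix by (simp add: unit_matrix_def u_def outer_def vec_eq_iff algebra_simps)
  have ut: "u b \<bullet> (transpose t *v ?e a) = \<tau> * (?e a \<bullet> (t *v ?f b))" for a b
    by (simp add: ad u_def tt matrix_vector_mult_diff_distrib matrix_vector_mult_scaleR inner_diff_left
        inner_commute[of "?e a" "t *v ?f b"] algebra_simps)
  have da: "(transpose t *v v) \<bullet> x = v \<bullet> (t *v x)" for x v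
    using ad[of x v] by (simp add: inner_commute)
  have uu: "u b \<bullet> u b = 1 - (1 - \<tau>\<^sup>2) * ((t *v ?f b) \<bullet> (t *v ?f b))" for b
    by (simp add: u_def inner_diff_left inner_diff_right ad da tt inner_axis_axis power2_eq_square algebra_simps)
  have expand: "(\<Lambda> ** V a b) \<bullet> V a b =
      (?e a \<bullet> (\<Lambda> *v ?e a)) * (1 - (1 - \<tau>\<^sup>2) * ((t *v ?f b) \<bullet> (t *v ?f b)))
      - 2 * \<tau>\<^sup>2 * ((?f b \<bullet> (transpose t *v (\<Lambda> *v ?e a))) * (?f b \<bullet> (transpose t *v ?e a)))
      + \<tau>\<^sup>2 * (((\<Lambda> ** t) *v ?f b) \<bullet> (t *v ?f b))" for a b
  proof -
    have 1: "(transpose t *v ?e a) \<bullet> (transpose t *v ?e a) = 1"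
      by (simp add: ad tt inner_axis_axis)
    have 2: "(\<Lambda> *v (t *v ?f b)) \<bullet> ?e a = (t *v ?f b) \<bullet> (\<Lambda> *v ?e a)"
      using inner_matrix_vector[of \<Lambda> "t *v ?f b" "?e a"] sym by simp
    have 3: "(\<Lambda> *v ?e a) \<bullet> (t *v ?f b) = (t *v ?f b) \<bullet> (\<Lambda> *v ?e a)"
      "(\<Lambda> *v ?e a) \<bullet> ?e a = ?e a \<bullet> (\<Lambda> *v ?e a)"
      "(transpose t *v ?e a) \<bullet> u b = u b \<bullet> (transpose t *v ?e a)" by (rule inner_commute)+
    have LV: "\<Lambda> ** V a b = outer (\<Lambda> *v ?e a) (u b) - \<tau> *\<^sub>R outer (\<Lambda> *v (t *v ?f b)) (transpose t *v ?e a)"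
      unfolding V by (simp add: matrix_mult_diff_right
          matrix_mult_scaleR_right matrix_outer_mult)
    have "(\<Lambda> ** V a b) \<bullet> V a b = (?e a \<bullet> (\<Lambda> *v ?e a)) * (u b \<bullet> u b)
        - 2 * \<tau> * (((t *v ?f b) \<bullet> (\<Lambda> *v ?e a)) * (u b \<bullet> (transpose t *v ?e a)))
        + \<tau>\<^sup>2 * ((\<Lambda> *v (t *v ?f b)) \<bullet> (t *v ?f b))"
      unfolding LV unfolding V
      by (simp add: inner_diff_left inner_diff_right outer_inner_outer 1 2 3 power2_eq_square algebra_simps)
    then show ?thesis
      unfolding uu ut by (simp add: ad inner_commute[of "?e a" "t *v ?f b"] matrix_vector_mul_assoc[symmetric]
          power2_eq_square)
  qed
  have c1: "(\<Sum>b\<in>UNIV. (?f b \<bullet> (transpose t *v (\<Lambda> *v ?e a))) * (?f b \<bullet> (transpose t *v ?e a)))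
      = ?e a \<bullet> (\<Lambda> *v ?e a)" for a
    unfolding sum_axis_inner by (simp add: ad tt inner_commute)
  have tr: "(\<Lambda> ** t) \<bullet> t = trace \<Lambda>" "t \<bullet> t = real CARD('d)"
    using inner_mult_left_matrix[of \<Lambda> t t] inner_mat_1[of \<Lambda>] orthonormal_rows_inner_self[OF st]
    by (simp_all add: st inner_commute)
  have "(\<Sum>a\<in>UNIV. \<Sum>b\<in>UNIV. (\<Lambda> ** V a b) \<bullet> V a b)
    = (\<Sum>a\<in>UNIV. (?e a \<bullet> (\<Lambda> *v ?e a)) * (real CARD('p) - (1 - \<tau>\<^sup>2) * real CARD('d))
        - 2 * \<tau>\<^sup>2 * (?e a \<bullet> (\<Lambda> *v ?e a)) + \<tau>\<^sup>2 * trace \<Lambda>)"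
    unfolding expand
    by (simp only: sum.distrib sum_subtractf sum_distrib_left[symmetric] sum_axis_columns c1 tr)
      (simp add: sum_axis_columns tr)
  also have "\<dots> = r_fun CARD('p) CARD('d) \<tau> * trace \<Lambda>"
    by (simp add: sum.distrib sum_subtractf sum_distrib_left[symmetric] sum_distrib_right[symmetric]
        sum_axis_trace r_fun_def algebra_simps)
  finally show ?thesis .
qed

section \<open>Critical configurations\<close>

text \<open>
  The inner product of the deviations of \<open>F\<close> and \<open>G\<close> from their means; \<open>centered F F\<close> is the squared
  distance of \<open>F\<close> to the constant configurations.
\<close>

definition centered :: "'a::real_inner^'n::finite \<Rightarrow> 'a^'n \<Rightarrow> real" where
  "centered F G = F \<bullet> G - (1 / real CARD('n)) * ((\<Sum>i\<in>UNIV. F $ i) \<bullet> (\<Sum>i\<in>UNIV. G $ i))"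

lemma centered_diff_scaleR:
  "centered (F - c *\<^sub>R G) (F - c *\<^sub>R G) = centered F F - 2 * c * centered G F + c\<^sup>2 * centered G G"
proof -
  define f g where "f = (\<Sum>i\<in>UNIV. F $ i)" and "g = (\<Sum>i\<in>UNIV. G $ i)"
  have S: "(\<Sum>i\<in>UNIV. (F - c *\<^sub>R G) $ i) = f - c *\<^sub>R g"
    by (simp add: f_def g_def sum_subtractf scaleR_sum_right)
  show ?thesis
    unfolding centered_def S f_def[symmetric] g_def[symmetric]
    by (simp add: inner_diff_left inner_diff_right inner_commute[of F G] inner_commute[of f g]
        power2_eq_square algebra_simps)
qed

lemma linear_centered: "linear (centered F)"
  by (rule linearI)
    (simp_all add: centered_def inner_add_right sum.distrib inner_sum_right[symmetric]
      scaleR_sum_right[symmetric] algebra_simps)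

lemma linear_turn: "linear (turn \<tau> t)"
proof -
  note L = matrix_mult_add_left
    matrix_mult_add_right
    matrix_mult_scaleR_left
    matrix_mult_scaleR_right
  have T: "transpose (X + Y) = transpose X + transpose Y" "transpose (c *\<^sub>R X) = c *\<^sub>R transpose X"
    for X Y :: "real^'a^'b" and c by (simp_all add: transpose_def vec_eq_iff)
  show ?thesis
    by (rule linearI) (simp_all add: turn_def L T algebra_simps)
qed

lemma matrix_eq_sum_unit_matrices:
  "(U::real^'p::finite^'d::finite) = (\<Sum>a\<in>UNIV. \<Sum>b\<in>UNIV. (U $ a $ b) *\<^sub>R unit_matrix a b)"
proof -
  have "(\<Sum>a\<in>UNIV. \<Sum>b\<in>UNIV. (U $ a $ b) *\<^sub>R unit_matrix a b) $ i $ j = U $ i $ j" for i j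
  proof -
    have "unit_matrix a b $ i $ j = (if a = i \<and> b = j then 1 else 0)" for a b
      by (simp add: unit_matrix_def outer_def axis_def)
    then have "(\<Sum>a\<in>UNIV. \<Sum>b\<in>UNIV. (U $ a $ b) *\<^sub>R unit_matrix a b) $ i $ j
        = (\<Sum>a\<in>UNIV. \<Sum>b\<in>UNIV. if a = i \<and> b = j then U $ a $ b else 0)"
      by (simp add: if_distrib[of "\<lambda>x. _ * x"] cong: if_cong)
    also have "\<dots> = (\<Sum>a\<in>UNIV. if a = i then U $ a $ j else 0)"
    proof (intro sum.cong refl)
      show "(\<Sum>b\<in>UNIV. if a = i \<and> b = j then U $ a $ b else 0) = (if a = i then U $ a $ j else 0)" for a
        by (cases "a = i") simp_all
    qed
    finally show ?thesis by simp
  qed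
  then show ?thesis by (simp add: vec_eq_iff)
qed

text \<open>
  For a symmetric multiplier, \<open>turn\<close> cannot be distinguished from \<open>\<Phi>\<close> by \<open>\<Lambda> t\<close>: both of
  its parts have the same inner product with \<open>\<Lambda> t\<close> as \<open>\<Phi>\<close>.
\<close>

lemma inner_turn:
  fixes t \<Phi> :: "real^'p::finite^'d::finite" and \<Lambda> :: "real^'d^'d"
  assumes st: "t ** transpose t = mat 1" and sym: "transpose \<Lambda> = \<Lambda>"
  shows "(\<Lambda> ** t) \<bullet> turn \<tau> t \<Phi> = (\<Lambda> ** t) \<bullet> \<Phi>"
proof -
  have 1: "(\<Lambda> ** t) \<bullet> (\<Phi> ** (transpose t ** t)) = (\<Lambda> ** t) \<bullet> \<Phi>"
  proof -
    have "(\<Phi> ** (transpose t ** t)) \<bullet> (\<Lambda> ** t) = \<Phi> \<bullet> (\<Lambda> ** (t ** transpose t) ** t)"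
      unfolding inner_mult_left_matrix by (simp add: matrix_transpose_mul matrix_mul_assoc)
    then show ?thesis by (simp add: st inner_commute)
  qed
  have 2: "(\<Lambda> ** t) \<bullet> (t ** transpose \<Phi> ** t) = (\<Lambda> ** t) \<bullet> \<Phi>"
  proof -
    have "(t ** transpose \<Phi> ** t) \<bullet> (\<Lambda> ** t) = (t ** transpose \<Phi>) \<bullet> (\<Lambda> ** (t ** transpose t))"
      unfolding inner_mult_left_matrix by (simp add: matrix_mul_assoc)
    also have "\<dots> = transpose (t ** transpose \<Phi>) \<bullet> transpose \<Lambda>" by (simp add: st inner_transpose_matrix)
    also have "\<dots> = (\<Phi> ** transpose t) \<bullet> \<Lambda>" by (simp add: sym matrix_transpose_mul)
    also have "\<dots> = (\<Lambda> ** t) \<bullet> \<Phi>"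
      using inner_mult_left_matrix[of \<Lambda> t \<Phi>] by (simp add: inner_commute)
    finally show ?thesis by (simp add: inner_commute)
  qed
  show ?thesis by (simp add: turn_def inner_add_right 1 2 algebra_simps)
qed

text \<open>
  The situation after the blocks of \<open>Z\<close> have been rotated to the identity.  An element of the type
  \<open>real^'p^'d^'n\<close> is a family of \<open>n\<close> matrices; \<open>\<mu>\<close> and \<open>\<alpha>\<mu>\<close> are bounds for the positive spectrum of
  \<open>L\<close>, and \<open>\<Lambda>\<close> collects the Lagrange multipliers of the constraints \<open>T\<^sub>i T\<^sub>i\<^sup>T = 1\<close>.
\<close>

locale critical_configuration =
  fixes L :: "real^'p::finite^'d::finite^'n::finite \<Rightarrow> real^'p^'d^'n"
    and T :: "real^'p^'d^'n" and \<Lambda> :: "real^'d^'d^'n" and \<mu> \<alpha> :: real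
  assumes lin: "linear L" and self: "\<And>F G. L F \<bullet> G = F \<bullet> L G"
    and const: "\<And>\<Phi>. L (\<chi> i. \<Phi>) = 0"
    and \<mu>: "0 < \<mu>" and \<alpha>: "1 < \<alpha>"
    and lower: "\<And>F. \<mu> * centered F F \<le> L F \<bullet> F"
    and upper: "\<And>F. L F \<bullet> F \<le> \<alpha> * (\<mu> * centered F F)"
    and stiefel: "\<And>i. T $ i ** transpose (T $ i) = mat 1"
    and sym: "\<And>i. transpose (\<Lambda> $ i) = \<Lambda> $ i"
    and first_order: "\<And>G. L T \<bullet> G = (\<Sum>i\<in>UNIV. (\<Lambda> $ i ** T $ i) \<bullet> G $ i)"
    and second_order: "\<And>G. (\<And>i. G $ i ** transpose (T $ i) + T $ i ** transpose (G $ i) = 0) \<Longrightarrow>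
        (\<Sum>i\<in>UNIV. (\<Lambda> $ i ** G $ i) \<bullet> G $ i) \<le> L G \<bullet> G"
    and card: "CARD('d) < CARD('p)"
begin

definition turns :: "real \<Rightarrow> real^'p^'d \<Rightarrow> real^'p^'d^'n" where
  "turns \<tau> \<Phi> = (\<chi> i. turn \<tau> (T $ i) \<Phi>)"

text \<open>
  By the first-order condition and \<open>inner_turn\<close> this inner product is the same as with the constant
  configuration \<open>\<Phi>\<close>, which \<open>L\<close> annihilates.
\<close>

lemma orthogonal_to_turns: "L T \<bullet> turns \<tau> \<Phi> = 0"
proof -
  have "L T \<bullet> turns \<tau> \<Phi> = (\<Sum>i\<in>UNIV. (\<Lambda> $ i ** T $ i) \<bullet> \<Phi>)"
    by (simp add: first_order turns_def inner_turn[OF stiefel sym])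
  also have "\<dots> = L T \<bullet> (\<chi> i. \<Phi>)" by (simp add: first_order)
  also have "\<dots> = 0" by (simp add: self const)
  finally show ?thesis .
qed

lemma tangent_turn: "(\<Phi> - turn \<tau> (T $ i) \<Phi>) ** transpose (T $ i)
     + T $ i ** transpose (\<Phi> - turn \<tau> (T $ i) \<Phi>) = 0"
proof -
  let ?t = "T $ i"
  have tT: "transpose (X - Y) = transpose X - transpose Y" for X Y :: "real^'p^'d"
    by (simp add: transpose_def vec_eq_iff)
  have sT: "transpose (c *\<^sub>R X + e *\<^sub>R Y) = c *\<^sub>R transpose X + e *\<^sub>R transpose Y" for X Y :: "real^'e^'f" and c e
    by (simp add: transpose_def vec_eq_iff)
  have W: "turn \<tau> ?t \<Phi> ** transpose ?t = (1 - \<tau>) *\<^sub>R (\<Phi> ** transpose ?t) + \<tau> *\<^sub>R (?t ** transpose \<Phi>)"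
  proof -
    have "(\<Phi> ** (transpose ?t ** ?t)) ** transpose ?t = \<Phi> ** transpose ?t ** (?t ** transpose ?t)"
      "(?t ** transpose \<Phi> ** ?t) ** transpose ?t = ?t ** transpose \<Phi> ** (?t ** transpose ?t)"
      by (simp_all only: matrix_mul_assoc)
    then show ?thesis
      by (simp add: turn_def stiefel matrix_mult_add_left
        matrix_mult_scaleR_left)
  qed
  have "?t ** transpose (turn \<tau> ?t \<Phi>) = transpose (turn \<tau> ?t \<Phi> ** transpose ?t)"
    by (simp add: matrix_transpose_mul)
  also have "\<dots> = (1 - \<tau>) *\<^sub>R (?t ** transpose \<Phi>) + \<tau> *\<^sub>R (\<Phi> ** transpose ?t)"
    unfolding W sT by (simp add: matrix_transpose_mul)
  finally have B: "?t ** transpose (turn \<tau> ?t \<Phi>)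
      = (1 - \<tau>) *\<^sub>R (?t ** transpose \<Phi>) + \<tau> *\<^sub>R (\<Phi> ** transpose ?t)" .
  show ?thesis
    unfolding tT matrix_mult_diff_left
        matrix_mult_diff_right W B by (simp add: algebra_simps)
qed

text \<open>
  The second-order condition summed over the tangent configurations \<open>\<Phi> - turn \<tau> T \<Phi>\<close>, where \<open>\<Phi>\<close> runs
  through the matrix units.
\<close>

lemma tangent_average:
  "r_fun CARD('p) CARD('d) \<tau> * (L T \<bullet> T)
     \<le> (\<Sum>a\<in>UNIV. \<Sum>b\<in>UNIV. L (turns \<tau> (unit_matrix a b)) \<bullet> turns \<tau> (unit_matrix a b))"
proof -
  have LT: "L T \<bullet> T = (\<Sum>i\<in>UNIV. trace (\<Lambda> $ i))"
    by (simp add: first_order inner_mult_left_matrix stiefel inner_commute[of _ "mat 1"] inner_mat_1)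
  define V where "V = (\<lambda>a b. (\<chi> i. unit_matrix a b) - turns \<tau> (unit_matrix a b))"
  have Vi: "V a b $ i = unit_matrix a b - turn \<tau> (T $ i) (unit_matrix a b)" for a b i
    by (simp add: V_def turns_def)
  have "r_fun CARD('p) CARD('d) \<tau> * (L T \<bullet> T)
      = (\<Sum>i\<in>UNIV. \<Sum>a\<in>UNIV. \<Sum>b\<in>UNIV. (\<Lambda> $ i ** V a b $ i) \<bullet> V a b $ i)"
    unfolding LT Vi sum_tangent_moment[OF stiefel sym] by (simp add: sum_distrib_left)
  also have "\<dots> = (\<Sum>a\<in>UNIV. \<Sum>i\<in>UNIV. \<Sum>b\<in>UNIV. (\<Lambda> $ i ** V a b $ i) \<bullet> V a b $ i)"
    by (rule sum.swap)
  also have "\<dots> = (\<Sum>a\<in>UNIV. \<Sum>b\<in>UNIV. \<Sum>i\<in>UNIV. (\<Lambda> $ i ** V a b $ i) \<bullet> V a b $ i)"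
    by (intro sum.cong refl sum.swap)
  also have "\<dots> \<le> (\<Sum>a\<in>UNIV. \<Sum>b\<in>UNIV. L (V a b) \<bullet> V a b)"
    by (intro sum_mono second_order) (unfold Vi, rule tangent_turn)
  also have "\<dots> = (\<Sum>a\<in>UNIV. \<Sum>b\<in>UNIV. L (turns \<tau> (unit_matrix a b)) \<bullet> turns \<tau> (unit_matrix a b))"
  proof -
    have "L (V a b) \<bullet> V a b = L (turns \<tau> (unit_matrix a b)) \<bullet> turns \<tau> (unit_matrix a b)" for a b
    proof -
      have LV: "L (V a b) = - L (turns \<tau> (unit_matrix a b))"
        by (simp add: V_def linear_diff[OF lin] const)
      have "L (turns \<tau> (unit_matrix a b)) \<bullet> (\<chi> i. unit_matrix a b) = 0" by (simp add: self const)
      then show ?thesis unfolding LV by (simp add: V_def inner_diff_right)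
    qed
    then show ?thesis by simp
  qed
  finally show ?thesis .
qed

lemma linear_turns: "linear (turns \<tau>)"
  by (rule linearI)
    (simp_all add: turns_def vec_eq_iff linear_add[OF linear_turn] linear_scale[OF linear_turn])

text \<open>
  The upper bound for \<open>L\<close> is applied to \<open>turn \<tau> T \<Phi> - \<epsilon> \<langle>\<Phi>, U\<rangle> T\<close> instead of
  \<open>turn \<tau> T \<Phi>\<close>.  Since \<open>L T\<close> is orthogonal to all turns, the left side changes
  only by \<open>\<epsilon>\<^sup>2 |U|\<^sup>2 \<langle>L T, T\<rangle>\<close>, whereas the right side gains a term linear in \<open>\<epsilon>\<close>.
\<close>

lemma master_inequality:
  assumes "U \<bullet> U = real CARD('d)"
  shows "(r_fun CARD('p) CARD('d) \<tau> + \<epsilon>\<^sup>2 * real CARD('d)) * centered T T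
    \<le> \<alpha> * ((\<Sum>a\<in>UNIV. \<Sum>b\<in>UNIV. centered (turns \<tau> (unit_matrix a b)) (turns \<tau> (unit_matrix a b)))
           - 2 * \<epsilon> * centered T (turns \<tau> U) + \<epsilon>\<^sup>2 * real CARD('d) * centered T T)"
proof -
  let ?E = "\<lambda>a b. turns \<tau> (unit_matrix a b)"
  define G where "G = (\<lambda>a b. ?E a b - (\<epsilon> * U $ a $ b) *\<^sub>R T)"
  have UU: "(\<Sum>a\<in>UNIV. \<Sum>b\<in>UNIV. (\<epsilon> * U $ a $ b)\<^sup>2) = \<epsilon>\<^sup>2 * real CARD('d)"
    unfolding assms[symmetric]
    by (simp add: inner_vec_def sum_distrib_left power2_eq_square mult_ac)
  have LG: "L (G a b) \<bullet> G a b = L (?E a b) \<bullet> ?E a b + (\<epsilon> * U $ a $ b)\<^sup>2 * (L T \<bullet> T)" for a b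
  proof -
    have 0: "L T \<bullet> ?E a b = 0" "L (?E a b) \<bullet> T = 0"
      using orthogonal_to_turns by (simp_all add: self) (simp add: self[symmetric] inner_commute orthogonal_to_turns)
    show ?thesis
      by (simp add: G_def linear_diff[OF lin] linear_scale[OF lin] inner_diff_left inner_diff_right 0 power2_eq_square)
  qed
  have sumT: "(\<Sum>a\<in>UNIV. \<Sum>b\<in>UNIV. (\<epsilon> * U $ a $ b) * centered T (?E a b)) = \<epsilon> * centered T (turns \<tau> U)"
  proof -
    have "centered T (turns \<tau> U) = centered T (turns \<tau> (\<Sum>a\<in>UNIV. \<Sum>b\<in>UNIV. (U $ a $ b) *\<^sub>R unit_matrix a b))"
      using matrix_eq_sum_unit_matrices[of U] by simp
    also have "\<dots> = (\<Sum>a\<in>UNIV. \<Sum>b\<in>UNIV. U $ a $ b * centered T (?E a b))"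
      by (simp add: linear_sum[OF linear_turns] linear_sum[OF linear_centered] linear_scale[OF linear_turns]
          linear_scale[OF linear_centered])
    finally show ?thesis by (simp add: sum_distrib_left mult.assoc)
  qed
  have lT: "\<mu> * centered T T \<le> L T \<bullet> T" by (rule lower)
  have r: "0 \<le> r_fun CARD('p) CARD('d) \<tau> + \<epsilon>\<^sup>2 * real CARD('d)"
    using r_fun_pos[of "CARD('d)" "CARD('p)" \<tau>] card by (intro add_nonneg_nonneg) simp_all
  have "\<mu> * ((r_fun CARD('p) CARD('d) \<tau> + \<epsilon>\<^sup>2 * real CARD('d)) * centered T T)
      \<le> (r_fun CARD('p) CARD('d) \<tau> + \<epsilon>\<^sup>2 * real CARD('d)) * (L T \<bullet> T)"
    using mult_left_mono[OF lT r] by (simp add: mult_ac)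
  also have "\<dots> \<le> (\<Sum>a\<in>UNIV. \<Sum>b\<in>UNIV. L (?E a b) \<bullet> ?E a b) + \<epsilon>\<^sup>2 * real CARD('d) * (L T \<bullet> T)"
    using tangent_average[of \<tau>] by (simp add: distrib_right)
  also have "\<dots> = (\<Sum>a\<in>UNIV. \<Sum>b\<in>UNIV. L (G a b) \<bullet> G a b)"
    unfolding LG UU[symmetric] by (simp add: sum.distrib sum_distrib_right)
  also have "\<dots> \<le> (\<Sum>a\<in>UNIV. \<Sum>b\<in>UNIV. \<alpha> * (\<mu> * centered (G a b) (G a b)))"
    by (intro sum_mono upper)
  also have "\<dots> = \<mu> * (\<alpha> * (\<Sum>a\<in>UNIV. \<Sum>b\<in>UNIV. centered (G a b) (G a b)))"
    by (simp add: sum_distrib_left mult_ac)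
  also have "(\<Sum>a\<in>UNIV. \<Sum>b\<in>UNIV. centered (G a b) (G a b))
      = (\<Sum>a\<in>UNIV. \<Sum>b\<in>UNIV. centered (?E a b) (?E a b))
        - 2 * \<epsilon> * centered T (turns \<tau> U) + \<epsilon>\<^sup>2 * real CARD('d) * centered T T"
  proof -
    have "(\<Sum>a\<in>UNIV. \<Sum>b\<in>UNIV. centered (G a b) (G a b))
      = (\<Sum>a\<in>UNIV. \<Sum>b\<in>UNIV. centered (?E a b) (?E a b)
         - 2 * ((\<epsilon> * U $ a $ b) * centered T (?E a b)) + (\<epsilon> * U $ a $ b)\<^sup>2 * centered T T)"
      unfolding G_def centered_diff_scaleR by (simp add: mult.assoc)
    also have "\<dots> = (\<Sum>a\<in>UNIV. \<Sum>b\<in>UNIV. centered (?E a b) (?E a b))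
        - 2 * (\<Sum>a\<in>UNIV. \<Sum>b\<in>UNIV. (\<epsilon> * U $ a $ b) * centered T (?E a b))
        + (\<Sum>a\<in>UNIV. \<Sum>b\<in>UNIV. (\<epsilon> * U $ a $ b)\<^sup>2) * centered T T"
      by (simp only: sum.distrib sum_subtractf sum_distrib_left sum_distrib_right)
    finally show ?thesis unfolding sumT UU by simp
  qed
  finally show ?thesis using \<mu> by simp
qed

end

section \<open>The geometry of a configuration\<close>

lemma sum_Basis_vec: "(\<Sum>b\<in>Basis. f b) = (\<Sum>j\<in>UNIV. f (axis j 1 :: real^'k::finite))"
proof -
  have B: "(Basis :: (real^'k) set) = (\<lambda>j. axis j 1) ` UNIV" by (auto simp: Basis_vec_def)
  have "inj (\<lambda>j::'k. axis j (1::real))" by (simp add: inj_def axis_eq_axis)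
  then show ?thesis unfolding B by (simp only: sum.reindex comp_def)
qed

lemma matrix_row_mult:
  fixes t :: "real^'p::finite^'k::finite" and U :: "real^'p^'d::finite"
  shows "(t ** transpose U) $ a = U *v (t $ a)"
  by (simp add: vec_eq_iff matrix_matrix_mult_def matrix_vector_mult_def transpose_def mult.commute)

lemma gram_inner_gram:
  fixes t s :: "real^'p::finite^'d::finite"
  shows "(transpose t ** t) \<bullet> (transpose s ** s) = (\<Sum>a\<in>UNIV. \<Sum>c\<in>UNIV. (t $ a \<bullet> s $ c)\<^sup>2)"
proof -
  have "(transpose t ** t) \<bullet> (transpose s ** s) = transpose t \<bullet> transpose (t ** transpose s ** s)"
    unfolding inner_mult_left_matrix by (simp add: matrix_transpose_mul matrix_mul_assoc)
  also have "\<dots> = (t ** transpose s ** s) \<bullet> t" by (simp add: inner_transpose_matrix inner_commute)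
  also have "\<dots> = (t ** transpose s) \<bullet> (t ** transpose s)" by (simp add: inner_mult_left_matrix)
  also have "\<dots> = (\<Sum>a\<in>UNIV. \<Sum>c\<in>UNIV. (t $ a \<bullet> s $ c)\<^sup>2)"
    by (simp add: inner_vec_def matrix_matrix_mult_def transpose_def power2_eq_square)
  finally show ?thesis .
qed

lemma orthonormal_rows_transpose_norm:
  fixes t :: "real^'p::finite^'d::finite"
  assumes "t ** transpose t = mat 1"
  shows "(transpose t *v v) \<bullet> (transpose t *v v) = v \<bullet> v"
  using inner_matrix_vector[of t "transpose t *v v" v] by (simp add: matrix_vector_mul_assoc assms)

lemma orthonormal_rows_norm_le:
  fixes t :: "real^'p::finite^'d::finite"
  assumes "t ** transpose t = mat 1"
  shows "(t *v w) \<bullet> (t *v w) \<le> w \<bullet> w"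
proof -
  have "0 \<le> (w - transpose t *v (t *v w)) \<bullet> (w - transpose t *v (t *v w))" by simp
  also have "\<dots> = w \<bullet> w - 2 * (w \<bullet> (transpose t *v (t *v w))) + (t *v w) \<bullet> (t *v w)"
    using orthonormal_rows_transpose_norm[OF assms, of "t *v w"]
    by (simp add: inner_diff_left inner_diff_right inner_commute[of "transpose t *v (t *v w)" w])
  also have "w \<bullet> (transpose t *v (t *v w)) = (t *v w) \<bullet> (t *v w)"
    by (simp add: inner_matrix_vector)
  finally show ?thesis by simp
qed

text \<open>
  The product \<open>V V\<close> is not symmetric, but for quadratic forms and traces it is dominated by symmetric
  products: \<open>2 \<langle>V\<^sup>T v, V v\<rangle> \<le> |V\<^sup>T v|\<^sup>2 + |V v|\<^sup>2\<close> and \<open>tr (V V) = \<langle>V, V\<^sup>T\<rangle> \<le> |V|\<^sup>2\<close>.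
\<close>

lemma contraction_trace_bound:
  fixes V :: "real^'d::finite^'d"
  assumes "\<And>v. (V *v v) \<bullet> (V *v v) \<le> v \<bullet> v" "\<And>v. (transpose V *v v) \<bullet> (transpose V *v v) \<le> v \<bullet> v"
    and \<tau>: "0 \<le> \<tau>" "\<tau> \<le> 1"
  defines "K \<equiv> mat 1 - (1 - \<tau>) *\<^sub>R (transpose V ** V) - \<tau> *\<^sub>R (V ** V)"
  shows "0 \<le> v \<bullet> (K *v v)" and "real CARD('d) - V \<bullet> V \<le> trace K" and "V \<bullet> V \<le> real CARD('d)"
proof -
  have "K *v v = v - (1 - \<tau>) *\<^sub>R (transpose V *v (V *v v)) - \<tau> *\<^sub>R (V *v (V *v v))"
    by (simp add: K_def matrix_vector_mult_diff_rdistrib scaleR_matrix_vector_assoc[symmetric] matrix_vector_mul_assoc)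
  then have "v \<bullet> (K *v v) = v \<bullet> v - (1 - \<tau>) * ((V *v v) \<bullet> (V *v v)) - \<tau> * ((transpose V *v v) \<bullet> (V *v v))"
    using inner_matrix_vector[of V v "V *v v"] inner_matrix_vector[of "transpose V" v "V *v v"]
    by (simp add: inner_diff_right)
  moreover have "2 * ((transpose V *v v) \<bullet> (V *v v)) \<le> 2 * (v \<bullet> v)"
  proof -
    have "0 \<le> (transpose V *v v - V *v v) \<bullet> (transpose V *v v - V *v v)" by simp
    then show ?thesis using assms(1,2)[of v]
      by (simp add: inner_diff_left inner_diff_right inner_commute)
  qed
  then have "\<tau> * ((transpose V *v v) \<bullet> (V *v v)) \<le> \<tau> * (v \<bullet> v)" using \<tau> by (intro mult_left_mono) auto
  moreover have "(1 - \<tau>) * ((V *v v) \<bullet> (V *v v)) \<le> (1 - \<tau>) * (v \<bullet> v)"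
    using \<tau> assms(1) by (intro mult_left_mono) auto
  ultimately show "0 \<le> v \<bullet> (K *v v)" by (simp add: algebra_simps)
  have tr: "mat 1 \<bullet> (transpose V ** V) = V \<bullet> V" "mat 1 \<bullet> (V ** V) = V \<bullet> transpose V"
    using inner_mult_left_matrix[of "transpose V" V "mat 1"] inner_mult_left_matrix[of V V "mat 1"]
      inner_transpose_matrix[of V V]
    by (simp_all add: inner_commute)
  have "0 \<le> (V - transpose V) \<bullet> (V - transpose V)" by simp
  then have "V \<bullet> transpose V \<le> V \<bullet> V"
    using inner_transpose_matrix[of V V] inner_commute[of V "transpose V"]
    by (simp add: inner_diff_left inner_diff_right)
  then have "\<tau> * (V \<bullet> transpose V) \<le> \<tau> * (V \<bullet> V)" using \<tau> by (intro mult_left_mono)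
  moreover have "trace K = real CARD('d) - (1 - \<tau>) * (V \<bullet> V) - \<tau> * (V \<bullet> transpose V)"
    unfolding inner_mat_1[symmetric] K_def inner_diff_right inner_scaleR_right tr inner_mat_1_self ..
  ultimately show "real CARD('d) - V \<bullet> V \<le> trace K" by (simp add: algebra_simps)
  have "V \<bullet> V = (\<Sum>b\<in>UNIV. (V *v axis b 1) \<bullet> (V *v axis b 1))" by (rule sum_axis_columns[symmetric])
  also have "\<dots> \<le> (\<Sum>b\<in>(UNIV::'d set). axis b (1::real) \<bullet> axis b 1)" by (intro sum_mono assms)
  also have "\<dots> = real CARD('d)" by (simp add: inner_axis_axis)
  finally show "V \<bullet> V \<le> real CARD('d)" .
qed

context critical_configuration
begin

definition mean :: "real^'p^'d" where
  "mean = (1 / real CARD('n)) *\<^sub>R (\<Sum>i\<in>UNIV. T $ i)"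

definition spread :: real where
  "spread = real CARD('d) - mean \<bullet> mean"

lemma sum_T: "(\<Sum>i\<in>UNIV. T $ i) = real CARD('n) *\<^sub>R mean"
  by (simp add: mean_def)

lemma T_inner_self: "T $ i \<bullet> T $ i = real CARD('d)"
  by (rule orthonormal_rows_inner_self[OF stiefel])

lemma centered_T: "centered T T = real CARD('n) * spread"
  by (simp add: centered_def inner_vec_def[of T T] T_inner_self sum_T spread_def algebra_simps)

definition gram_energy :: real where
  "gram_energy = (\<Sum>i\<in>UNIV. \<Sum>j\<in>UNIV. (transpose (T $ i) ** T $ i) \<bullet> (transpose (T $ j) ** T $ j))"

definition correlation_energy :: real where
  "correlation_energy = (\<Sum>i\<in>UNIV. \<Sum>j\<in>UNIV. (T $ i \<bullet> T $ j)\<^sup>2)"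

lemma sum_centered_turns:
  "(\<Sum>a\<in>UNIV. \<Sum>b\<in>UNIV. centered (turns \<tau> (unit_matrix a b)) (turns \<tau> (unit_matrix a b)))
    = real CARD('n) * (q_fun CARD('d) \<tau> * real CARD('d) + \<tau>\<^sup>2 * (real CARD('d))\<^sup>2)
      - (1 / real CARD('n)) *
        (q_fun CARD('d) \<tau> * gram_energy
         + \<tau>\<^sup>2 * correlation_energy)"
proof -
  let ?b = "\<lambda>i a b. turn \<tau> (T $ i) (unit_matrix a b)"
  have MM: "(transpose (T $ i) ** T $ i) \<bullet> (transpose (T $ i) ** T $ i) = real CARD('d)" for i
  proof -
    have "(transpose (T $ i) ** T $ i) \<bullet> (transpose (T $ i) ** T $ i)
        = transpose (T $ i) \<bullet> transpose (T $ i ** transpose (T $ i) ** T $ i)"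
      unfolding inner_mult_left_matrix by (simp add: matrix_transpose_mul matrix_mul_assoc)
    then show ?thesis by (simp add: stiefel inner_transpose_matrix T_inner_self)
  qed
  have "centered (turns \<tau> (unit_matrix a b)) (turns \<tau> (unit_matrix a b))
      = (\<Sum>i\<in>UNIV. ?b i a b \<bullet> ?b i a b) - (1 / real CARD('n)) * (\<Sum>i\<in>UNIV. \<Sum>j\<in>UNIV. ?b i a b \<bullet> ?b j a b)" for a b
    unfolding centered_def inner_vec_def[of "turns _ _"] inner_sum_left inner_sum_right
    by (subst (2) sum.swap) (simp add: turns_def)
  then have "(\<Sum>a\<in>UNIV. \<Sum>b\<in>UNIV. centered (turns \<tau> (unit_matrix a b)) (turns \<tau> (unit_matrix a b)))
    = (\<Sum>a\<in>UNIV. \<Sum>b\<in>UNIV. \<Sum>i\<in>UNIV. ?b i a b \<bullet> ?b i a b)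
      - (1 / real CARD('n)) * (\<Sum>a\<in>UNIV. \<Sum>b\<in>UNIV. \<Sum>i\<in>UNIV. \<Sum>j\<in>UNIV. ?b i a b \<bullet> ?b j a b)"
    by (simp only: sum_subtractf sum_distrib_left)
  also have "(\<Sum>a\<in>UNIV. \<Sum>b\<in>UNIV. \<Sum>i\<in>UNIV. ?b i a b \<bullet> ?b i a b)
      = (\<Sum>i\<in>UNIV. \<Sum>a\<in>UNIV. \<Sum>b\<in>UNIV. ?b i a b \<bullet> ?b i a b)"
    by (subst sum.swap[of _ UNIV "UNIV::'n set"]) (intro sum.cong refl sum.swap)
  also have "\<dots> = real CARD('n) * (q_fun CARD('d) \<tau> * real CARD('d) + \<tau>\<^sup>2 * (real CARD('d))\<^sup>2)"
    unfolding sum_turn_inner MM T_inner_self by simp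
  also have "(\<Sum>a\<in>UNIV. \<Sum>b\<in>UNIV. \<Sum>i\<in>UNIV. \<Sum>j\<in>UNIV. ?b i a b \<bullet> ?b j a b)
     = (\<Sum>i\<in>UNIV. \<Sum>j\<in>UNIV. \<Sum>a\<in>UNIV. \<Sum>b\<in>UNIV. ?b i a b \<bullet> ?b j a b)"
  proof -
    have "(\<Sum>a\<in>UNIV. \<Sum>b\<in>UNIV. \<Sum>i\<in>UNIV. \<Sum>j\<in>UNIV. ?b i a b \<bullet> ?b j a b)
       = (\<Sum>a\<in>UNIV. \<Sum>i\<in>UNIV. \<Sum>b\<in>UNIV. \<Sum>j\<in>UNIV. ?b i a b \<bullet> ?b j a b)"
      by (intro sum.cong refl sum.swap)
    also have "\<dots> = (\<Sum>i\<in>UNIV. \<Sum>a\<in>UNIV. \<Sum>b\<in>UNIV. \<Sum>j\<in>UNIV. ?b i a b \<bullet> ?b j a b)"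
      by (rule sum.swap)
    also have "\<dots> = (\<Sum>i\<in>UNIV. \<Sum>a\<in>UNIV. \<Sum>j\<in>UNIV. \<Sum>b\<in>UNIV. ?b i a b \<bullet> ?b j a b)"
      by (intro sum.cong refl sum.swap)
    also have "\<dots> = (\<Sum>i\<in>UNIV. \<Sum>j\<in>UNIV. \<Sum>a\<in>UNIV. \<Sum>b\<in>UNIV. ?b i a b \<bullet> ?b j a b)"
      by (intro sum.cong refl sum.swap)
    finally show ?thesis .
  qed
  finally show ?thesis
    unfolding sum_turn_inner gram_energy_def correlation_energy_def
    by (simp add: sum.distrib sum_distrib_left)
qed

text \<open>
  Bessel's inequality for all rows of all \<open>T\<^sub>i\<close>, with the projection onto the row space of
  \<open>U\<close>, which has rank \<open>d\<close> in \<open>\<real>\<^sup>p\<close>.  The number \<open>t\<close> is the mean squared length that this projection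
  loses.
\<close>

lemma gram_energy_bound:
  fixes U :: "real^'p^'d"
  assumes U: "U ** transpose U = mat 1"
  defines "t \<equiv> real CARD('d) - (1 / real CARD('n)) * (\<Sum>i\<in>UNIV. (T $ i ** transpose U) \<bullet> (T $ i ** transpose U))"
  shows "(real CARD('n))\<^sup>2 * (real CARD('d) - 2 * t + real CARD('p) / (real CARD('d) * (real CARD('p) - real CARD('d))) * t\<^sup>2)
    \<le> gram_energy"
proof -
  define n d p where "n = real CARD('n)" and "d = real CARD('d)" and "p = real CARD('p)"
  have pos: "0 < n" "0 < d" "d < p" using card by (simp_all add: n_def d_def p_def)
  define Q where "Q = (\<lambda>v. transpose U *v (U *v v))"
  define x where "x = (\<lambda>(i, a). T $ i $ a)"
  have UU: "U *v (transpose U *v v) = v" for v by (simp add: matrix_vector_mul_assoc U)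
  have Qx: "v \<bullet> Q w = (U *v v) \<bullet> (U *v w)" for v w
    by (simp add: Q_def inner_matrix_vector)
  have A: "(\<Sum>k\<in>UNIV. x k \<bullet> Q (x k)) = n * (d - t)"
  proof -
    have "(\<Sum>k\<in>UNIV. x k \<bullet> Q (x k)) = (\<Sum>i\<in>UNIV. \<Sum>a\<in>UNIV. T $ i $ a \<bullet> Q (T $ i $ a))"
      by (simp add: x_def UNIV_Times_UNIV[symmetric] sum.cartesian_product' del: UNIV_Times_UNIV)
    also have "\<dots> = (\<Sum>i\<in>UNIV. (T $ i ** transpose U) \<bullet> (T $ i ** transpose U))"
      by (simp add: Qx inner_eq_sum_rows matrix_row_mult)
    also have "\<dots> = n * (d - t)" by (simp add: t_def n_def d_def)
    finally show ?thesis .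
  qed
  have X: "(\<Sum>k\<in>UNIV. x k \<bullet> x k) = n * d"
  proof -
    have "(\<Sum>k\<in>UNIV. x k \<bullet> x k) = (\<Sum>i\<in>UNIV. \<Sum>a\<in>UNIV. T $ i $ a \<bullet> T $ i $ a)"
      by (simp add: x_def UNIV_Times_UNIV[symmetric] sum.cartesian_product' del: UNIV_Times_UNIV)
    then show ?thesis by (simp add: inner_eq_sum_rows[symmetric] T_inner_self n_def d_def)
  qed
  have "(\<Sum>k\<in>UNIV. x k \<bullet> Q (x k))\<^sup>2 / d + (\<Sum>k\<in>UNIV. x k \<bullet> x k - x k \<bullet> Q (x k))\<^sup>2 / (real DIM(real^'p) - d)
      \<le> (\<Sum>k\<in>UNIV. \<Sum>l\<in>UNIV. (x k \<bullet> x l)\<^sup>2)"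
  proof (rule gram_bessel)
    show "linear Q" unfolding Q_def
      by (rule linearI) (simp_all add: matrix_vector_right_distrib matrix_vector_mult_scaleR)
    show "Q v \<bullet> w = v \<bullet> Q w" for v w
      using Qx[of v w] Qx[of w v] by (simp add: inner_commute)
    show "Q (Q v) = Q v" for v by (simp add: Q_def UU)
    show "(\<Sum>b\<in>Basis. b \<bullet> Q b) = d"
      unfolding Qx sum_Basis_vec sum_axis_columns d_def by (rule orthonormal_rows_inner_self[OF U])
  qed (use pos in \<open>simp_all add: p_def\<close>)
  also have "(\<Sum>k\<in>UNIV. \<Sum>l\<in>UNIV. (x k \<bullet> x l)\<^sup>2)
     = (\<Sum>i\<in>UNIV. \<Sum>a\<in>UNIV. \<Sum>j\<in>UNIV. \<Sum>c\<in>UNIV. (T $ i $ a \<bullet> T $ j $ c)\<^sup>2)"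
    by (simp add: x_def UNIV_Times_UNIV[symmetric] sum.cartesian_product' del: UNIV_Times_UNIV)
  also have "\<dots> = gram_energy"
    unfolding gram_energy_def gram_inner_gram by (intro sum.cong refl sum.swap)
  also have "(\<Sum>k\<in>UNIV. x k \<bullet> x k - x k \<bullet> Q (x k)) = n * t"
    unfolding sum_subtractf A X by (simp add: algebra_simps)
  finally have "(n * (d - t))\<^sup>2 / d + (n * t)\<^sup>2 / (p - d)
      \<le> gram_energy"
    unfolding A by (simp add: p_def)
  also have "(n * (d - t))\<^sup>2 / d + (n * t)\<^sup>2 / (p - d) = n\<^sup>2 * (d - 2 * t + p / (d * (p - d)) * t\<^sup>2)"
    using pos by (simp add: field_simps power2_eq_square)
  finally show ?thesis by (simp add: n_def d_def p_def)
qed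

text \<open>
  Bessel's inequality for the \<open>T\<^sub>i\<close> as vectors of \<open>\<real>\<^bsup>pd\<^esup>\<close>, with the projection onto the line of the
  mean (any line if the mean is zero).  By Jensen's inequality this projection loses
  on average at most \<open>spread\<close>.
\<close>

lemma correlation_energy_bound:
  obtains y where "0 \<le> y" "y \<le> spread"
    "(real CARD('n))\<^sup>2 * ((real CARD('d))\<^sup>2 - 2 * real CARD('d) * y + h_slope CARD('p) CARD('d) * y\<^sup>2)
      \<le> correlation_energy"
proof -
  define n d p where "n = real CARD('n)" and "d = real CARD('d)" and "p = real CARD('p)"
  have pos: "0 < n" "1 \<le> d" "d < p" using card by (simp_all add: n_def d_def p_def)
  then have "1 * 1 < p * d" by (intro mult_less_le_imp_less) auto
  then have pd: "1 < p * d" by simp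
  obtain e :: "real^'p^'d" where e: "e \<bullet> e = 1" "(mean \<bullet> e)\<^sup>2 = mean \<bullet> mean"
  proof (cases "mean = 0")
    case True
    show thesis
      by (rule that[of "axis undefined (axis undefined 1)"]) (simp_all add: True inner_axis_axis)
  next
    case False
    have "mean \<bullet> mean = (norm mean)\<^sup>2" by (simp add: power2_norm_eq_inner)
    then show thesis using False
      by (intro that[of "(1 / norm mean) *\<^sub>R mean"]) (simp_all add: power2_eq_square)
  qed
  define y where "y = d - (1 / n) * (\<Sum>i\<in>UNIV. (T $ i \<bullet> e)\<^sup>2)"
  define Q where "Q = (\<lambda>v. (v \<bullet> e) *\<^sub>R e)"
  have A: "(\<Sum>i\<in>UNIV. T $ i \<bullet> Q (T $ i)) = n * (d - y)"
    using pos by (simp add: Q_def y_def power2_eq_square)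
  have "(\<Sum>i\<in>UNIV. T $ i \<bullet> Q (T $ i))\<^sup>2 / 1
      + (\<Sum>i\<in>UNIV. T $ i \<bullet> T $ i - T $ i \<bullet> Q (T $ i))\<^sup>2 / (real DIM(real^'p^'d) - 1)
      \<le> correlation_energy"
    unfolding correlation_energy_def
  proof (rule gram_bessel)
    show "linear Q" unfolding Q_def by (rule linearI) (simp_all add: inner_add_left scaleR_add_left)
    show "Q v \<bullet> w = v \<bullet> Q w" for v w by (simp add: Q_def inner_commute)
    show "Q (Q v) = Q v" for v by (simp add: Q_def e)
    show "(\<Sum>b\<in>Basis. b \<bullet> Q b) = 1"
      using euclidean_inner[of e e] by (simp add: Q_def e inner_commute)
    show "1 < real DIM(real^'p^'d)" using pd by (simp add: p_def d_def mult.commute)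
  qed simp
  also have "(\<Sum>i\<in>UNIV. T $ i \<bullet> T $ i - T $ i \<bullet> Q (T $ i)) = n * y"
    unfolding sum_subtractf A T_inner_self by (simp add: n_def d_def algebra_simps)
  finally have "(n * (d - y))\<^sup>2 / 1 + (n * y)\<^sup>2 / (p * d - 1) \<le> correlation_energy"
    unfolding A by (simp add: p_def d_def mult.commute)
  also have "(n * (d - y))\<^sup>2 / 1 + (n * y)\<^sup>2 / (p * d - 1) = n\<^sup>2 * (d\<^sup>2 - 2 * d * y + p * d / (p * d - 1) * y\<^sup>2)"
    using pd by (simp add: field_simps power2_eq_square)
  finally have 1: "n\<^sup>2 * (d\<^sup>2 - 2 * d * y + h_slope CARD('p) CARD('d) * y\<^sup>2) \<le> correlation_energy"
    by (simp add: h_slope_def p_def d_def)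
  have "(T $ i \<bullet> e)\<^sup>2 \<le> d" for i
    using Cauchy_Schwarz_ineq[of "T $ i" e] by (simp add: e T_inner_self d_def)
  then have "(\<Sum>i\<in>UNIV. (T $ i \<bullet> e)\<^sup>2) \<le> (\<Sum>i\<in>(UNIV::'n set). d)" by (intro sum_mono)
  then have 2: "0 \<le> y" using pos by (simp add: y_def n_def field_simps)
  have "n\<^sup>2 * (mean \<bullet> mean) = (\<Sum>i\<in>UNIV. T $ i \<bullet> e)\<^sup>2"
    unfolding e(2)[symmetric] inner_sum_left[symmetric] sum_T by (simp add: n_def power_mult_distrib)
  also have "\<dots> \<le> n * (\<Sum>i\<in>UNIV. (T $ i \<bullet> e)\<^sup>2)"
    using sum_norm_ge_norm_sum[of "\<lambda>i. T $ i \<bullet> e"] by (simp add: n_def power2_eq_square)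
  finally have "n * (mean \<bullet> mean) \<le> (\<Sum>i\<in>UNIV. (T $ i \<bullet> e)\<^sup>2)" using pos by (simp add: power2_eq_square)
  then have 3: "y \<le> spread" using pos by (simp add: y_def spread_def d_def field_simps)
  show thesis using that[OF 2 3] 1 by (simp add: n_def d_def)
qed

lemma mean_contraction: "(transpose mean *v v) \<bullet> (transpose mean *v v) \<le> v \<bullet> v"
proof -
  let ?x = "\<lambda>i. transpose (T $ i) *v v"
  have "transpose (X + Y) = transpose X + transpose Y" "transpose (c *\<^sub>R X) = c *\<^sub>R transpose X"
    for X Y :: "real^'p^'d" and c by (simp_all add: transpose_def vec_eq_iff)
  then have lin': "linear (\<lambda>X::real^'p^'d. transpose X *v v)"
    by (intro linearI) (simp_all add: matrix_vector_mult_add_rdistrib scaleR_matrix_vector_assoc[symmetric])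
  have "(\<Sum>i\<in>UNIV. ?x i) = real CARD('n) *\<^sub>R (transpose mean *v v)"
    using linear_sum[OF lin', of "\<lambda>i. T $ i" UNIV] linear_scale[OF lin'] by (simp add: sum_T)
  then have "real CARD('n) * (real CARD('n) * ((transpose mean *v v) \<bullet> (transpose mean *v v)))
      \<le> real CARD('n) * (\<Sum>i\<in>UNIV. ?x i \<bullet> ?x i)"
    using sum_norm_ge_norm_sum[of ?x] by simp
  also have "\<dots> = real CARD('n) * (real CARD('n) * (v \<bullet> v))"
    by (simp add: orthonormal_rows_transpose_norm[OF stiefel])
  finally show ?thesis by simp
qed

end

section \<open>Comparison of the bound with \<open>G\<close>\<close>

text \<open>
  For \<open>s \<le> 1\<close> the left side is increasing on \<open>[0, s]\<close>, so that \<open>y = s\<close> is the worst case; for \<open>s > 1\<close> it is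
  majorised by its tangent at \<open>y = 1\<close>.
\<close>

lemma concave_quadratic_bound:
  fixes D c y s :: real
  assumes "0 < c" "c \<le> D" "0 \<le> y" "y \<le> s"
  shows "2 * D * y - c * y\<^sup>2 \<le> s * (2 * D - c * min s 1)"
proof (cases "s \<le> 1")
  case True
  have "c * (s + y) \<le> c * 2" using assms True by (intro mult_left_mono) auto
  then have "0 \<le> 2 * D - c * (s + y)" using assms by linarith
  then have "0 \<le> (s - y) * (2 * D - c * (s + y))" using assms by (intro mult_nonneg_nonneg) auto
  then show ?thesis using True by (simp add: algebra_simps power2_eq_square)
next
  case False
  have "0 \<le> c * (y - 1)\<^sup>2" using assms by simp
  then have "2 * D * y - c * y\<^sup>2 \<le> (2 * D - 2 * c) * y + c"
    by (simp add: power2_eq_square algebra_simps)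
  also have "\<dots> \<le> (2 * D - 2 * c) * s + c * s"
    using assms False by (intro add_mono mult_left_mono) auto
  finally show ?thesis using False by (simp add: algebra_simps)
qed

text \<open>
  The constant part of \<open>h\<close> is chosen such that \<open>2 - h_const\<close> is the maximum of \<open>2 u - c u\<^sup>2\<close> on
  \<open>[0, 1]\<close>, where \<open>c = p / (d (p - d))\<close>.  For \<open>p \<ge> d + 2\<close> one has \<open>c \<le> 1\<close> and the maximum is at
  \<open>u = 1\<close>; for \<open>p = d + 1\<close> it is \<open>1/c = d / (d + 1)\<close>, attained inside the interval.
\<close>

lemma profile_le_h_const:
  assumes "2 \<le> d" "d + 1 \<le> p" "0 \<le> u" "u \<le> 1"
  shows "2 * u - real p / (real d * (real p - real d)) * u\<^sup>2 \<le> 2 - h_const p d"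
proof (cases "p = d + 1")
  case True
  define c where "c = (real d + 1) / real d"
  have c: "0 < c" using assms by (simp add: c_def)
  have "0 \<le> (c * u - 1)\<^sup>2 / c" using c by simp
  also have "\<dots> = 1 / c - (2 * u - c * u\<^sup>2)"
    using c by (simp add: field_simps power2_eq_square)
  finally have "2 * u - c * u\<^sup>2 \<le> real d / (real d + 1)" by (simp add: c_def)
  then show ?thesis using True by (simp add: h_const_def c_def add.commute)
next
  case False
  define c where "c = real p / (real d * (real p - real d))"
  have D: "2 \<le> real d" "2 \<le> real p - real d" using assms False by auto
  have "2 * 2 \<le> real d * (real p - real d)" using D by (intro mult_mono) auto
  moreover have "0 \<le> (real d - 1) * (real p - real d - 2)" using D by simp
  ultimately have "real p \<le> real d * (real p - real d)" using D by (simp add: algebra_simps)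
  then have c: "c \<le> 1" using D by (simp add: c_def divide_le_eq)
  have c0: "0 \<le> c" using D by (simp add: c_def)
  have "c * (1 + u) \<le> 1 * 2" using c c0 assms by (intro mult_mono) auto
  then have "0 \<le> (1 - u) * (2 - c * (1 + u))" using assms by (intro mult_nonneg_nonneg) auto
  then have "2 * u - c * u\<^sup>2 \<le> 2 - c" by (simp add: algebra_simps power2_eq_square)
  then show ?thesis using False by (simp add: h_const_def c_def)
qed

text \<open>
  The upper bound for \<open>r(\<tau>)/\<alpha>\<close> at a configuration with spread \<open>s\<close>, where \<open>t\<close> and
  \<open>y\<close> are the losses of the two projections in Bessel's inequality and \<open>x = 1 - 1/\<alpha>\<close>.
\<close>

definition profile :: "nat \<Rightarrow> nat \<Rightarrow> real \<Rightarrow> real \<Rightarrow> real \<Rightarrow> real \<Rightarrow> real \<Rightarrow> real" where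
  "profile p d \<tau> x s t y =
     (q_fun d \<tau> * (2 * t - real p / (real d * (real p - real d)) * t\<^sup>2)
            + \<tau>\<^sup>2 * (2 * real d * y - h_slope p d * y\<^sup>2)) / s
         - max 0 (1 - s) * t\<^sup>2 / (x * real d * s\<^sup>2)"

text \<open>
  Put \<open>u = t/s\<close> and \<open>m = min s 1\<close>.  The profile is at most \<open>2 d \<tau>\<^sup>2\<close> plus the convex combination of
  \<open>q (2 u - c u\<^sup>2) - h_slope * \<tau>\<^sup>2\<close> and \<open>2 q u - u\<^sup>2/(x d)\<close> with weights \<open>m\<close> and \<open>1 - m\<close>.  The former is at
  most \<open>q (2 - h)\<close>, the latter at most \<open>q\<close> times the Huber profile of \<open>x d q\<close>.
\<close>

lemma interpolation_le_G_fun: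
  assumes "2 \<le> d" "d + 1 \<le> p" "0 \<le> \<tau>" "\<tau> \<le> 1"
    and x: "0 < x" and "0 < s" "0 \<le> t" "t \<le> s" "0 \<le> y" "y \<le> s"
  shows "profile p d \<tau> x s t y \<le> G_fun p d x \<tau>"
proof -
  define q where "q = q_fun d \<tau>"
  define c where "c = real p / (real d * (real p - real d))"
  define c1 where "c1 = h_slope p d"
  define u where "u = t / s"
  define m where "m = min s 1"
  define D where "D = real d"
  have D: "2 \<le> D" "D < real p" using assms by (simp_all add: D_def)
  have q: "0 \<le> q" using assms by (simp add: q_def q_fun_nonneg)
  have c: "0 \<le> c" using D by (simp add: c_def D_def)
  have u: "0 \<le> u" "u \<le> 1" "t = s * u" using assms by (simp_all add: u_def)
  have m: "0 \<le> m" "m \<le> 1" "m \<le> s" "max 0 (1 - s) = 1 - m" using assms by (auto simp: m_def)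
  have c1: "0 < c1" "c1 \<le> D"
    using h_slope_gt_1[of d p] h_slope_le_2[of d p] assms by (simp_all add: c1_def D_def)
  have "\<tau>\<^sup>2 * (2 * D * y - c1 * y\<^sup>2) \<le> \<tau>\<^sup>2 * (s * (2 * D - c1 * m))"
    unfolding m_def using concave_quadratic_bound[OF c1 assms(9,10)] by (intro mult_left_mono) auto
  then have 1: "\<tau>\<^sup>2 * (2 * D * y - c1 * y\<^sup>2) / s \<le> \<tau>\<^sup>2 * (2 * D - c1 * m)"
    using assms(6) by (simp add: divide_le_eq mult_ac)
  have "c * u\<^sup>2 * m \<le> c * u\<^sup>2 * s" using c m by (intro mult_left_mono) auto
  then have 2: "q * (2 * t - c * t\<^sup>2) / s \<le> q * (2 * u - m * (c * u\<^sup>2))"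
  proof -
    have "q * (2 * t - c * t\<^sup>2) / s = q * (2 * u - c * u\<^sup>2 * s)"
      using assms(6) by (simp add: u(3) field_simps power2_eq_square)
    also have "\<dots> \<le> q * (2 * u - m * (c * u\<^sup>2))"
      using \<open>c * u\<^sup>2 * m \<le> c * u\<^sup>2 * s\<close> q by (intro mult_left_mono) (auto simp: mult_ac)
    finally show ?thesis .
  qed
  have 3: "max 0 (1 - s) * t\<^sup>2 / (x * D * s\<^sup>2) = (1 - m) * (u\<^sup>2 / (x * D))"
    using assms(6) by (simp add: m u(3) power_mult_distrib)
  define low where "low = (2 - h_const p d) * q - c1 * \<tau>\<^sup>2"
  define high where "high = q * huber (x * D * q)"
  have low: "q * (2 * u - c * u\<^sup>2) - c1 * \<tau>\<^sup>2 \<le> low"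
    using mult_left_mono[OF profile_le_h_const[OF assms(1,2) u(1,2)] q]
    unfolding low_def c_def by (simp add: mult.commute)
  have high: "2 * q * u - u\<^sup>2 / (x * D) \<le> high"
  proof (cases "q = 0")
    case True
    then show ?thesis using x D by (simp add: high_def)
  next
    case False
    then have "0 < q" using q by simp
    then have "q * (2 * u - u\<^sup>2 / (x * D * q)) \<le> high"
      unfolding high_def using x D u by (intro mult_left_mono huber_ge) auto
    then show ?thesis using \<open>0 < q\<close> x D by (simp add: algebra_simps)
  qed
  have "m * (q * (2 * u - c * u\<^sup>2) - c1 * \<tau>\<^sup>2) + (1 - m) * (2 * q * u - u\<^sup>2 / (x * D))
      \<le> m * max high low + (1 - m) * max high low"
    using m low high by (intro add_mono mult_left_mono) auto
  then have conv: "m * (q * (2 * u - c * u\<^sup>2) - c1 * \<tau>\<^sup>2) + (1 - m) * (2 * q * u - u\<^sup>2 / (x * D))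
      \<le> max high low" by (simp add: algebra_simps)
  have "(q * (2 * t - c * t\<^sup>2) + \<tau>\<^sup>2 * (2 * D * y - c1 * y\<^sup>2)) / s - max 0 (1 - s) * t\<^sup>2 / (x * D * s\<^sup>2)
      \<le> q * (2 * u - m * (c * u\<^sup>2)) + \<tau>\<^sup>2 * (2 * D - c1 * m) - (1 - m) * (u\<^sup>2 / (x * D))"
    using 1 2 by (simp add: 3 add_divide_distrib)
  also have "\<dots> = 2 * D * \<tau>\<^sup>2 + (m * (q * (2 * u - c * u\<^sup>2) - c1 * \<tau>\<^sup>2)
       + (1 - m) * (2 * q * u - u\<^sup>2 / (x * D)))" by (simp add: algebra_simps)
  also have "\<dots> \<le> 2 * D * \<tau>\<^sup>2 + max high low" using conv by simp
  also have "\<dots> = G_fun p d x \<tau>"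
    unfolding G_fun_eq_G_max[OF assms(1-4)] G_max_def high_def low_def D_def q_def c1_def ..
  finally show ?thesis unfolding profile_def q_def c_def c1_def D_def .
qed

text \<open>
  For \<open>d = 1\<close> and \<open>\<tau> = 0\<close> the two weights act inside one quadratic \<open>2 u - w u\<^sup>2\<close>, where \<open>w\<close> is a
  convex combination of \<open>p/(p - 1)\<close> and \<open>1/x\<close>, hence at least \<open>1/G\<close>.
\<close>

lemma interpolation_le_G_fun_1:
  assumes "2 \<le> p" and x: "0 < x" and s: "0 < s" "s \<le> 1" and t: "0 \<le> t" "t \<le> s"
  shows "(2 * t - real p / (real p - 1) * t\<^sup>2) / s - (1 - s) * t\<^sup>2 / (x * s\<^sup>2) \<le> G_fun p 1 x 0"
proof -
  define g where "g = G_fun p 1 x 0"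
  define c where "c = real p / (real p - 1)"
  define u where "u = t / s"
  have u: "t = s * u" using s by (simp add: u_def)
  have g: "x \<le> g" "1 / c \<le> g" unfolding g_def G_fun_1 c_def by simp_all
  have g0: "0 < g" using g x by linarith
  have c: "0 < c" using assms by (simp add: c_def)
  have "1 / g \<le> 1 / x" "1 / g \<le> c" using g g0 x c by (simp_all add: field_simps)
  then have "s * (1 / g) + (1 - s) * (1 / g) \<le> s * c + (1 - s) * (1 / x)"
    using s by (intro add_mono mult_left_mono) auto
  moreover have "1 / g = s * (1 / g) + (1 - s) * (1 / g)" unfolding distrib_right[symmetric] by simp
  ultimately have w: "1 / g \<le> s * c + (1 - s) / x" by simp
  have "(2 * t - c * t\<^sup>2) / s - (1 - s) * t\<^sup>2 / (x * s\<^sup>2) = 2 * u - u\<^sup>2 * (s * c + (1 - s) / x)"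
    using s x by (simp add: u field_simps power2_eq_square)
  also have "\<dots> \<le> 2 * u - u\<^sup>2 * (1 / g)" using w by (intro diff_left_mono mult_left_mono) auto
  also have "\<dots> \<le> g"
  proof -
    have "0 \<le> (u - g)\<^sup>2 / g" using g0 by simp
    also have "\<dots> = g - (2 * u - u\<^sup>2 * (1 / g))" using g0 by (simp add: field_simps power2_eq_square)
    finally show ?thesis by simp
  qed
  finally show ?thesis by (simp add: g_def c_def)
qed

context critical_configuration
begin

text \<open>
  With \<open>V\<^sub>i = T\<^sub>i U\<^sup>T\<close> and \<open>m = H U\<close>, both \<open>T\<^sub>i\<close> and \<open>m\<close> act on the turns of \<open>U\<close> only through \<open>H\<close> and
  \<open>V\<^sub>i\<close>.
\<close>

lemma alignment_with_turns:
  assumes U: "U ** transpose U = mat 1" and polar: "mean = H ** U"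
  shows "centered T (turns \<tau> U) = (\<Sum>i\<in>UNIV. H \<bullet> (mat 1
     - (1 - \<tau>) *\<^sub>R (transpose (T $ i ** transpose U) ** (T $ i ** transpose U))
     - \<tau> *\<^sub>R ((T $ i ** transpose U) ** (T $ i ** transpose U))))"
proof -
  have "T $ i \<bullet> turn \<tau> (T $ i) U = T $ i \<bullet> U" for i
    using inner_turn[OF stiefel, of "mat 1" i \<tau> U] by simp
  then have 1: "T \<bullet> turns \<tau> U = real CARD('n) * (mean \<bullet> U)"
    by (simp add: inner_vec_def[of T] turns_def inner_sum_left[symmetric] sum_T)
  have 2: "mean \<bullet> U = H \<bullet> mat 1" by (simp add: polar inner_mult_left_matrix U)
  have 3: "mean \<bullet> turn \<tau> (T $ i) U = H \<bullet> ((1 - \<tau>) *\<^sub>R (transpose (T $ i ** transpose U) ** (T $ i ** transpose U))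
     + \<tau> *\<^sub>R ((T $ i ** transpose U) ** (T $ i ** transpose U)))" for i
    by (simp add: polar inner_mult_left_matrix turn_def matrix_transpose_mul matrix_mul_assoc
        matrix_mult_add_left
        matrix_mult_scaleR_left)
  have 4: "(\<Sum>i\<in>UNIV. T $ i) \<bullet> (\<Sum>i\<in>UNIV. turns \<tau> U $ i)
      = real CARD('n) * (\<Sum>i\<in>UNIV. mean \<bullet> turn \<tau> (T $ i) U)"
    by (simp add: sum_T turns_def inner_sum_right sum_distrib_left)
  have "centered T (turns \<tau> U) = real CARD('n) * (mean \<bullet> U) - (\<Sum>i\<in>UNIV. mean \<bullet> turn \<tau> (T $ i) U)"
    unfolding centered_def 1 4 by simp
  also have "\<dots> = (\<Sum>i\<in>UNIV. H \<bullet> mat 1 - mean \<bullet> turn \<tau> (T $ i) U)"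
    by (simp add: sum_subtractf 2)
  finally show ?thesis by (simp add: 3 inner_diff_right inner_add_right algebra_simps)
qed

text \<open>
  The master inequality is used with the orthogonal polar factor \<open>U\<close> of the mean, the direction in which
  \<open>T\<close> and its turns are provably aligned.  As \<open>1 - H\<^sup>2 = 1 - m m\<^sup>T\<close> is positive semidefinite with trace
  \<open>s\<close>, each eigenvalue of \<open>H\<^sup>2\<close> is at least \<open>1 - s\<close>; this is the origin of the weight
  \<open>max 0 (1 - s)\<close>.
\<close>

lemma critical_bound:
  assumes s: "0 < spread" and \<tau>: "0 \<le> \<tau>" "\<tau> \<le> 1"
  obtains t y where "0 \<le> t" "t \<le> spread" "0 \<le> y" "y \<le> spread"
    "r_fun CARD('p) CARD('d) \<tau> / \<alpha> \<le>
       profile CARD('p) CARD('d) \<tau> (1 - 1 / \<alpha>) spread t y"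
proof -
  define n d p where "n = real CARD('n)" and "d = real CARD('d)" and "p = real CARD('p)"
  have pos: "0 < n" "0 < d" "d < p" using card by (simp_all add: n_def d_def p_def)
  have "CARD('d) \<le> CARD('p)" using card by simp
  then obtain U :: "real^'p^'d" where U: "U ** transpose U = mat 1"
    and Hsym: "transpose (mean ** transpose U) = mean ** transpose U"
    and Hpsd: "\<And>y. 0 \<le> y \<bullet> ((mean ** transpose U) *v y)"
    and polar: "mean = mean ** transpose U ** U"
    using polar_decomposition[of mean] by blast
  define H where "H = mean ** transpose U"
  define V where "V = (\<lambda>i. T $ i ** transpose U)"
  define lam where "lam = max 0 (1 - spread)"
  note Hsym = Hsym[folded H_def] and Hpsd = Hpsd[folded H_def] and polar = polar[folded H_def]
  have UU: "U *v (transpose U *v v) = v" for v by (simp add: matrix_vector_mul_assoc U)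
  have HH: "H \<bullet> H = mean \<bullet> mean"
    using inner_mult_left_matrix[of H U mean] by (simp add: polar[symmetric] H_def[symmetric])
  have Hnorm: "(H *v v) \<bullet> (H *v v) = (transpose mean *v v) \<bullet> (transpose mean *v v)" for v
  proof -
    have "transpose mean *v v = transpose U *v (H *v v)"
      by (subst polar) (simp add: matrix_transpose_mul Hsym matrix_vector_mul_assoc)
    then show ?thesis by (simp add: orthonormal_rows_transpose_norm[OF U])
  qed
  have lam_le: "lam * (v \<bullet> v) \<le> (H *v v) \<bullet> (H *v v)" for v
  proof -
    define K where "K = mat 1 - mean ** transpose mean"
    have Kv: "w \<bullet> (K *v w) = w \<bullet> w - (transpose mean *v w) \<bullet> (transpose mean *v w)" for w
      using inner_matrix_vector[of mean "transpose mean *v w" w]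
      by (simp add: K_def matrix_vector_mult_diff_rdistrib matrix_vector_mul_assoc inner_diff_right inner_commute)
    have "trace K = spread"
      unfolding K_def inner_mat_1[symmetric] inner_diff_right
      using inner_mult_left_matrix[of mean "transpose mean" "mat 1"]
      by (simp add: spread_def inner_commute[of "mat 1" "mean ** transpose mean"] inner_mat_1_self)
    moreover have "v \<bullet> (K *v v) \<le> trace K * (v \<bullet> v)"
      by (rule psd_le_trace) (simp add: Kv mean_contraction)
    ultimately have "(1 - spread) * (v \<bullet> v) \<le> (H *v v) \<bullet> (H *v v)"
      by (simp add: Kv Hnorm algebra_simps)
    then show ?thesis by (simp add: lam_def max_def)
  qed
  have H_lower: "sqrt lam * (v \<bullet> v) \<le> v \<bullet> (H *v v)" for v
    by (rule psd_lower_bound_from_square[OF Hsym Hpsd lam_le]) (simp add: lam_def)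
  have V_contr: "(V i *v v) \<bullet> (V i *v v) \<le> v \<bullet> v"
    "(transpose (V i) *v v) \<bullet> (transpose (V i) *v v) \<le> v \<bullet> v" for i v
  proof -
    have "(V i *v v) \<bullet> (V i *v v) \<le> (transpose U *v v) \<bullet> (transpose U *v v)"
      unfolding V_def matrix_vector_mul_assoc[symmetric] by (rule orthonormal_rows_norm_le[OF stiefel])
    then show "(V i *v v) \<bullet> (V i *v v) \<le> v \<bullet> v" by (simp add: orthonormal_rows_transpose_norm[OF U])
    have "(transpose (V i) *v v) \<bullet> (transpose (V i) *v v)
        \<le> (transpose (T $ i) *v v) \<bullet> (transpose (T $ i) *v v)"
      unfolding V_def matrix_transpose_mul transpose_transpose matrix_vector_mul_assoc[symmetric]
      by (rule orthonormal_rows_norm_le[OF U])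
    then show "(transpose (V i) *v v) \<bullet> (transpose (V i) *v v) \<le> v \<bullet> v"
      by (simp add: orthonormal_rows_transpose_norm[OF stiefel])
  qed
  define K where "K = (\<lambda>i. mat 1 - (1 - \<tau>) *\<^sub>R (transpose (V i) ** V i) - \<tau> *\<^sub>R (V i ** V i))"
  note contr = contraction_trace_bound[OF V_contr \<tau>]
  define t where "t = d - (1 / n) * (\<Sum>i\<in>UNIV. V i \<bullet> V i)"
  have nt: "n * t = (\<Sum>i\<in>UNIV. d - V i \<bullet> V i)" using pos by (simp add: t_def sum_subtractf n_def algebra_simps)
  have t0: "0 \<le> t"
  proof -
    have "0 \<le> n * t" unfolding nt d_def using contr(3) by (intro sum_nonneg) simp
    then show ?thesis using pos by (simp add: zero_le_mult_iff)
  qed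
  have t_le: "t \<le> spread"
  proof -
    have "(\<Sum>i\<in>UNIV. V i) = n *\<^sub>R H"
      using matrix_mult_sum_left[ of "\<lambda>i. T $ i" UNIV "transpose U"]
      by (simp add: V_def H_def sum_T n_def matrix_mult_scaleR_left)
    then have "n * (n * (mean \<bullet> mean)) \<le> n * (\<Sum>i\<in>UNIV. V i \<bullet> V i)"
      using sum_norm_ge_norm_sum[of V] by (simp add: n_def HH)
    then have "n * (mean \<bullet> mean) \<le> (\<Sum>i\<in>UNIV. V i \<bullet> V i)" using pos by simp
    then show ?thesis using pos by (simp add: t_def spread_def d_def field_simps)
  qed
  have kappa: "sqrt lam * (n * t) \<le> centered T (turns \<tau> U)"
  proof -
    have "0 \<le> (H - sqrt lam *\<^sub>R mat 1) \<bullet> K i" for i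
    proof (rule psd_inner_nonneg)
      show "transpose (H - sqrt lam *\<^sub>R mat 1) = H - sqrt lam *\<^sub>R mat 1"
        using Hsym by (auto simp: vec_eq_iff transpose_def mat_def)
      show "0 \<le> v \<bullet> ((H - sqrt lam *\<^sub>R mat 1) *v v)" for v
        using H_lower[of v]
        by (simp add: matrix_vector_mult_diff_rdistrib scaleR_matrix_vector_assoc[symmetric] inner_diff_right)
      show "0 \<le> v \<bullet> (K i *v v)" for v unfolding K_def by (rule contr(1))
    qed
    then have "sqrt lam * trace (K i) \<le> H \<bullet> K i" for i
      by (simp add: inner_diff_left inner_mat_1)
    moreover have "sqrt lam * (d - V i \<bullet> V i) \<le> sqrt lam * trace (K i)" for i
      using contr(2)[of i] unfolding K_def d_def by (intro mult_left_mono) (simp_all add: lam_def)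
    ultimately have "(\<Sum>i\<in>UNIV. sqrt lam * (d - V i \<bullet> V i)) \<le> (\<Sum>i\<in>UNIV. H \<bullet> K i)"
      by (intro sum_mono) (meson order_trans)
    then show ?thesis
      unfolding nt alignment_with_turns[OF U polar] K_def V_def by (simp add: sum_distrib_left)
  qed
  obtain y where y: "0 \<le> y" "y \<le> spread" and eta: "n\<^sup>2 * (d\<^sup>2 - 2 * d * y + h_slope CARD('p) CARD('d) * y\<^sup>2)
      \<le> correlation_energy"
    unfolding n_def d_def by (rule correlation_energy_bound)
  have xi: "n\<^sup>2 * (d - 2 * t + p / (d * (p - d)) * t\<^sup>2)
    \<le> gram_energy"
    using gram_energy_bound[OF U] unfolding n_def d_def p_def t_def V_def .
  define q where "q = q_fun CARD('d) \<tau>"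
  define r where "r = r_fun CARD('p) CARD('d) \<tau>"
  have q: "0 \<le> q" unfolding q_def by (rule q_fun_nonneg[OF \<tau>])
  define N where "N = q * (2 * t - p / (d * (p - d)) * t\<^sup>2) + \<tau>\<^sup>2 * (2 * d * y - h_slope CARD('p) CARD('d) * y\<^sup>2)"
  have W: "(\<Sum>a\<in>UNIV. \<Sum>b\<in>UNIV. centered (turns \<tau> (unit_matrix a b)) (turns \<tau> (unit_matrix a b))) \<le> n * N"
  proof -
    have "q * (n\<^sup>2 * (d - 2 * t + p / (d * (p - d)) * t\<^sup>2)) + \<tau>\<^sup>2 * (n\<^sup>2 * (d\<^sup>2 - 2 * d * y + h_slope CARD('p) CARD('d) * y\<^sup>2))
      \<le> q * gram_energy
       + \<tau>\<^sup>2 * correlation_energy"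
      using q by (intro add_mono mult_left_mono xi eta) auto
    then have "(1 / n) * (q * (n\<^sup>2 * (d - 2 * t + p / (d * (p - d)) * t\<^sup>2)) + \<tau>\<^sup>2 * (n\<^sup>2 * (d\<^sup>2 - 2 * d * y + h_slope CARD('p) CARD('d) * y\<^sup>2)))
      \<le> (1 / n) * (q * gram_energy
       + \<tau>\<^sup>2 * correlation_energy)"
      using pos by (intro mult_left_mono) auto
    moreover have "(1 / n) * (q * (n\<^sup>2 * (d - 2 * t + p / (d * (p - d)) * t\<^sup>2)) + \<tau>\<^sup>2 * (n\<^sup>2 * (d\<^sup>2 - 2 * d * y + h_slope CARD('p) CARD('d) * y\<^sup>2)))
       = n * (q * d + \<tau>\<^sup>2 * d\<^sup>2) - n * N"
      using pos(1) unfolding N_def by (simp add: power2_eq_square algebra_simps)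
    ultimately show ?thesis
      unfolding sum_centered_turns q_def[symmetric] n_def[symmetric] d_def[symmetric] by linarith
  qed
  define x where "x = 1 - 1 / \<alpha>"
  have x: "0 < x" "\<alpha> * x = \<alpha> - 1" using \<alpha> by (simp_all add: x_def field_simps)
  \<comment> \<open>The minimiser of \<open>- 2 \<epsilon> \<surd>lam t + \<epsilon>\<^sup>2 x d s\<close>.\<close>
  define \<epsilon> where "\<epsilon> = sqrt lam * t / (x * d * spread)"
  have \<epsilon>: "0 \<le> \<epsilon>" using x pos s t0 by (simp add: \<epsilon>_def lam_def)
  have "U \<bullet> U = real CARD('d)" by (rule orthonormal_rows_inner_self[OF U])
  from master_inequality[OF this, of \<tau> \<epsilon>]
  have "(r + \<epsilon>\<^sup>2 * d) * (n * spread) \<le> \<alpha> * ((\<Sum>a\<in>UNIV. \<Sum>b\<in>UNIV. centered (turns \<tau> (unit_matrix a b)) (turns \<tau> (unit_matrix a b)))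
           - 2 * \<epsilon> * centered T (turns \<tau> U) + \<epsilon>\<^sup>2 * d * (n * spread))"
    unfolding centered_T r_def d_def n_def .
  also have "\<dots> \<le> \<alpha> * (n * N - 2 * \<epsilon> * (sqrt lam * (n * t)) + \<epsilon>\<^sup>2 * d * (n * spread))"
  proof -
    have "2 * \<epsilon> * (sqrt lam * (n * t)) \<le> 2 * \<epsilon> * centered T (turns \<tau> U)"
      using kappa \<epsilon> by (intro mult_left_mono) auto
    with W show ?thesis using \<alpha> by (intro mult_left_mono) linarith+
  qed
  finally have "n * ((r + \<epsilon>\<^sup>2 * d) * spread) \<le> n * (\<alpha> * (N - 2 * \<epsilon> * (sqrt lam * t) + \<epsilon>\<^sup>2 * d * spread))"
    by (simp add: algebra_simps)
  then have "(r + \<epsilon>\<^sup>2 * d) * spread \<le> \<alpha> * (N - 2 * \<epsilon> * (sqrt lam * t) + \<epsilon>\<^sup>2 * d * spread)"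
    using pos by simp
  then have "r * spread \<le> \<alpha> * (N - 2 * \<epsilon> * (sqrt lam * t)) + (\<alpha> - 1) * (\<epsilon>\<^sup>2 * d * spread)"
    by (simp add: algebra_simps)
  also have "\<dots> = \<alpha> * (N - 2 * \<epsilon> * (sqrt lam * t) + \<epsilon>\<^sup>2 * (x * d * spread))"
    unfolding x(2)[symmetric] by (simp add: algebra_simps)
  also have "- 2 * \<epsilon> * (sqrt lam * t) + \<epsilon>\<^sup>2 * (x * d * spread) = - (lam * t\<^sup>2 / (x * d * spread))"
  proof -
    have e: "\<epsilon> * (x * d * spread) = sqrt lam * t" using x pos s by (simp add: \<epsilon>_def)
    have "\<epsilon>\<^sup>2 * (x * d * spread) = \<epsilon> * (sqrt lam * t)" unfolding e[symmetric] by (simp add: power2_eq_square)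
    moreover have "\<epsilon> * (sqrt lam * t) = lam * t\<^sup>2 / (x * d * spread)"
    proof -
      have "sqrt lam * sqrt lam = lam" by (simp add: lam_def)
      then show ?thesis by (simp add: \<epsilon>_def power2_eq_square)
    qed
    ultimately show ?thesis by simp
  qed
  then have "N - 2 * \<epsilon> * (sqrt lam * t) + \<epsilon>\<^sup>2 * (x * d * spread) = N - lam * t\<^sup>2 / (x * d * spread)" by simp
  finally have "r * spread \<le> \<alpha> * (N - lam * t\<^sup>2 / (x * d * spread))" .
  then have "r / \<alpha> \<le> (N - lam * t\<^sup>2 / (x * d * spread)) / spread"
    using \<alpha> s by (simp add: divide_le_eq le_divide_eq mult_ac)
  also have "\<dots> = N / spread - lam * t\<^sup>2 / (x * d * spread\<^sup>2)"
    by (simp add: diff_divide_distrib power2_eq_square mult.assoc)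
  finally show thesis
    using that[OF t0 t_le y] unfolding profile_def r_def q_def N_def lam_def x_def d_def p_def by blast
qed

lemma all_equal_if_spread_zero:
  assumes "spread = 0"
  shows "T $ i = mean"
proof -
  have "(T $ i - mean) \<bullet> (T $ i - mean) = T $ i \<bullet> T $ i - 2 * (T $ i \<bullet> mean) + mean \<bullet> mean" for i
    by (simp add: inner_diff_left inner_diff_right inner_commute)
  then have "(\<Sum>i\<in>UNIV. (T $ i - mean) \<bullet> (T $ i - mean)) = (\<Sum>i\<in>UNIV. T $ i \<bullet> T $ i)
      - 2 * ((\<Sum>i\<in>UNIV. T $ i) \<bullet> mean) + real CARD('n) * (mean \<bullet> mean)"
    by (simp add: sum.distrib sum_subtractf inner_sum_left sum_distrib_left)
  also have "\<dots> = 0" using assms by (simp add: T_inner_self sum_T spread_def)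
  finally have "(T $ i - mean) \<bullet> (T $ i - mean) = 0"
    by (simp add: sum_nonneg_eq_0_iff)
  then show ?thesis by simp
qed

lemma spread_nonneg: "0 \<le> spread"
proof -
  have "0 \<le> real CARD('n) * (real CARD('n) * spread)"
    using sum_norm_ge_norm_sum[of "\<lambda>i. T $ i"]
    by (simp add: sum_T T_inner_self spread_def algebra_simps)
  then show ?thesis by (simp add: zero_le_mult_iff)
qed

text \<open>
  A positive spread would contradict the hypothesis on \<open>G\<close>, because the profile never exceeds \<open>G\<close>.
  A vanishing spread means that the variance of the \<open>T\<^sub>i\<close> is zero.
\<close>

lemma configuration_constant:
  assumes \<tau>: "0 \<le> \<tau>" "\<tau> \<le> 1" and d1: "CARD('d) = 1 \<Longrightarrow> \<tau> = 0"
    and less: "G_fun CARD('p) CARD('d) (1 - 1 / \<alpha>) \<tau> < r_fun CARD('p) CARD('d) \<tau> / \<alpha>"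
  shows "T $ i = mean"
proof (rule all_equal_if_spread_zero, rule ccontr)
  assume "spread \<noteq> 0"
  then have s: "0 < spread" using spread_nonneg by simp
  have x: "0 < 1 - 1 / \<alpha>" using \<alpha> by simp
  obtain t y where ty: "0 \<le> t" "t \<le> spread" "0 \<le> y" "y \<le> spread"
    "r_fun CARD('p) CARD('d) \<tau> / \<alpha> \<le>
       profile CARD('p) CARD('d) \<tau> (1 - 1 / \<alpha>) spread t y"
    by (rule critical_bound[OF s \<tau>])
  note ty(5)
  also have "profile CARD('p) CARD('d) \<tau> (1 - 1 / \<alpha>) spread t y
       \<le> G_fun CARD('p) CARD('d) (1 - 1 / \<alpha>) \<tau>"
  proof (cases "CARD('d) = 1")
    case False
    moreover have "0 < CARD('d)" by simp
    ultimately have "2 \<le> CARD('d)" by linarith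
    then show ?thesis using card by (intro interpolation_le_G_fun \<tau> x s ty(1-4)) auto
  next
    case True
    have "spread \<le> 1" unfolding spread_def True by simp
    moreover have "2 \<le> CARD('p)" using card True by simp
    ultimately show ?thesis
      using interpolation_le_G_fun_1[OF _ x s _ ty(1,2), of "CARD('p)"]
      unfolding True d1[OF True] by (simp add: profile_def q_fun_def)
  qed
  finally show False using less by simp
qed

end

section \<open>The spectral gap\<close>

lemma eigenvectors_orthogonal:
  fixes L :: "real^'m::finite^'m"
  assumes "transpose L = L" "L *v v = \<mu> *\<^sub>R v" "L *v w = \<nu> *\<^sub>R w" "\<mu> \<noteq> \<nu>"
  shows "v \<bullet> w = 0"
proof -
  have "\<mu> * (v \<bullet> w) = \<nu> * (v \<bullet> w)"
    using inner_matrix_vector[of L v w] assms(1-3) by simp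
  then show ?thesis using assms(4) by simp
qed

lemma finite_eigenvalues:
  fixes L :: "real^'m::finite^'m"
  assumes "transpose L = L"
  shows "finite (eigenvalues L)"
proof -
  have "\<forall>\<mu>\<in>eigenvalues L. \<exists>v. v \<noteq> 0 \<and> L *v v = \<mu> *\<^sub>R v" by (simp add: eigenvalues_def)
  then obtain f where f: "\<And>\<mu>. \<mu> \<in> eigenvalues L \<Longrightarrow> f \<mu> \<noteq> 0 \<and> L *v f \<mu> = \<mu> *\<^sub>R f \<mu>"
    by metis
  have orth: "f \<mu> \<bullet> f \<nu> = 0" if "\<mu> \<in> eigenvalues L" "\<nu> \<in> eigenvalues L" "\<mu> \<noteq> \<nu>" for \<mu> \<nu>
    using eigenvectors_orthogonal[OF assms] f that by blast
  have "pairwise orthogonal (f ` eigenvalues L)"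
    using orth by (auto simp: pairwise_def orthogonal_def)
  then have "finite (f ` eigenvalues L)" by (rule pairwise_orthogonal_imp_finite)
  moreover have "inj_on f (eigenvalues L)"
    using orth f by (metis inj_onI inner_eq_zero_iff)
  ultimately show ?thesis by (rule finite_imageD)
qed

lemma lambda_max_upper:
  fixes L :: "real^'m::finite^'m"
  assumes sym: "transpose L = L"
  shows "v \<bullet> (L *v v) \<le> lambda_max L * (v \<bullet> v)"
proof (cases "v = 0")
  case False
  obtain w \<mu> where w: "w \<noteq> 0" "- (L *v w) = \<mu> *\<^sub>R w" "\<And>u. \<mu> * (u \<bullet> u) \<le> u \<bullet> - (L *v u)"
  proof (rule rayleigh_minimizer[of "\<lambda>u. - (L *v u)" UNIV v])
    show "linear (\<lambda>u. - (L *v u))"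
      by (rule linearI) (simp_all add: matrix_vector_right_distrib matrix_vector_mult_scaleR)
    show "- (L *v u) \<bullet> u' = u \<bullet> - (L *v u')" for u u'
      using inner_matrix_vector[of L u u'] by (simp add: sym)
  qed (use False in auto)
  have "L *v w = (- \<mu>) *\<^sub>R w" using w(2) by (metis minus_minus scaleR_minus_left)
  then have "- \<mu> \<in> eigenvalues L" using w(1) unfolding eigenvalues_def by blast
  then have "- \<mu> \<le> lambda_max L"
    unfolding lambda_max_def by (intro Max_ge finite_eigenvalues sym)
  then have "- \<mu> * (v \<bullet> v) \<le> lambda_max L * (v \<bullet> v)" by (intro mult_right_mono) auto
  then show ?thesis using w(3)[of v] by simp
qed simp

text \<open>
  A \<open>k\<close>-dimensional subspace of the kernel accounts for the first \<open>k\<close> entries of the spectrum.  As the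
  next entry is positive, this subspace is the whole kernel, and the next entry is the smallest positive
  eigenvalue.  On the orthogonal complement of the kernel, the minimum of the Rayleigh quotient is a
  positive eigenvalue and hence at least as large.
\<close>

lemma lambda_after_kernel:
  fixes L :: "real^'m::finite^'m"
  assumes "psd L" and Y: "subspace Y" "dim Y = k" "\<And>y. y \<in> Y \<Longrightarrow> L *v y = 0"
    and k: "0 < k" "0 < lambda (k + 1) L" and w: "\<And>y. y \<in> Y \<Longrightarrow> y \<bullet> w = 0"
  shows "lambda (k + 1) L * (w \<bullet> w) \<le> w \<bullet> (L *v w)"
proof (cases "w = 0")
  case False
  define E where "E = eigenvalues L"
  define ker where "ker = {v. L *v v = 0 *\<^sub>R v}"
  let ?es = "\<lambda>\<mu>. {v. L *v v = \<mu> *\<^sub>R v}"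
  have sym: "transpose L = L" and nonneg: "\<And>v. 0 \<le> v \<bullet> (L *v v)"
    using assms(1) by (simp_all add: psd_def)
  have fin: "finite E" unfolding E_def by (rule finite_eigenvalues[OF sym])
  have E_nonneg: "0 \<le> \<mu>" if "\<mu> \<in> E" for \<mu>
  proof -
    obtain v where "v \<noteq> 0" "L *v v = \<mu> *\<^sub>R v" using \<open>\<mu> \<in> E\<close> by (auto simp: E_def eigenvalues_def)
    then have "0 \<le> \<mu> * (v \<bullet> v)" "0 < v \<bullet> v" using nonneg[of v] by auto
    then show ?thesis by (simp add: zero_le_mult_iff)
  qed
  have sub: "subspace ker"
    by (auto simp: ker_def subspace_def matrix_vector_right_distrib matrix_vector_mult_scaleR)
  have Y_ker: "Y \<subseteq> ker" using Y(3) by (auto simp: ker_def)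
  obtain y where "y \<in> Y" "y \<noteq> 0" using Y(2) k(1) dim_eq_0[of Y] by auto
  then have "0 \<in> E" using Y(3) by (auto simp: E_def eigenvalues_def)
  then have "Min E = 0" using fin E_nonneg by (intro Min_eqI) auto
  moreover have "E \<noteq> {}" using \<open>0 \<in> E\<close> by blast
  ultimately have es: "sorted_list_of_set E = 0 # sorted_list_of_set (E - {0})"
    using sorted_list_of_set_nonempty[OF fin] by simp
  have list: "spectrum_list L = replicate (dim ker) 0
      @ concat (map (\<lambda>\<mu>. replicate (dim (?es \<mu>)) \<mu>) (sorted_list_of_set (E - {0})))"
    unfolding spectrum_list_def E_def[symmetric] es ker_def by simp
  have "\<not> k < dim ker" using k(2) by (auto simp: lambda_def list nth_append)
  then have "ker = Y" using subspace_dim_equal[OF Y(1) sub Y_ker] Y(2) by simp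
  then have dim_ker: "dim ker = k" using Y(2) by simp
  obtain v \<mu> where v: "v \<in> {u. \<forall>y\<in>Y. y \<bullet> u = 0}" "v \<noteq> 0" "L *v v = \<mu> *\<^sub>R v"
    and min: "\<And>u. u \<in> {u. \<forall>y\<in>Y. y \<bullet> u = 0} \<Longrightarrow> \<mu> * (u \<bullet> u) \<le> u \<bullet> (L *v u)"
  proof (rule rayleigh_minimizer[of "\<lambda>u. L *v u" "{u. \<forall>y\<in>Y. y \<bullet> u = 0}" w])
    show "(L *v u) \<bullet> u' = u \<bullet> (L *v u')" for u u'
      using inner_matrix_vector[of L u u'] by (simp add: sym)
    show "subspace {u. \<forall>y\<in>Y. y \<bullet> u = 0}" by (auto simp: subspace_def inner_add_right)
    show "L *v u \<in> {u. \<forall>y\<in>Y. y \<bullet> u = 0}" if "u \<in> {u. \<forall>y\<in>Y. y \<bullet> u = 0}" for u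
    proof -
      have "y \<bullet> (L *v u) = (L *v y) \<bullet> u" for y
        using inner_matrix_vector[of L y u] by (simp add: sym)
      then show ?thesis by (simp add: Y(3))
    qed
  qed (use False w in auto)
  have "\<mu> \<in> E" using v by (auto simp: E_def eigenvalues_def)
  moreover have "\<mu> \<noteq> 0"
  proof
    assume "\<mu> = 0"
    then have "v \<in> Y" using v(3) \<open>ker = Y\<close> by (auto simp: ker_def)
    then show False using v(1,2) by auto
  qed
  ultimately have \<mu>: "\<mu> \<in> E - {0}" by simp
  define m where "m = Min (E - {0})"
  have "m \<in> E - {0}" unfolding m_def using fin \<mu> by (intro Min_in) auto
  then obtain u where "u \<noteq> 0" "u \<in> ?es m" by (auto simp: E_def eigenvalues_def)
  then have "dim (?es m) \<noteq> 0" using dim_eq_0[of "?es m"] by auto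
  moreover have "sorted_list_of_set (E - {0}) = m # sorted_list_of_set (E - {0} - {m})"
    unfolding m_def using fin \<mu> by (intro sorted_list_of_set_nonempty) auto
  ultimately have "lambda (k + 1) L = m"
    by (simp add: lambda_def list nth_append dim_ker)
  moreover have "m \<le> \<mu>" unfolding m_def using fin \<mu> by (intro Min_le) auto
  ultimately have "lambda (k + 1) L * (w \<bullet> w) \<le> \<mu> * (w \<bullet> w)" by (intro mult_right_mono) auto
  also have "\<dots> \<le> w \<bullet> (L *v w)" using w by (intro min) auto
  finally show ?thesis .
qed simp

section \<open>From critical points to critical configurations\<close>

lemma inner_mult_right_matrix:
  fixes M :: "real^'k::finite^'l::finite" and X :: "real^'m::finite^'l" and Y :: "real^'m^'k"
  shows "X \<bullet> (M ** Y) = (transpose M ** X) \<bullet> Y"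
proof -
  have "X \<bullet> (M ** Y) = transpose X \<bullet> (transpose Y ** transpose M)"
    by (simp add: inner_transpose_matrix matrix_transpose_mul[symmetric])
  also have "\<dots> = (transpose Y ** transpose M) \<bullet> transpose X" by (rule inner_commute)
  also have "\<dots> = transpose Y \<bullet> (transpose X ** M)" by (simp add: inner_mult_left_matrix)
  also have "\<dots> = transpose Y \<bullet> transpose (transpose M ** X)" by (simp add: matrix_transpose_mul)
  finally show ?thesis by (simp add: inner_transpose_matrix inner_commute)
qed

text \<open>
  The change of gauge: a family \<open>F\<close> of \<open>d \<times> p\<close> matrices is sent to the block matrix with blocks
  \<open>Z\<^sub>i F\<^sub>i\<close>.  The next definition is its adjoint, and its inverse when the blocks of \<open>Z\<close> are
  orthogonal.
\<close>

definition block_embed :: "real^'d^('n::finite \<times> 'd::finite) \<Rightarrow> real^'p^'d^'n \<Rightarrow> real^'p^('n \<times> 'd)" where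
  "block_embed Z F = (\<chi> k. (row_block Z (fst k) ** F $ fst k) $ snd k)"

definition block_pull :: "real^'d^('n::finite \<times> 'd::finite) \<Rightarrow> real^'p^('n \<times> 'd) \<Rightarrow> real^'p^'d^'n" where
  "block_pull Z X = (\<chi> i. transpose (row_block Z i) ** row_block X i)"

lemma row_block_embed: "row_block (block_embed Z F) i = row_block Z i ** F $ i"
  by (simp add: block_embed_def row_block_def vec_eq_iff)

lemma row_block_eqI: "(\<And>i. row_block X i = row_block Y i) \<Longrightarrow> X = Y"
  by (simp add: row_block_def vec_eq_iff)

lemma inner_block_embed: "X \<bullet> block_embed Z F = block_pull Z X \<bullet> F"
  by (simp add: inner_row_block row_block_embed inner_mult_right_matrix block_pull_def
      inner_vec_def[of "\<chi> i. transpose (row_block Z i) ** row_block X i"])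

lemma orthogonal_blocks_mult:
  assumes "Z \<in> orthogonal_blocks"
  shows "transpose (row_block Z i) ** row_block Z i = mat 1" "row_block Z i ** transpose (row_block Z i) = mat 1"
  using assms by (auto simp: orthogonal_blocks_def orthogonal_matrix_def)

lemma pull_embed: "Z \<in> orthogonal_blocks \<Longrightarrow> block_pull Z (block_embed Z F) = F"
  by (simp add: block_pull_def row_block_embed matrix_mul_assoc orthogonal_blocks_mult vec_eq_iff)

lemma embed_pull: "Z \<in> orthogonal_blocks \<Longrightarrow> block_embed Z (block_pull Z X) = X"
  by (intro row_block_eqI) (simp add: row_block_embed block_pull_def matrix_mul_assoc orthogonal_blocks_mult)

lemma embed_const: "block_embed Z (\<chi> i. \<Phi>) = Z ** \<Phi>"
  by (intro row_block_eqI) (simp add: row_block_embed row_block_mult)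

lemma linear_block_embed: "linear (block_embed Z)"
  by (rule linearI)
    (simp_all add: block_embed_def vec_eq_iff matrix_mult_add_right
      matrix_mult_scaleR_right)

lemma transpose_mult_blocks:
  fixes Z :: "real^'d^('n::finite \<times> 'd::finite)" and X :: "real^'p::finite^('n \<times> 'd)"
  shows "transpose Z ** X = (\<Sum>i\<in>UNIV. transpose (row_block Z i) ** row_block X i)"
  by (simp add: vec_eq_iff matrix_matrix_mult_def transpose_def row_block_def
      UNIV_Times_UNIV[symmetric] sum.cartesian_product' del: UNIV_Times_UNIV)

lemma quadratic_form_columns:
  fixes L :: "real^'m::finite^'m" and X :: "real^'p::finite^'m"
  shows "(L ** X) \<bullet> X = (\<Sum>b\<in>UNIV. (X *v axis b 1) \<bullet> (L *v (X *v axis b 1)))"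
  by (simp add: sum_axis_columns[symmetric] matrix_vector_mul_assoc inner_commute)

text \<open>
  Tangency makes \<open>V\<^sub>i S\<^sub>i\<^sup>T\<close> skew-symmetric, hence orthogonal to the symmetric block \<open>BDG(X)\<^sub>i\<^sub>i\<close>.
\<close>

lemma skew_orthogonal_to_BDG:
  assumes "V \<in> tangent_space S"
  shows "(BDG X ** S) \<bullet> V = 0"
proof -
  have "row_block (BDG X ** S) i \<bullet> row_block V i = 0" for i
  proof -
    let ?M = "(1/2) *\<^sub>R (block X i i + transpose (block X i i))"
    let ?W = "row_block V i ** transpose (row_block S i)"
    have Mt: "transpose ?M = ?M" by (simp add: vec_eq_iff transpose_def)
    have "?W + transpose ?W = 0" using assms by (simp add: tangent_space_def matrix_transpose_mul)
    then have "transpose ?W = - ?W" by (simp add: add_eq_0_iff)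
    then have "?M \<bullet> ?W = - (?M \<bullet> ?W)"
      using inner_transpose_matrix[of ?M ?W] by (simp only: Mt inner_minus_right)
    then have "?M \<bullet> ?W = 0" by simp
    then show ?thesis unfolding row_block_BDG_mult inner_mult_left_matrix .
  qed
  then show ?thesis by (simp add: inner_row_block)
qed

lemma riem_grad_objective_has_derivative:
  assumes "transpose A = A"
  shows "(riem_grad (objective A) has_derivative (\<lambda>V. (- 2) *\<^sub>R (A ** V)
     - (BDG ((- 2) *\<^sub>R (A ** S) ** transpose S) ** V
        + BDG ((- 2) *\<^sub>R (A ** S) ** transpose V + (- 2) *\<^sub>R (A ** V) ** transpose S) ** S))) (at S)"
proof -
  have E: "((\<lambda>S. (- 2) *\<^sub>R (A ** S)) has_derivative (\<lambda>V. (- 2) *\<^sub>R (A ** V))) (at S)"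
    by (intro bounded_linear_imp_has_derivative bounded_linear_scaleR_right[THEN bounded_linear_compose]
        bounded_bilinear.bounded_linear_right[OF bounded_bilinear_matrix_mult])
  have M: "((\<lambda>S. (- 2) *\<^sub>R (A ** S) ** transpose S) has_derivative
      (\<lambda>V. (- 2) *\<^sub>R (A ** S) ** transpose V + (- 2) *\<^sub>R (A ** V) ** transpose S)) (at S)"
    by (rule bounded_bilinear.FDERIV[OF bounded_bilinear_matrix_mult E
          bounded_linear_imp_has_derivative[OF bounded_linear_transpose_real]])
  show ?thesis
    unfolding riem_grad_objective[OF assms] tangent_proj_def
    by (rule has_derivative_diff[OF E
          bounded_bilinear.FDERIV[OF bounded_bilinear_matrix_mult
            bounded_linear.has_derivative[OF bounded_linear_BDG M] has_derivative_ident]])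
qed

lemma BDG_scaleR: "BDG (c *\<^sub>R X) = c *\<^sub>R BDG X"
  by (rule linear_scale[OF bounded_linear.linear[OF bounded_linear_BDG]])

lemma critical_first_order:
  assumes "transpose A = A" "second_order_critical (objective A) S"
  shows "A ** S = BDG (A ** S ** transpose S) ** S"
proof -
  have s: "(c *\<^sub>R X) ** Y = c *\<^sub>R (X ** Y)" for c and X :: "real^'k::finite^'l::finite" and Y :: "real^'m::finite^'k"
    by (rule matrix_mult_scaleR_left)
  have "tangent_proj S ((- 2) *\<^sub>R (A ** S)) = 0"
    using assms(2) unfolding second_order_critical_def riem_grad_objective[OF assms(1)] by blast
  then have "(- 2) *\<^sub>R (A ** S) = (- 2) *\<^sub>R (BDG (A ** S ** transpose S) ** S)"
    unfolding tangent_proj_def s BDG_scaleR by (simp only: right_minus_eq)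
  then show ?thesis by (simp only: scaleR_cancel_left) simp
qed

text \<open>
  The derivative of the gradient field has one further summand, of the form \<open>BDG(X) S\<close>, which is
  orthogonal to the tangent space.
\<close>

lemma critical_second_order:
  assumes "transpose A = A" "second_order_critical (objective A) S" "V \<in> tangent_space S"
  shows "(A ** V) \<bullet> V \<le> (BDG (A ** S ** transpose S) ** V) \<bullet> V"
proof -
  have s: "(c *\<^sub>R X) ** Y = c *\<^sub>R (X ** Y)" for c and X :: "real^'k::finite^'l::finite" and Y :: "real^'m::finite^'k"
    by (rule matrix_mult_scaleR_left)
  define D where "D = frechet_derivative (riem_grad (objective A)) (at S) V"
  have D: "D = (- 2) *\<^sub>R (A ** V)
     - (BDG ((- 2) *\<^sub>R (A ** S) ** transpose S) ** V
        + BDG ((- 2) *\<^sub>R (A ** S) ** transpose V + (- 2) *\<^sub>R (A ** V) ** transpose S) ** S)"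
    unfolding D_def frechet_derivative_at[OF riem_grad_objective_has_derivative[OF assms(1)], symmetric] ..
  have "S \<in> stiefel_blocks" using assms(2) by (simp add: second_order_critical_def)
  then have "(D - tangent_proj S D) \<bullet> V = 0" using assms(3) by (rule tangent_proj_orthogonal(2))
  moreover have "0 \<le> V \<bullet> tangent_proj S D"
    using assms(2,3) unfolding second_order_critical_def riem_hess_def D_def by blast
  ultimately have "0 \<le> D \<bullet> V"
    using inner_commute[of V "tangent_proj S D"] by (simp add: inner_diff_left)
  also have "D \<bullet> V = 2 * ((BDG (A ** S ** transpose S) ** V) \<bullet> V - (A ** V) \<bullet> V)"
    unfolding D inner_diff_left inner_add_left skew_orthogonal_to_BDG[OF assms(3)] s BDG_scaleR
    by simp
  finally show ?thesis by simp
qed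


definition sym_block :: "real^('n::finite \<times> 'd::finite)^('n \<times> 'd) \<Rightarrow> 'n \<Rightarrow> real^'d^'d" where
  "sym_block X i = (1/2) *\<^sub>R (block X i i + transpose (block X i i))"

lemma row_block_BDG: "row_block (BDG X ** S) i = sym_block X i ** row_block S i"
  unfolding sym_block_def by (rule row_block_BDG_mult)

lemma transpose_sym_block: "transpose (sym_block X i) = sym_block X i"
  by (simp add: sym_block_def vec_eq_iff transpose_def)

lemma BDG_stiefel_inner:
  assumes "S \<in> stiefel_blocks"
  shows "BDG X \<bullet> (S ** transpose S) = (\<Sum>i\<in>UNIV. trace (sym_block X i))"
proof -
  have "BDG X \<bullet> (S ** transpose S) = (BDG X ** S) \<bullet> S" by (simp add: inner_mult_left_matrix)
  also have "\<dots> = (\<Sum>i\<in>UNIV. sym_block X i \<bullet> (row_block S i ** transpose (row_block S i)))"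
    by (simp add: inner_row_block row_block_BDG inner_mult_left_matrix)
  also have "\<dots> = (\<Sum>i\<in>UNIV. mat 1 \<bullet> sym_block X i)"
    using assms by (simp add: stiefel_blocks_def inner_commute)
  finally show ?thesis by (simp add: inner_mat_1)
qed

text \<open>
  \<open>L\<close> does not see the mean of \<open>F\<close>; after it is removed, the columns of the embedded family are orthogonal
  to the range of \<open>Z\<close>, which is contained in the kernel of \<open>L\<close> and has dimension \<open>d\<close>.
\<close>

lemma spectral_gap_centered:
  fixes L :: "real^('n::finite \<times> 'd::finite)^('n \<times> 'd)" and Z :: "real^'d^('n \<times> 'd)"
    and F :: "real^'p::finite^'d^'n"
  assumes Z: "Z \<in> orthogonal_blocks" and L: "psd L" "L ** Z = 0" "0 < lambda (CARD('d) + 1) L"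
  shows "lambda (CARD('d) + 1) L * centered F F \<le> (L ** block_embed Z F) \<bullet> block_embed Z F"
    and "(L ** block_embed Z F) \<bullet> block_embed Z F \<le> lambda_max L * centered F F"
proof -
  define n where "n = real CARD('n)"
  have n: "0 < n" by (simp add: n_def)
  have sym: "transpose L = L" using L(1) by (simp add: psd_def)
  define m where "m = (1 / n) *\<^sub>R (\<Sum>i\<in>UNIV. F $ i)"
  have sumF: "(\<Sum>i\<in>UNIV. F $ i) = n *\<^sub>R m" using n by (simp add: m_def)
  define F' where "F' = F - (\<chi> i. m)"
  define X where "X = block_embed Z F'"
  have X: "block_embed Z F = X + Z ** m"
    unfolding X_def F'_def linear_diff[OF linear_block_embed] embed_const by simp
  have LX: "L ** block_embed Z F = L ** X"
    unfolding X matrix_mult_add_right matrix_mul_assoc L(2) by simp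
  have "(L ** X) \<bullet> (Z ** m) = X \<bullet> (L ** Z ** m)"
    by (simp add: inner_mult_right_matrix sym matrix_mul_assoc matrix_transpose_mul)
  then have form: "(L ** block_embed Z F) \<bullet> block_embed Z F = (L ** X) \<bullet> X"
    unfolding LX unfolding X by (simp add: inner_add_right L(2))
  have "F' \<bullet> F' = (\<Sum>i\<in>UNIV. (F $ i - m) \<bullet> (F $ i - m))"
    unfolding inner_vec_def[of F' F'] by (simp add: F'_def)
  also have "\<dots> = (\<Sum>i\<in>UNIV. F $ i \<bullet> F $ i - 2 * (F $ i \<bullet> m) + m \<bullet> m)"
    by (intro sum.cong refl) (simp add: inner_diff_left inner_diff_right inner_commute)
  also have "\<dots> = F \<bullet> F - 2 * ((\<Sum>i\<in>UNIV. F $ i) \<bullet> m) + n * (m \<bullet> m)"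
    by (simp add: sum.distrib sum_subtractf inner_sum_left sum_distrib_left n_def inner_vec_def[of F])
  also have "\<dots> = centered F F"
    using n unfolding centered_def sumF n_def[symmetric] by simp
  finally have "X \<bullet> X = centered F F"
    unfolding X_def inner_block_embed pull_embed[OF Z] .
  then have cols: "centered F F = (\<Sum>b\<in>UNIV. (X *v axis b 1) \<bullet> (X *v axis b 1))"
    by (simp add: sum_axis_columns)
  have "transpose Z ** X = (\<Sum>i\<in>UNIV. F' $ i)"
    by (simp add: transpose_mult_blocks X_def row_block_embed matrix_mul_assoc orthogonal_blocks_mult[OF Z])
  also have "\<dots> = 0" by (simp add: F'_def sum_subtractf sumF n_def sum_constant_scaleR del: sum_constant)
  finally have ZX: "transpose Z ** X = 0" .
  define Y where "Y = range (\<lambda>v. Z *v v)"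
  have ZZ: "transpose Z ** Z = n *\<^sub>R mat 1"
    by (simp add: transpose_mult_blocks orthogonal_blocks_mult[OF Z] n_def sum_constant_scaleR
        del: sum_constant)
  have "inj (\<lambda>v. Z *v v)"
  proof (rule injI)
    fix v w assume "Z *v v = Z *v w"
    then have "transpose Z ** Z *v v = transpose Z ** Z *v w"
      by (simp add: matrix_vector_mul_assoc[symmetric])
    then show "v = w" using n by (simp add: ZZ scaleR_matrix_vector_assoc[symmetric])
  qed
  then have dimY: "dim Y = CARD('d)"
    unfolding Y_def using dim_image_eq[of "\<lambda>v. Z *v v" UNIV] by simp
  have subY: "subspace Y" unfolding Y_def by (intro linear_subspace_image) auto
  have LY: "L *v y = 0" if "y \<in> Y" for y
    using that by (auto simp: Y_def matrix_vector_mul_assoc L(2))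
  have orth: "y \<bullet> (X *v e) = 0" if "y \<in> Y" for y e
    using that inner_matrix_vector[of Z _ "X *v e"] by (auto simp: Y_def matrix_vector_mul_assoc ZX)
  have gap: "lambda (CARD('d) + 1) L * ((X *v e) \<bullet> (X *v e)) \<le> (X *v e) \<bullet> (L *v (X *v e))" for e
    by (rule lambda_after_kernel[OF L(1) subY dimY LY _ L(3) orth]) auto
  show "lambda (CARD('d) + 1) L * centered F F \<le> (L ** block_embed Z F) \<bullet> block_embed Z F"
    unfolding form unfolding cols quadratic_form_columns sum_distrib_left by (intro sum_mono gap)
  show "(L ** block_embed Z F) \<bullet> block_embed Z F \<le> lambda_max L * centered F F"
    unfolding form unfolding cols quadratic_form_columns sum_distrib_left by (intro sum_mono lambda_max_upper sym)
qed

text \<open>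
  With at least two blocks there is a family that is not constant; its Rayleigh quotient separates the two
  bounds.
\<close>

lemma lambda_le_lambda_max:
  fixes L :: "real^('n::finite \<times> 'd::finite)^('n \<times> 'd)" and Z :: "real^'d^('n \<times> 'd)"
  assumes "2 \<le> CARD('n)" "Z \<in> orthogonal_blocks" "psd L" "L ** Z = 0" "0 < lambda (CARD('d) + 1) L"
  shows "lambda (CARD('d) + 1) L \<le> lambda_max L"
proof -
  define F :: "real^'d^'d^'n" where "F = axis undefined (mat 1)"
  have "(\<Sum>j\<in>UNIV. F $ j) = mat 1"
    by (simp add: F_def axis_def)
  moreover have "F \<bullet> F = real CARD('d)"
    by (simp add: F_def inner_axis_axis inner_mat_1_self)
  ultimately have "centered F F = real CARD('d) * (1 - 1 / real CARD('n))"
    by (simp add: centered_def inner_mat_1_self algebra_simps)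
  then have "0 < centered F F" using assms(1) by simp
  moreover have "lambda (CARD('d) + 1) L * centered F F \<le> lambda_max L * centered F F"
    using spectral_gap_centered[OF assms(2-5), of F] by linarith
  ultimately show ?thesis by simp
qed

text \<open>
  Since \<open>L\<close> and \<open>-A\<close> differ by a block diagonal matrix, the critical point equations for \<open>A\<close> turn into
  those for \<open>L\<close>, with the multiplier \<open>BDG(A Z Z\<^sup>T) - BDG(A S S\<^sup>T)\<close>; conjugating its blocks by
  \<open>Z\<^sub>i\<close> gives \<open>\<Lambda>\<close>.
\<close>

lemma critical_configuration_of_critical_point:
  fixes A :: "real^('n::finite \<times> 'd::finite)^('n \<times> 'd)" and Z :: "real^'d^('n \<times> 'd)"
    and S :: "real^'p::finite^('n \<times> 'd)"
  assumes A: "transpose A = A" and Z: "Z \<in> orthogonal_blocks"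
    and L_def: "L = BDG (A ** Z ** transpose Z) - A"
    and L: "L ** Z = 0" "psd L" "0 < lambda (CARD('d) + 1) L"
    and \<alpha>: "1 < \<alpha>" "lambda_max L \<le> \<alpha> * lambda (CARD('d) + 1) L"
    and crit: "second_order_critical (objective A) S" and card: "CARD('d) < CARD('p)"
  defines "\<Lambda> \<equiv> \<chi> i. transpose (row_block Z i)
      ** (sym_block (A ** Z ** transpose Z) i - sym_block (A ** S ** transpose S) i) ** row_block Z i"
  shows "critical_configuration (\<lambda>F. block_pull Z (L ** block_embed Z F)) (block_pull Z S) \<Lambda>
      (lambda (CARD('d) + 1) L) \<alpha>"
proof -
  define T where "T = block_pull Z S"
  define N where "N = (\<lambda>i. sym_block (A ** Z ** transpose Z) i - sym_block (A ** S ** transpose S) i)"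
  have S: "S \<in> stiefel_blocks" using crit by (simp add: second_order_critical_def)
  have ET: "block_embed Z T = S" unfolding T_def by (rule embed_pull[OF Z])
  have symL: "transpose L = L" using L(2) by (simp add: psd_def)
  have symN: "transpose (N i) = N i" for i
  proof -
    have "transpose (X - Y) = transpose X - transpose Y" for X Y :: "real^'d^'d"
      by (simp add: transpose_def vec_eq_iff)
    then show ?thesis by (simp add: N_def transpose_sym_block)
  qed
  have \<Lambda>: "\<Lambda> $ i = transpose (row_block Z i) ** N i ** row_block Z i" for i
    by (simp add: \<Lambda>_def N_def)
  have form: "block_pull Z (L ** block_embed Z F) \<bullet> G = (L ** block_embed Z F) \<bullet> block_embed Z G"
    for F G :: "real^'p^'d^'n" by (simp add: inner_block_embed)
  have \<Lambda>_inner: "(\<Lambda> $ i ** X) \<bullet> Y = (N i ** (row_block Z i ** X)) \<bullet> (row_block Z i ** Y)"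
    for i and X Y :: "real^'p^'d"
    by (simp add: \<Lambda> inner_mult_right_matrix matrix_mul_assoc)
  have L_mult: "L ** V = BDG (A ** Z ** transpose Z) ** V - A ** V" for V :: "real^'p^('n \<times> 'd)"
    unfolding L_def by (rule matrix_mult_diff_left)
  have BB: "(BDG (A ** Z ** transpose Z) ** V) \<bullet> W - (BDG (A ** S ** transpose S) ** V) \<bullet> W
      = (\<Sum>i\<in>UNIV. (N i ** row_block V i) \<bullet> row_block W i)" for V W :: "real^'p^('n \<times> 'd)"
    by (simp add: inner_row_block row_block_BDG N_def sum_subtractf inner_diff_left
        matrix_mult_diff_left)
  show ?thesis unfolding T_def[symmetric]
  proof (rule critical_configuration.intro)
    show "linear (\<lambda>F. block_pull Z (L ** block_embed Z (F :: real^'p^'d^'n)))"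
      by (rule linearI)
        (simp_all add: linear_add[OF linear_block_embed] linear_scale[OF linear_block_embed]
          block_pull_def row_block_mult[symmetric] vec_eq_iff
          row_block_def matrix_matrix_mult_def transpose_def sum.distrib sum_distrib_left algebra_simps)
    show "block_pull Z (L ** block_embed Z F) \<bullet> G = F \<bullet> block_pull Z (L ** block_embed Z G)"
      for F G :: "real^'p^'d^'n"
      using form[of F G] form[of G F] inner_mult_right_matrix[of "block_embed Z F" L "block_embed Z G"]
      by (simp add: symL inner_commute)
    show "block_pull Z (L ** block_embed Z (\<chi> i. \<Phi>)) = 0" for \<Phi> :: "real^'p^'d"
    proof -
      have "L ** (Z ** \<Phi>) = 0" by (simp add: matrix_mul_assoc L(1))
      then show ?thesis
        unfolding embed_const by (simp add: block_pull_def row_block_def vec_eq_iff matrix_matrix_mult_def)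
    qed
    show "0 < lambda (CARD('d) + 1) L" "1 < \<alpha>" "CARD('d) < CARD('p)" by fact+
    show "lambda (CARD('d) + 1) L * centered F F \<le> block_pull Z (L ** block_embed Z F) \<bullet> F"
      for F :: "real^'p^'d^'n"
      unfolding form by (rule spectral_gap_centered(1)[OF Z L(2,1,3)])
    show "block_pull Z (L ** block_embed Z F) \<bullet> F \<le> \<alpha> * (lambda (CARD('d) + 1) L * centered F F)"
      for F :: "real^'p^'d^'n"
    proof -
      have "0 \<le> centered F F"
        using spectral_gap_centered[OF Z L(2,1,3), of F] L(3)
          sum_norm_ge_norm_sum[of "\<lambda>i. F $ i"]
        by (simp add: centered_def inner_vec_def[of F F] divide_le_eq mult.commute)
      then have "lambda_max L * centered F F \<le> \<alpha> * lambda (CARD('d) + 1) L * centered F F"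
        using \<alpha>(2) by (intro mult_right_mono)
      then show ?thesis
        using spectral_gap_centered(2)[OF Z L(2,1,3), of F] unfolding form by (simp add: mult.assoc)
    qed
    show "T $ i ** transpose (T $ i) = mat 1" for i
    proof -
      have "T $ i ** transpose (T $ i)
          = transpose (row_block Z i) ** (row_block S i ** transpose (row_block S i)) ** row_block Z i"
        by (simp add: T_def block_pull_def matrix_transpose_mul matrix_mul_assoc)
      then show ?thesis using S by (simp add: stiefel_blocks_def orthogonal_blocks_mult[OF Z])
    qed
    show "transpose (\<Lambda> $ i) = \<Lambda> $ i" for i
      by (simp add: \<Lambda> matrix_transpose_mul symN matrix_mul_assoc)
    show "block_pull Z (L ** block_embed Z T) \<bullet> G = (\<Sum>i\<in>UNIV. (\<Lambda> $ i ** T $ i) \<bullet> G $ i)"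
      for G :: "real^'p^'d^'n"
    proof -
      have "block_pull Z (L ** block_embed Z T) \<bullet> G
        = (BDG (A ** Z ** transpose Z) ** S) \<bullet> block_embed Z G - (BDG (A ** S ** transpose S) ** S) \<bullet> block_embed Z G"
        unfolding form unfolding ET L_mult inner_diff_left critical_first_order[OF A crit, symmetric] ..
      also have "\<dots> = (\<Sum>i\<in>UNIV. (N i ** row_block S i) \<bullet> row_block (block_embed Z G) i)" by (rule BB)
      also have "\<dots> = (\<Sum>i\<in>UNIV. (\<Lambda> $ i ** T $ i) \<bullet> G $ i)"
        unfolding \<Lambda>_inner row_block_embed[symmetric] ET ..
      finally show ?thesis .
    qed
    show "(\<Sum>i\<in>UNIV. (\<Lambda> $ i ** G $ i) \<bullet> G $ i) \<le> block_pull Z (L ** block_embed Z G) \<bullet> G"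
      if G: "\<And>i. G $ i ** transpose (T $ i) + T $ i ** transpose (G $ i) = 0" for G :: "real^'p^'d^'n"
    proof -
      let ?V = "block_embed Z G"
      have "row_block ?V i ** transpose (row_block S i) + row_block S i ** transpose (row_block ?V i) = 0" for i
      proof -
        have "row_block ?V i ** transpose (row_block S i) + row_block S i ** transpose (row_block ?V i)
          = row_block Z i ** (G $ i ** transpose (T $ i) + T $ i ** transpose (G $ i)) ** transpose (row_block Z i)"
          unfolding ET[symmetric] row_block_embed
          by (simp add: matrix_transpose_mul matrix_mul_assoc
              matrix_mult_add_right
              matrix_mult_add_left)
        then show ?thesis by (simp add: G)
      qed
      then have "?V \<in> tangent_space S" by (simp add: tangent_space_def)
      then have "(A ** ?V) \<bullet> ?V \<le> (BDG (A ** S ** transpose S) ** ?V) \<bullet> ?V"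
        by (rule critical_second_order[OF A crit])
      then have "(\<Sum>i\<in>UNIV. (N i ** row_block ?V i) \<bullet> row_block ?V i) \<le> (L ** ?V) \<bullet> ?V"
        unfolding BB[symmetric] L_mult inner_diff_left by simp
      then show ?thesis unfolding form \<Lambda>_inner row_block_embed .
    qed
  qed
qed

section \<open>Benign landscape\<close>

lemma benign_landscape:
  fixes A :: "real^('n::finite \<times> 'd::finite)^('n \<times> 'd)" and Z :: "real^'d^('n \<times> 'd)"
    and S :: "real^'p::finite^('n \<times> 'd)"
  assumes n: "2 \<le> CARD('n)" and A: "transpose A = A" and Z: "Z \<in> orthogonal_blocks"
    and L_def: "L = BDG (A ** Z ** transpose Z) - A"
    and L: "L ** Z = 0" "psd L" "0 < lambda (CARD('d) + 1) L"
    and \<tau>: "0 \<le> \<tau>" "\<tau> \<le> 1" "CARD('d) = 1 \<Longrightarrow> \<tau> = 0"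
    and cond: "lambda_max L / lambda (CARD('d) + 1) L < alphaG CARD('p) CARD('d) \<tau>"
    and crit: "second_order_critical (objective A) S" and card: "CARD('d) < CARD('p)"
  shows "S ** transpose S = Z ** transpose Z"
proof -
  define \<kappa> where "\<kappa> = lambda_max L / lambda (CARD('d) + 1) L"
  \<comment> \<open>Strictly between the condition number and the threshold, so that \<open>\<alpha> > 1\<close> also when \<open>\<kappa> = 1\<close>.\<close>
  define \<alpha> where "\<alpha> = (\<kappa> + alphaG CARD('p) CARD('d) \<tau>) / 2"
  have "1 \<le> \<kappa>" using lambda_le_lambda_max[OF n Z L(2,1,3)] L(3) by (simp add: \<kappa>_def)
  then have \<alpha>: "1 < \<alpha>" "\<kappa> \<le> \<alpha>" "\<alpha> < alphaG CARD('p) CARD('d) \<tau>"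
    using cond unfolding \<alpha>_def \<kappa>_def[symmetric] by simp_all
  have "lambda_max L \<le> \<alpha> * lambda (CARD('d) + 1) L"
    using \<alpha>(2) L(3) by (simp add: \<kappa>_def divide_le_eq)
  note conf = critical_configuration_of_critical_point[OF A Z L_def L \<alpha>(1) this crit card]
  have "1 \<le> CARD('d)" "CARD('d) + 1 \<le> CARD('p)" using card by simp_all
  then have less: "G_fun CARD('p) CARD('d) (1 - 1 / \<alpha>) \<tau> < r_fun CARD('p) CARD('d) \<tau> / \<alpha>"
    using \<tau> \<alpha> by (intro below_alphaG) auto
  obtain m where m: "\<And>i. block_pull Z S $ i = m"
    using critical_configuration.configuration_constant[OF conf \<tau> less] by blast
  have "S = Z ** m"
    using embed_pull[OF Z, of S] embed_const[of Z m] m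
    by (metis (no_types, lifting) vec_lambda_unique)
  moreover have "m ** transpose m = mat 1"
    using critical_configuration.stiefel[OF conf] m by simp
  ultimately show ?thesis
    by (simp add: matrix_transpose_mul matrix_mul_assoc) (simp add: matrix_mul_assoc[symmetric])
qed

text \<open>
  On the product of Stiefel manifolds \<open>\<langle>BDG(X), S S\<^sup>T\<rangle>\<close> is constant, so the objective is
  \<open>\<langle>L, S S\<^sup>T\<rangle> \<ge> 0\<close> up to a constant, and this vanishes for \<open>S S\<^sup>T = Z Z\<^sup>T\<close>.
\<close>

lemma global_minimizer:
  fixes A :: "real^('n::finite \<times> 'd::finite)^('n \<times> 'd)" and Z :: "real^'d^('n \<times> 'd)"
    and S :: "real^'p::finite^('n \<times> 'd)"
  assumes L_def: "L = BDG (A ** Z ** transpose Z) - A" and L: "L ** Z = 0" "psd L"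
    and S: "S \<in> stiefel_blocks" "S ** transpose S = Z ** transpose Z"
  shows "is_arg_min (objective A) (\<lambda>T. T \<in> stiefel_blocks) S"
proof -
  define c where "c = (\<Sum>i\<in>UNIV. trace (sym_block (A ** Z ** transpose Z) i))"
  have obj: "objective A T = L \<bullet> (T ** transpose T) - c" if "T \<in> stiefel_blocks" for T :: "real^'p^('n \<times> 'd)"
    using BDG_stiefel_inner[OF that, of "A ** Z ** transpose Z"]
    by (simp add: objective_def L_def inner_diff_left c_def)
  have "0 \<le> L \<bullet> (T ** transpose T)" for T :: "real^'p^('n \<times> 'd)"
    using L(2) by (simp add: inner_mult_left_matrix[symmetric] quadratic_form_columns psd_def sum_nonneg)
  moreover have "L \<bullet> (S ** transpose S) = 0"
    unfolding S(2) by (simp add: inner_mult_left_matrix[symmetric] L(1))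
  ultimately have "objective A S \<le> objective A T" if "T \<in> stiefel_blocks" for T :: "real^'p^('n \<times> 'd)"
    by (simp add: obj[OF that] obj[OF S(1)])
  then show ?thesis using S(1) by (auto simp: is_arg_min_def not_less)
qed

theorem theorem2p6:
  fixes d p :: nat
  assumes "1 \<le> d" and "d + 1 \<le> p"
  shows
    "(\<forall>\<tau>\<in>{0..1}.
        (feasible p d \<tau> (alphaG p d \<tau>) \<and> (\<forall>\<alpha>. feasible p d \<tau> \<alpha> \<longrightarrow> \<alpha> \<le> alphaG p d \<tau>)) \<and>
        (d = 1 \<longrightarrow>
          (let \<alpha> = (real p - 1 + (1 - \<tau>\<^sup>2)\<^sup>2) / (2 * \<tau>\<^sup>2 + (1 - \<tau>\<^sup>2)\<^sup>2)
           in if (1 - 1 / \<alpha>) * (1 - \<tau>\<^sup>2)\<^sup>2 + 2 * \<tau>\<^sup>2 \<ge> (real p - 1) / real p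
              then alphaG p 1 \<tau> = \<alpha>
              else alphaG p 1 \<tau> = real p \<and>
                   (1 - 1 / real p) * (1 - \<tau>\<^sup>2)\<^sup>2 + 2 * \<tau>\<^sup>2 \<le> (real p - 1) / real p)) \<and>
        (2 \<le> d \<and> 1 \<le> h_fun p d \<tau> \<longrightarrow>
          (\<forall>\<alpha>. larger_root p d \<tau> \<alpha> \<and> 1 / ereal (real d * q_fun d \<tau>) \<le> ereal (1 - 1 / \<alpha>)
                \<longrightarrow> alphaG p d \<tau> = \<alpha>) \<and>
          ((\<nexists>\<alpha>. larger_root p d \<tau> \<alpha> \<and> 1 / ereal (real d * q_fun d \<tau>) \<le> ereal (1 - 1 / \<alpha>)) \<longrightarrow>
            (let \<alpha> = (real d * (q_fun d \<tau>)\<^sup>2 + r_fun p d \<tau>)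
                        / (real d * (q_fun d \<tau>)\<^sup>2 + 2 * real d * \<tau>\<^sup>2)
             in if (2 - h_fun p d \<tau>) / ereal (real d * q_fun d \<tau>) \<le> ereal (1 - 1 / \<alpha>) \<and>
                   ereal (1 - 1 / \<alpha>) \<le> 1 / ereal (real d * q_fun d \<tau>)
                then alphaG p d \<tau> = \<alpha>
                else (let \<alpha>' = r_fun p d \<tau> / (2 * (q_fun d \<tau> + real d * \<tau>\<^sup>2)
                                                - q_fun d \<tau> * real_of_ereal (h_fun p d \<tau>))
                      in ereal (1 - 1 / \<alpha>') \<le> (2 - h_fun p d \<tau>) / ereal (real d * q_fun d \<tau>) \<and>
                         alphaG p d \<tau> = \<alpha>')))) \<and>
        (2 \<le> d \<and> h_fun p d \<tau> \<le> 1 \<longrightarrow>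
          (\<forall>\<alpha>. larger_root p d \<tau> \<alpha> \<and>
                1 / (ereal (real d * q_fun d \<tau>) * h_fun p d \<tau>) \<le> ereal (1 - 1 / \<alpha>)
                \<longrightarrow> alphaG p d \<tau> = \<alpha>) \<and>
          ((\<nexists>\<alpha>. larger_root p d \<tau> \<alpha> \<and>
                1 / (ereal (real d * q_fun d \<tau>) * h_fun p d \<tau>) \<le> ereal (1 - 1 / \<alpha>)) \<longrightarrow>
            (let \<alpha>' = r_fun p d \<tau> / (2 * (q_fun d \<tau> + real d * \<tau>\<^sup>2)
                                      - q_fun d \<tau> * real_of_ereal (h_fun p d \<tau>))
             in ereal (1 - 1 / \<alpha>') \<le> 1 / (ereal (real d * q_fun d \<tau>) * h_fun p d \<tau>) \<and>
                alphaG p d \<tau> = \<alpha>'))))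
     \<and> ((\<exists>\<tau>\<in>{0..1}. alphaG_max p d = alphaG p d \<tau>) \<and>
        (\<forall>\<tau>\<in>{0..1}. alphaG p d \<tau> \<le> alphaG_max p d))
     \<and> (d = 1 \<longrightarrow> alphaG_max p 1 = real p)
     \<and> ((d + 2 \<le> p \<and> 2 \<le> d) \<or> (p = d + 1 \<and> d \<in> {2, 3}) \<longrightarrow> 1 < alphaG_max p d)
     \<and> (\<forall>(A :: real^('n::finite \<times> 'd::finite)^('n \<times> 'd)) (Z :: real^'d^('n \<times> 'd)) L.
          CARD('n) \<ge> 2 \<and> CARD('d) = d \<and> CARD('p::finite) = p \<and>
          transpose A = A \<and> Z \<in> orthogonal_blocks \<and>
          L = BDG (A ** Z ** transpose Z) - A \<and>
          L ** Z = 0 \<and> psd L \<and> 0 < lambda (d + 1) L \<and>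
          lambda_max L / lambda (d + 1) L < alphaG_max p d
          \<longrightarrow> (\<forall>S :: real^'p^('n \<times> 'd).
                 second_order_critical (objective A) S \<longrightarrow>
                 is_arg_min (objective A) (\<lambda>T. T \<in> stiefel_blocks) S \<and>
                 S ** transpose S = Z ** transpose Z))"
proof -
  obtain \<tau>m where \<tau>m: "\<tau>m \<in> {0..1}" "\<And>\<sigma>. \<sigma> \<in> {0..1} \<Longrightarrow> alphaG p d \<sigma> \<le> alphaG p d \<tau>m"
    using alphaG_attains_max[OF assms] by blast
  have max_eq: "alphaG_max p d = alphaG p d \<tau>m" by (rule alphaG_max_eqI[OF \<tau>m])
  have max1: "alphaG_max p 1 = real p" "alphaG p d 0 = alphaG_max p d" if "d = 1"
  proof -
    have p: "2 \<le> p" using assms that by simp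
    have "alphaG_max p 1 = alphaG p 1 0"
      by (rule alphaG_max_eqI) (use alphaG_1_le[OF p] alphaG_1_0[OF p] in auto)
    then show "alphaG_max p 1 = real p" "alphaG p d 0 = alphaG_max p d"
      using alphaG_1_0[OF p] that by simp_all
  qed
  have gt_1: "1 < alphaG_max p d" if d: "(d + 2 \<le> p \<and> 2 \<le> d) \<or> (p = d + 1 \<and> d \<in> {2, 3})"
  proof -
    obtain \<tau> where "\<tau> \<in> {0..1}" "1 < alphaG p d \<tau>" using exists_alphaG_gt_1[OF d] by blast
    then show ?thesis using \<tau>m(2)[of \<tau>] by (simp add: max_eq)
  qed
  have benign: "is_arg_min (objective A) (\<lambda>T. T \<in> stiefel_blocks) S \<and> S ** transpose S = Z ** transpose Z"
    if h: "CARD('n) \<ge> 2 \<and> CARD('d) = d \<and> CARD('p) = p \<and>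
          transpose A = A \<and> Z \<in> orthogonal_blocks \<and>
          L = BDG (A ** Z ** transpose Z) - A \<and>
          L ** Z = 0 \<and> psd L \<and> 0 < lambda (d + 1) L \<and>
          lambda_max L / lambda (d + 1) L < alphaG_max p d"
      and crit: "second_order_critical (objective A) S"
    for A :: "real^('n \<times> 'd)^('n \<times> 'd)" and Z :: "real^'d^('n \<times> 'd)" and L and S :: "real^'p^('n \<times> 'd)"
  proof -
    define \<tau> where "\<tau> = (if d = 1 then 0 else \<tau>m)"
    have \<tau>: "0 \<le> \<tau>" "\<tau> \<le> 1" "alphaG_max p d = alphaG p d \<tau>"
      using \<tau>m(1) max1 max_eq by (auto simp: \<tau>_def)
    have c: "CARD('d) = d" "CARD('p) = p" using h by auto
    have n: "2 \<le> CARD('n)" and A: "transpose A = A" and Z: "Z \<in> orthogonal_blocks"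
      and L: "L = BDG (A ** Z ** transpose Z) - A" "L ** Z = 0" "psd L" "0 < lambda (CARD('d) + 1) L"
      and cond: "lambda_max L / lambda (CARD('d) + 1) L < alphaG CARD('p) CARD('d) \<tau>"
      using h unfolding c \<tau>(3) by blast+
    have SS: "S ** transpose S = Z ** transpose Z"
      by (rule benign_landscape[OF n A Z L \<tau>(1,2) _ cond crit])
        (use assms in \<open>simp_all add: c \<tau>_def\<close>)
    have "S \<in> stiefel_blocks" using crit by (simp add: second_order_critical_def)
    then have "is_arg_min (objective A) (\<lambda>T. T \<in> stiefel_blocks) S"
      by (rule global_minimizer[OF L(1-3) _ SS])
    with SS show ?thesis by blast
  qed
  \<comment> \<open>Cases 1 to 5 are the statements for a fixed \<open>\<tau>\<close>, 6 and 7 say that the maximum is attained, 8 and 9 concern its value, 10 is the landscape.\<close>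
  show ?thesis
  proof (intro conjI ballI, goal_cases)
    case (1 \<tau>)
    then show ?case using feasible_iff[OF assms] alphaG_pos[OF assms] by auto
  next
    case (2 \<tau>)
    then show ?case using feasible_iff[OF assms] by auto
  next
    case (3 \<tau>)
    then show ?case unfolding Let_def using alphaG_1_cases[of p \<tau>] assms(2) by auto
  next
    case (4 \<tau>)
    then have \<tau>: "0 \<le> \<tau>" "\<tau> \<le> 1" by auto
    show ?case
      unfolding Let_def alpha_mid_def[symmetric] alpha_low_def[symmetric]
      using alphaG_cases_h_ge_1[OF _ assms(2) \<tau>] by (metis (no_types))
  next
    case (5 \<tau>)
    then have \<tau>: "0 \<le> \<tau>" "\<tau> \<le> 1" by auto
    show ?case
      unfolding Let_def alpha_low_def[symmetric]
      using alphaG_cases_h_le_1[OF _ assms(2) \<tau>] by (metis (no_types))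
  next
    case 6
    show ?case using \<tau>m(1) max_eq by blast
  next
    case (7 \<tau>)
    then show ?case using \<tau>m(2) max_eq by simp
  next
    case 8
    show ?case using max1(1) by blast
  next
    case 9
    show ?case using gt_1 by blast
  next
    case 10
    show ?case by (intro allI impI) (rule benign)
  qed
qed

end
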